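(* Let $\ell$ be a commutative unital ring with involution containing an element $\lambda$ with $\lambda+\lambda^*=1$. The functors $\mathrm{res}:kk^h\to kk$ and $\mathrm{ind}:kk\to kk^h$ are both right and left adjoint to one another; that is, for every $A\in\mathrm{Alg}^*_\ell$ and $B\in\mathrm{Alg}_\ell$ there are natural isomorphisms $$kk(\mathrm{res}(A),B)\cong kk^h(A,\mathrm{ind}(B))\quad\text{and}\quad kk^h(\mathrm{ind}(B),A)\cong kk(B,\mathrm{res}(A)).$$
   Context: Algebras. $\ell$ is a commutative unital ring with an involutive ring automorphism $x\mapsto x^*$. $\mathrm{Alg}_\ell$ is the category of associative, not necessarily unital $\ell$-algebras. A $*$-algebra is an $\ell$-algebra $A$ with an additive map $*:A\to A$, $a^{**}=a$, $(ab)^*=b^*a^*$, $(xa)^*=x^*a^*$ ($x\in\ell$). $\mathrm{Alg}^*_\ell$ is the category of $*$-algebras and involution preserving $\ell$-algebra homomorphisms. $\otimes=\otimes_\ell$, with $(a\otimes b)^*=a^*\otimes b^*$; $LA=L\otimes A$. $A[t]$ has $t^*=t$. For a set $X$, $M_X$ is the $*$-algebra of finitely supported functions $X\times X\to\ell$ with matrix product and $a^*(x,y)=a(y,x)^*$. $M_\pm$ is the algebra of $2\times2$ matrices over $\ell$ with involution $\begin{bmatrix}a&b\\c&d\end{bmatrix}^*=\begin{bmatrix}a^*&-c^*\\-b^*&d^*\end{bmatrix}$, $\iota_+:\ell\to M_\pm$, $x\mapsto xE_{1,1}$. The categories $kk^h$ and $kk$. Fix an infinite set $X$ and an underlying category $\mathfrak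 A$, either sets or $\ell$-modules. A short exact sequence $A\to B\xrightarrow{p}C$ in $\mathrm{Alg}^*_\ell$ or $\mathrm{Alg}_\ell$ (an extension) is semi-split if $p$ has a right inverse in $\mathfrak A$. An excisive homology theory on $\mathrm{Alg}^*_\ell$ (resp. $\mathrm{Alg}_\ell$) with values in a triangulated category $\mathfrak T$ (with suspension written $[-1]$, inverse $[1]$) is a functor $H$ to $\mathfrak T$ with a map $\partial_E:H(C)[1]\to H(A)$ for each semi-split extension $E:A\to B\to C$, compatible with maps of extensions, such that $H(C)[1]\xrightarrow{\partial_E}H(A)\to H(B)\to H(C)$ is a distinguished triangle. $H$ is homotopy invariant if it inverts all inclusions $A\to A[t]$; $M_X$-stable if it inverts $A\to M_XA$, $a\mapsto E_{x,x}\otimes a$ (for some, equivalently any, $x\in X$); and, on $\mathrm{Alg}^*_\ell$, $\iota_+$-stable if it inverts $\iota_+\otimes\mathrm{id}_A:A\to M_\pm A$. $j^h:\mathrm{Alg}^*_\ell\to kk^h$ denotes the universal (initial) excisive, homotopy invariant, $\iota_+$-stable and $M_X$-stable homology theory on $\mathrm{Alg}^*_\ell$, and $j:\mathrm{Alg}_\ell\to kk$ the universal excisive, homotopy invariant, $M_X$-stable homology theory on $\mathrm{Alg}_\ell$ (every other such theory factors uniquely through a triangulated functor). They exist and are the identity on objects; $kk^h(-,-)$ and $kk(-,-)$ denote the hom groups. The functors. $\mathrm{res}:\mathrm{Alg}^*_\ell\to\mathrm{Alg}_\ell$ forgets the involution. $\mathrm{ind}:\mathrm{Alg}_\ell\to\mathrm{Alg}^*_\ell$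 sends $B$ to $B\oplus B^{\mathrm{op}}$ with involution $(x,y)^*=(y,x)$ and $\ell$-action $a\cdot(x,y)=(ax,a^*y)$. By universality they induce triangulated functors, still denoted $\mathrm{res}:kk^h\to kk$ and $\mathrm{ind}:kk\to kk^h$, compatible with $j^h$ and $j$. *)

theory Defs
  imports "HOL-Algebra.Module" "HOL-Algebra.UnivPoly"
begin

section \<open>Categories and functors\<close>

record ('o, 'm) category =
  Obj :: "'o set"
  Arr :: "'m set"
  Dom :: "'m \<Rightarrow> 'o"
  Cod :: "'m \<Rightarrow> 'o"
  Id :: "'o \<Rightarrow> 'm"
  Comp :: "'m \<Rightarrow> 'm \<Rightarrow> 'm" (infixr "\<bullet>\<index>" 75)

definition arrows :: "('o, 'm, 'z) category_scheme \<Rightarrow> 'o \<Rightarrow> 'o \<Rightarrow> 'm set" where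
  "arrows C A B = {f \<in> Arr C. Dom C f = A \<and> Cod C f = B}"

definition is_category :: "('o, 'm, 'z) category_scheme \<Rightarrow> bool" where
  "is_category C \<longleftrightarrow>
    (\<forall>f\<in>Arr C. Dom C f \<in> Obj C \<and> Cod C f \<in> Obj C) \<and>
    (\<forall>A\<in>Obj C. Id C A \<in> arrows C A A) \<and>
    (\<forall>f\<in>Arr C. \<forall>g\<in>Arr C. Cod C f = Dom C g \<longrightarrow> g \<bullet>\<^bsub>C\<^esub> f \<in> arrows C (Dom C f) (Cod C g)) \<and>
    (\<forall>f\<in>Arr C. f \<bullet>\<^bsub>C\<^esub> Id C (Dom C f) = f \<and> Id C (Cod C f) \<bullet>\<^bsub>C\<^esub> f = f) \<and>
    (\<forall>f\<in>Arr C. \<forall>g\<in>Arr C. \<forall>h\<in>Arr C. Cod C f = Dom C g \<and> Cod C g = Dom C h \<longrightarrow>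
      (h \<bullet>\<^bsub>C\<^esub> g) \<bullet>\<^bsub>C\<^esub> f = h \<bullet>\<^bsub>C\<^esub> (g \<bullet>\<^bsub>C\<^esub> f))"

definition iso_arrow :: "('o, 'm, 'z) category_scheme \<Rightarrow> 'm \<Rightarrow> bool" where
  "iso_arrow C f \<longleftrightarrow> f \<in> Arr C \<and>
    (\<exists>g\<in>arrows C (Cod C f) (Dom C f).
      g \<bullet>\<^bsub>C\<^esub> f = Id C (Dom C f) \<and> f \<bullet>\<^bsub>C\<^esub> g = Id C (Cod C f))"

record ('o, 'm, 'p, 'n) func =
  ob :: "'o \<Rightarrow> 'p"
  ar :: "'m \<Rightarrow> 'n"

definition is_functor ::
    "('o, 'm, 'z) category_scheme \<Rightarrow> ('p, 'n, 'w) category_scheme \<Rightarrow> ('o, 'm, 'p, 'n) func \<Rightarrow> bool" where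
  "is_functor C D F \<longleftrightarrow>
    (\<forall>A\<in>Obj C. ob F A \<in> Obj D \<and> ar F (Id C A) = Id D (ob F A)) \<and>
    (\<forall>f\<in>Arr C. ar F f \<in> arrows D (ob F (Dom C f)) (ob F (Cod C f))) \<and>
    (\<forall>f\<in>Arr C. \<forall>g\<in>Arr C. Cod C f = Dom C g \<longrightarrow> ar F (g \<bullet>\<^bsub>C\<^esub> f) = ar F g \<bullet>\<^bsub>D\<^esub> ar F f)"

definition comp_func :: "('p, 'n, 'q, 'k) func \<Rightarrow> ('o, 'm, 'p, 'n) func \<Rightarrow> ('o, 'm, 'q, 'k) func" where
  "comp_func G F = \<lparr>ob = ob G \<circ> ob F, ar = ar G \<circ> ar F\<rparr>"

definition eq_func ::
    "('o, 'm, 'z) category_scheme \<Rightarrow> ('o, 'm, 'p, 'n) func \<Rightarrow> ('o, 'm, 'p, 'n) func \<Rightarrow> bool" where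
  "eq_func C F G \<longleftrightarrow> (\<forall>A\<in>Obj C. ob F A = ob G A) \<and> (\<forall>f\<in>Arr C. ar F f = ar G f)"


section \<open>Triangulated categories\<close>

text \<open>
  The functor \<open>[1]\<close> is written \<open>Loop\<close>; it is an autoequivalence, and the suspension \<open>[-1]\<close>
  is its quasi-inverse.  The triple \<open>(h, f, g)\<close> in \<open>Tri\<close> stands for the distinguished triangle
  \<open>C[1] \<rightarrow> A \<rightarrow> B \<rightarrow> C\<close> with maps \<open>h\<close>, \<open>f\<close>, \<open>g\<close>.
\<close>

record ('o, 'm) tricat = "('o, 'm) category" +
  Add :: "'m \<Rightarrow> 'm \<Rightarrow> 'm"
  Zero :: "'o \<Rightarrow> 'o \<Rightarrow> 'm"
  Loop :: "('o, 'm, 'o, 'm) func"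
  Tri :: "('m \<times> 'm \<times> 'm) set"

definition hom_group :: "('o, 'm) tricat \<Rightarrow> 'o \<Rightarrow> 'o \<Rightarrow> 'm monoid" where
  "hom_group T A B = \<lparr>carrier = arrows T A B, mult = Add T, one = Zero T A B\<rparr>"

definition Neg :: "('o, 'm) tricat \<Rightarrow> 'm \<Rightarrow> 'm" where
  "Neg T f = m_inv (hom_group T (Dom T f) (Cod T f)) f"

definition preadditive :: "('o, 'm) tricat \<Rightarrow> bool" where
  "preadditive T \<longleftrightarrow> is_category T \<and>
    (\<forall>A\<in>Obj T. \<forall>B\<in>Obj T. comm_group (hom_group T A B)) \<and>
    (\<forall>A\<in>Obj T. \<forall>B\<in>Obj T. \<forall>C\<in>Obj T. \<forall>f\<in>arrows T A B. \<forall>f'\<in>arrows T A B.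
      \<forall>g\<in>arrows T B C. \<forall>g'\<in>arrows T B C.
        g \<bullet>\<^bsub>T\<^esub> Add T f f' = Add T (g \<bullet>\<^bsub>T\<^esub> f) (g \<bullet>\<^bsub>T\<^esub> f') \<and>
        Add T g g' \<bullet>\<^bsub>T\<^esub> f = Add T (g \<bullet>\<^bsub>T\<^esub> f) (g' \<bullet>\<^bsub>T\<^esub> f))"

definition zero_object :: "('o, 'm) tricat \<Rightarrow> 'o \<Rightarrow> bool" where
  "zero_object T Z \<longleftrightarrow> Z \<in> Obj T \<and>
    (\<forall>A\<in>Obj T. arrows T A Z = {Zero T A Z} \<and> arrows T Z A = {Zero T Z A})"

definition has_biproduct :: "('o, 'm) tricat \<Rightarrow> 'o \<Rightarrow> 'o \<Rightarrow> bool" where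
  "has_biproduct T A B \<longleftrightarrow>
    (\<exists>P\<in>Obj T. \<exists>i\<in>arrows T A P. \<exists>j\<in>arrows T B P. \<exists>p\<in>arrows T P A. \<exists>q\<in>arrows T P B.
      p \<bullet>\<^bsub>T\<^esub> i = Id T A \<and> q \<bullet>\<^bsub>T\<^esub> j = Id T B \<and>
      p \<bullet>\<^bsub>T\<^esub> j = Zero T B A \<and> q \<bullet>\<^bsub>T\<^esub> i = Zero T A B \<and>
      Add T (i \<bullet>\<^bsub>T\<^esub> p) (j \<bullet>\<^bsub>T\<^esub> q) = Id T P)"

definition additive_category :: "('o, 'm) tricat \<Rightarrow> bool" where
  "additive_category T \<longleftrightarrow> preadditive T \<and> (\<exists>Z. zero_object T Z) \<and>
    (\<forall>A\<in>Obj T. \<forall>B\<in>Obj T. has_biproduct T A B)"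

definition additive_functor :: "('o, 'm) tricat \<Rightarrow> ('p, 'n) tricat \<Rightarrow> ('o, 'm, 'p, 'n) func \<Rightarrow> bool" where
  "additive_functor T T' F \<longleftrightarrow> is_functor T T' F \<and>
    (\<forall>A\<in>Obj T. \<forall>B\<in>Obj T. \<forall>f\<in>arrows T A B. \<forall>g\<in>arrows T A B.
      ar F (Add T f g) = Add T' (ar F f) (ar F g))"

definition autoequivalence :: "('o, 'm) tricat \<Rightarrow> ('o, 'm, 'o, 'm) func \<Rightarrow> bool" where
  "autoequivalence T F \<longleftrightarrow> is_functor T T F \<and>
    (\<forall>A\<in>Obj T. \<forall>B\<in>Obj T. bij_betw (ar F) (arrows T A B) (arrows T (ob F A) (ob F B))) \<and>
    (\<forall>B\<in>Obj T. \<exists>A\<in>Obj T. \<exists>f\<in>arrows T (ob F A) B. iso_arrow T f)"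

definition candidate_triangle :: "('o, 'm) tricat \<Rightarrow> 'm \<Rightarrow> 'm \<Rightarrow> 'm \<Rightarrow> bool" where
  "candidate_triangle T h f g \<longleftrightarrow> h \<in> Arr T \<and> f \<in> Arr T \<and> g \<in> Arr T \<and>
    Dom T h = ob (Loop T) (Cod T g) \<and> Cod T h = Dom T f \<and> Cod T f = Dom T g"

definition triangle_map ::
    "('o, 'm) tricat \<Rightarrow> ('m \<times> 'm \<times> 'm) \<Rightarrow> ('m \<times> 'm \<times> 'm) \<Rightarrow> 'm \<Rightarrow> 'm \<Rightarrow> 'm \<Rightarrow> bool" where
  "triangle_map T = (\<lambda>(h, f, g) (h', f', g') a b c.
    a \<in> arrows T (Dom T f) (Dom T f') \<and>
    b \<in> arrows T (Dom T g) (Dom T g') \<and>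
    c \<in> arrows T (Cod T g) (Cod T g') \<and>
    a \<bullet>\<^bsub>T\<^esub> h = h' \<bullet>\<^bsub>T\<^esub> ar (Loop T) c \<and> b \<bullet>\<^bsub>T\<^esub> f = f' \<bullet>\<^bsub>T\<^esub> a \<and> c \<bullet>\<^bsub>T\<^esub> g = g' \<bullet>\<^bsub>T\<^esub> b)"

text \<open>
  The usual axioms (TR1)--(TR4), written for triangles \<open>C[1] \<rightarrow> A \<rightarrow> B \<rightarrow> C\<close>: they say that the
  opposite category, with \<open>[1]\<close> as its shift, satisfies Verdier's axioms.
  The last clause is the octahedral axiom for \<open>g : B \<rightarrow> C\<close> and \<open>k : C \<rightarrow> D\<close>.
\<close>

definition triangulated :: "('o, 'm) tricat \<Rightarrow> bool" where
  "triangulated T \<longleftrightarrow>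
    additive_category T \<and> autoequivalence T (Loop T) \<and> additive_functor T T (Loop T) \<and>
    (\<forall>(h, f, g)\<in>Tri T. candidate_triangle T h f g) \<and>
    (\<forall>h f g h' f' g' a b c.
      (h, f, g) \<in> Tri T \<and> candidate_triangle T h' f' g' \<and>
      triangle_map T (h, f, g) (h', f', g') a b c \<and>
      iso_arrow T a \<and> iso_arrow T b \<and> iso_arrow T c \<longrightarrow> (h', f', g') \<in> Tri T) \<and>
    (\<forall>A\<in>Obj T. \<forall>Z. zero_object T Z \<longrightarrow> (Zero T (ob (Loop T) A) Z, Zero T Z A, Id T A) \<in> Tri T) \<and>
    (\<forall>g\<in>Arr T. \<exists>h f. (h, f, g) \<in> Tri T) \<and>
    (\<forall>h f g. candidate_triangle T h f g \<longrightarrow>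
      ((h, f, g) \<in> Tri T \<longleftrightarrow> (Neg T (ar (Loop T) g), h, f) \<in> Tri T)) \<and>
    (\<forall>h f g h' f' g' b c.
      (h, f, g) \<in> Tri T \<and> (h', f', g') \<in> Tri T \<and>
      b \<in> arrows T (Dom T g) (Dom T g') \<and> c \<in> arrows T (Cod T g) (Cod T g') \<and>
      c \<bullet>\<^bsub>T\<^esub> g = g' \<bullet>\<^bsub>T\<^esub> b \<longrightarrow>
      (\<exists>a. triangle_map T (h, f, g) (h', f', g') a b c)) \<and>
    (\<forall>g k h1 f1 h2 f2 h3 f3.
      Cod T g = Dom T k \<and>
      (h1, f1, g) \<in> Tri T \<and> (h2, f2, k) \<in> Tri T \<and> (h3, f3, k \<bullet>\<^bsub>T\<^esub> g) \<in> Tri T \<longrightarrow>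
      (\<exists>a\<in>arrows T (Dom T f1) (Dom T f3). \<exists>e\<in>arrows T (Dom T f3) (Dom T f2).
        (h1 \<bullet>\<^bsub>T\<^esub> ar (Loop T) f2, a, e) \<in> Tri T \<and>
        f3 \<bullet>\<^bsub>T\<^esub> a = f1 \<and> f2 \<bullet>\<^bsub>T\<^esub> e = g \<bullet>\<^bsub>T\<^esub> f3 \<and>
        e \<bullet>\<^bsub>T\<^esub> h3 = h2 \<and> a \<bullet>\<^bsub>T\<^esub> h1 = h3 \<bullet>\<^bsub>T\<^esub> ar (Loop T) k))"

text \<open>
  A triangulated functor is a functor \<open>F\<close> together with a natural isomorphism
  \<open>\<phi> A : (F A)[1] \<rightarrow> F (A[1])\<close> through which it preserves distinguished triangles.
\<close>

definition triangulated_functor ::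
    "('o, 'm) tricat \<Rightarrow> ('p, 'n) tricat \<Rightarrow> ('o, 'm, 'p, 'n) func \<Rightarrow> ('o \<Rightarrow> 'n) \<Rightarrow> bool" where
  "triangulated_functor T T' F \<phi> \<longleftrightarrow> additive_functor T T' F \<and>
    (\<forall>A\<in>Obj T. \<phi> A \<in> arrows T' (ob (Loop T') (ob F A)) (ob F (ob (Loop T) A)) \<and>
      iso_arrow T' (\<phi> A)) \<and>
    (\<forall>f\<in>Arr T. ar F (ar (Loop T) f) \<bullet>\<^bsub>T'\<^esub> \<phi> (Dom T f) =
      \<phi> (Cod T f) \<bullet>\<^bsub>T'\<^esub> ar (Loop T') (ar F f)) \<and>
    (\<forall>(h, f, g)\<in>Tri T. (ar F h \<bullet>\<^bsub>T'\<^esub> \<phi> (Cod T g), ar F f, ar F g) \<in> Tri T')"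


section \<open>Algebras and \<open>*\<close>-algebras\<close>

text \<open>
  The ground ring, the index set \<open>X\<close> of matrices and the carriers of all algebras live in one type
  \<open>'u\<close>, which plays the role of a universe; carriers are arbitrary subsets of it.  Algebras are
  not assumed unital: the field \<open>one\<close> of the library record is ignored throughout.
\<close>

record ('a, 'b) star_alg = "('a, 'b) module" +
  star :: "'b \<Rightarrow> 'b"

definition involutive_ring :: "'a ring \<Rightarrow> ('a \<Rightarrow> 'a) \<Rightarrow> bool" where
  "involutive_ring l \<sigma> \<longleftrightarrow> cring l \<and> \<sigma> \<in> ring_hom l l \<and> (\<forall>x\<in>carrier l. \<sigma> (\<sigma> x) = x)"

definition is_algebra :: "'a ring \<Rightarrow> ('a, 'b, 'z) module_scheme \<Rightarrow> bool" where
  "is_algebra l A \<longleftrightarrow> module l A \<and>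
    (\<forall>x\<in>carrier A. \<forall>y\<in>carrier A. x \<otimes>\<^bsub>A\<^esub> y \<in> carrier A) \<and>
    (\<forall>x\<in>carrier A. \<forall>y\<in>carrier A. \<forall>z\<in>carrier A.
      (x \<otimes>\<^bsub>A\<^esub> y) \<otimes>\<^bsub>A\<^esub> z = x \<otimes>\<^bsub>A\<^esub> (y \<otimes>\<^bsub>A\<^esub> z) \<and>
      (x \<oplus>\<^bsub>A\<^esub> y) \<otimes>\<^bsub>A\<^esub> z = x \<otimes>\<^bsub>A\<^esub> z \<oplus>\<^bsub>A\<^esub> y \<otimes>\<^bsub>A\<^esub> z \<and>
      x \<otimes>\<^bsub>A\<^esub> (y \<oplus>\<^bsub>A\<^esub> z) = x \<otimes>\<^bsub>A\<^esub> y \<oplus>\<^bsub>A\<^esub> x \<otimes>\<^bsub>A\<^esub> z) \<and>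
    (\<forall>r\<in>carrier l. \<forall>x\<in>carrier A. \<forall>y\<in>carrier A.
      (r \<odot>\<^bsub>A\<^esub> x) \<otimes>\<^bsub>A\<^esub> y = r \<odot>\<^bsub>A\<^esub> (x \<otimes>\<^bsub>A\<^esub> y) \<and> x \<otimes>\<^bsub>A\<^esub> (r \<odot>\<^bsub>A\<^esub> y) = r \<odot>\<^bsub>A\<^esub> (x \<otimes>\<^bsub>A\<^esub> y))"

definition is_star_algebra :: "'a ring \<Rightarrow> ('a \<Rightarrow> 'a) \<Rightarrow> ('a, 'b) star_alg \<Rightarrow> bool" where
  "is_star_algebra l \<sigma> A \<longleftrightarrow> is_algebra l A \<and>
    (\<forall>x\<in>carrier A. star A x \<in> carrier A \<and> star A (star A x) = x) \<and>
    (\<forall>x\<in>carrier A. \<forall>y\<in>carrier A.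
      star A (x \<oplus>\<^bsub>A\<^esub> y) = star A x \<oplus>\<^bsub>A\<^esub> star A y \<and> star A (x \<otimes>\<^bsub>A\<^esub> y) = star A y \<otimes>\<^bsub>A\<^esub> star A x) \<and>
    (\<forall>r\<in>carrier l. \<forall>x\<in>carrier A. star A (r \<odot>\<^bsub>A\<^esub> x) = \<sigma> r \<odot>\<^bsub>A\<^esub> star A x)"

definition linear_maps ::
    "'a ring \<Rightarrow> ('a, 'b, 'z) module_scheme \<Rightarrow> ('a, 'c, 'w) module_scheme \<Rightarrow> ('b \<Rightarrow> 'c) set" where
  "linear_maps l M N = {f \<in> carrier M \<rightarrow> carrier N.
    (\<forall>x\<in>carrier M. \<forall>y\<in>carrier M. f (x \<oplus>\<^bsub>M\<^esub> y) = f x \<oplus>\<^bsub>N\<^esub> f y) \<and>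
    (\<forall>r\<in>carrier l. \<forall>x\<in>carrier M. f (r \<odot>\<^bsub>M\<^esub> x) = r \<odot>\<^bsub>N\<^esub> f x)}"

definition alg_homs ::
    "'a ring \<Rightarrow> ('a, 'b, 'z) module_scheme \<Rightarrow> ('a, 'c, 'w) module_scheme \<Rightarrow> ('b \<Rightarrow> 'c) set" where
  "alg_homs l A B = {f \<in> linear_maps l A B.
    \<forall>x\<in>carrier A. \<forall>y\<in>carrier A. f (x \<otimes>\<^bsub>A\<^esub> y) = f x \<otimes>\<^bsub>B\<^esub> f y}"

definition star_homs ::
    "'a ring \<Rightarrow> ('a, 'b) star_alg \<Rightarrow> ('a, 'c) star_alg \<Rightarrow> ('b \<Rightarrow> 'c) set" where
  "star_homs l A B = {f \<in> alg_homs l A B. \<forall>x\<in>carrier A. f (star A x) = star B (f x)}"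

text \<open>An arrow is a triple of source, (extensional) underlying function and target.\<close>

type_synonym ('u, 'A) algebra_arrow = "'A \<times> ('u \<Rightarrow> 'u) \<times> 'A"

definition arrow ::
    "('u, 'u, 'z) module_scheme \<Rightarrow> ('u \<Rightarrow> 'u) \<Rightarrow> ('u, 'u, 'z) module_scheme \<Rightarrow>
      ('u, ('u, 'u, 'z) module_scheme) algebra_arrow" where
  "arrow A f B = (A, restrict f (carrier A), B)"

type_synonym 'u alg_arrow = "('u, ('u, 'u) module) algebra_arrow"
type_synonym 'u star_alg_arrow = "('u, ('u, 'u) star_alg) algebra_arrow"

definition concrete_category ::
    "('u, 'u, 'z) module_scheme set \<Rightarrow>
      (('u, 'u, 'z) module_scheme \<Rightarrow> ('u, 'u, 'z) module_scheme \<Rightarrow> ('u \<Rightarrow> 'u) set) \<Rightarrow>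
      (('u, 'u, 'z) module_scheme, ('u, ('u, 'u, 'z) module_scheme) algebra_arrow) category" where
  "concrete_category Ob Homs = \<lparr>
    Obj = Ob,
    Arr = {(A, f, B). A \<in> Ob \<and> B \<in> Ob \<and> f \<in> Homs A B \<inter> extensional (carrier A)},
    Dom = (\<lambda>(A, f, B). A),
    Cod = (\<lambda>(A, f, B). B),
    Id = (\<lambda>A. arrow A (\<lambda>x. x) A),
    Comp = (\<lambda>(B', g, C) (A, f, B). arrow A (g \<circ> f) C)\<rparr>"

definition Alg ::
    "'u ring \<Rightarrow> (('u, 'u) module, 'u alg_arrow) category" where
  "Alg l = concrete_category {A :: ('u, 'u) module. is_algebra l A} (alg_homs l)"

definition StarAlg ::
    "'u ring \<Rightarrow> ('u \<Rightarrow> 'u) \<Rightarrow> (('u, 'u) star_alg, 'u star_alg_arrow) category" where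
  "StarAlg l \<sigma> = concrete_category {A :: ('u, 'u) star_alg. is_star_algebra l \<sigma> A} (star_homs l)"


subsection \<open>Polynomials, matrices and tensor products\<close>

definition poly_alg :: "('a, 'b, 'z) module_scheme \<Rightarrow> ('a, nat \<Rightarrow> 'b) module" where
  "poly_alg A = \<lparr>carrier = up A, mult = mult (UP A), one = zero (UP A), zero = zero (UP A),
    add = add (UP A), smult = (\<lambda>r p n. r \<odot>\<^bsub>A\<^esub> p n)\<rparr>"

definition poly_star_alg :: "('a, 'b) star_alg \<Rightarrow> ('a, nat \<Rightarrow> 'b) star_alg" where
  "poly_star_alg A = module.extend (poly_alg A) \<lparr>star = (\<lambda>p n. star A (p n))\<rparr>"

text \<open>A finitely supported function on \<open>X \<times> X\<close> is extended by zero to the whole type.\<close>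

definition mat_alg :: "'a ring \<Rightarrow> 'i set \<Rightarrow> ('a, 'i \<times> 'i \<Rightarrow> 'a) module" where
  "mat_alg l X = \<lparr>
    carrier = {a. (\<forall>p. a p \<in> carrier l) \<and> finite {p. a p \<noteq> \<zero>\<^bsub>l\<^esub>} \<and> {p. a p \<noteq> \<zero>\<^bsub>l\<^esub>} \<subseteq> X \<times> X},
    mult = (\<lambda>a b (x, z). \<Oplus>\<^bsub>l\<^esub>y\<in>{y. a (x, y) \<noteq> \<zero>\<^bsub>l\<^esub>}. a (x, y) \<otimes>\<^bsub>l\<^esub> b (y, z)),
    one = (\<lambda>p. \<zero>\<^bsub>l\<^esub>),
    zero = (\<lambda>p. \<zero>\<^bsub>l\<^esub>),
    add = (\<lambda>a b p. a p \<oplus>\<^bsub>l\<^esub> b p),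
    smult = (\<lambda>r a p. r \<otimes>\<^bsub>l\<^esub> a p)\<rparr>"

definition mat_star_alg :: "'a ring \<Rightarrow> ('a \<Rightarrow> 'a) \<Rightarrow> 'i set \<Rightarrow> ('a, 'i \<times> 'i \<Rightarrow> 'a) star_alg" where
  "mat_star_alg l \<sigma> X = module.extend (mat_alg l X) \<lparr>star = (\<lambda>a (x, y). \<sigma> (a (y, x)))\<rparr>"

definition mat_unit :: "'a ring \<Rightarrow> 'i \<Rightarrow> 'i \<Rightarrow> 'i \<times> 'i \<Rightarrow> 'a" where
  "mat_unit l x y = (\<lambda>p. if p = (x, y) then \<one>\<^bsub>l\<^esub> else \<zero>\<^bsub>l\<^esub>)"

text \<open>
  \<open>M\<^sub>\<plusminus>\<close>: two by two matrices with rows and columns indexed by \<open>1, 2\<close>; the involution sends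
  \<open>(a b; c d)\<close> to \<open>(a* -c*; -b* d*)\<close>.
\<close>

definition M_pm :: "'a ring \<Rightarrow> ('a \<Rightarrow> 'a) \<Rightarrow> ('a, nat \<times> nat \<Rightarrow> 'a) star_alg" where
  "M_pm l \<sigma> = module.extend (mat_alg l {1, 2})
    \<lparr>star = (\<lambda>a (x, y). if x = y then \<sigma> (a (x, x)) else \<ominus>\<^bsub>l\<^esub> \<sigma> (a (y, x)))\<rparr>"

definition bilinear_maps ::
    "'a ring \<Rightarrow> ('a, 'b, 'z) module_scheme \<Rightarrow> ('a, 'c, 'w) module_scheme \<Rightarrow>
      ('a, 'd, 'v) module_scheme \<Rightarrow> ('b \<Rightarrow> 'c \<Rightarrow> 'd) set" where
  "bilinear_maps l L A P = {\<tau>.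
    (\<forall>m\<in>carrier L. \<tau> m \<in> linear_maps l A P) \<and>
    (\<forall>a\<in>carrier A. (\<lambda>m. \<tau> m a) \<in> linear_maps l L P)}"

text \<open>
  \<open>P\<close> with \<open>\<tau>\<close> is the tensor product of \<open>L\<close> and \<open>A\<close> over \<open>l\<close>, as a module by its universal
  property (with respect to modules in the universe), with the products
  \<open>(m \<otimes> a) (m' \<otimes> a') = m m' \<otimes> a a'\<close>.
\<close>

definition is_tensor ::
    "'u ring \<Rightarrow> ('u, 'b, 'z) module_scheme \<Rightarrow> ('u, 'u, 'w) module_scheme \<Rightarrow>
      ('u, 'u, 'w) module_scheme \<Rightarrow> ('b \<Rightarrow> 'u \<Rightarrow> 'u) \<Rightarrow> bool" where
  "is_tensor l L A P \<tau> \<longleftrightarrow> is_algebra l P \<and> \<tau> \<in> bilinear_maps l L A P \<and>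
    (\<forall>N :: ('u, 'u) module. \<forall>\<beta>. module l N \<and> \<beta> \<in> bilinear_maps l L A N \<longrightarrow>
      (\<exists>!f. f \<in> linear_maps l P N \<inter> extensional (carrier P) \<and>
        (\<forall>m\<in>carrier L. \<forall>a\<in>carrier A. f (\<tau> m a) = \<beta> m a))) \<and>
    (\<forall>m\<in>carrier L. \<forall>m'\<in>carrier L. \<forall>a\<in>carrier A. \<forall>a'\<in>carrier A.
      \<tau> m a \<otimes>\<^bsub>P\<^esub> \<tau> m' a' = \<tau> (m \<otimes>\<^bsub>L\<^esub> m') (a \<otimes>\<^bsub>A\<^esub> a'))"

definition is_star_tensor ::
    "'u ring \<Rightarrow> ('u \<Rightarrow> 'u) \<Rightarrow> ('u, 'b) star_alg \<Rightarrow> ('u, 'u) star_alg \<Rightarrow>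
      ('u, 'u) star_alg \<Rightarrow> ('b \<Rightarrow> 'u \<Rightarrow> 'u) \<Rightarrow> bool" where
  "is_star_tensor l \<sigma> L A P \<tau> \<longleftrightarrow> is_star_algebra l \<sigma> P \<and> is_tensor l L A P \<tau> \<and>
    (\<forall>m\<in>carrier L. \<forall>a\<in>carrier A. star P (\<tau> m a) = \<tau> (star L m) (star A a))"


section \<open>Homology theories\<close>

datatype underlying = Sets | Modules

definition semi_split_extensions ::
    "'u ring \<Rightarrow> underlying \<Rightarrow>
      (('u, 'u, 'z) module_scheme, ('u, ('u, 'u, 'z) module_scheme) algebra_arrow) category \<Rightarrow>
      (('u, ('u, 'u, 'z) module_scheme) algebra_arrow \<times>
       ('u, ('u, 'u, 'z) module_scheme) algebra_arrow) set" where
  "semi_split_extensions l U Cat = {((A, i, B), (B', p, C)).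
    (A, i, B) \<in> Arr Cat \<and> (B', p, C) \<in> Arr Cat \<and> B' = B \<and>
    inj_on i (carrier A) \<and> i ` carrier A = {b \<in> carrier B. p b = \<zero>\<^bsub>C\<^esub>} \<and> p ` carrier B = carrier C \<and>
    (\<exists>s. s \<in> (case U of Sets \<Rightarrow> carrier C \<rightarrow> carrier B | Modules \<Rightarrow> linear_maps l C B) \<and>
      (\<forall>c\<in>carrier C. p (s c) = c))}"

definition excisive ::
    "('o, 'm, 'z) category_scheme \<Rightarrow> ('m \<times> 'm) set \<Rightarrow> ('p, 'n) tricat \<Rightarrow>
      ('o, 'm, 'p, 'n) func \<Rightarrow> ('m \<times> 'm \<Rightarrow> 'n) \<Rightarrow> bool" where
  "excisive C Ext T H \<delta> \<longleftrightarrow> triangulated T \<and> is_functor C T H \<and>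
    (\<forall>(i, p)\<in>Ext. (\<delta> (i, p), ar H i, ar H p) \<in> Tri T) \<and>
    (\<forall>(i, p)\<in>Ext. \<forall>(i', p')\<in>Ext.
      \<forall>a\<in>arrows C (Dom C i) (Dom C i'). \<forall>b\<in>arrows C (Cod C i) (Cod C i').
      \<forall>c\<in>arrows C (Cod C p) (Cod C p').
        b \<bullet>\<^bsub>C\<^esub> i = i' \<bullet>\<^bsub>C\<^esub> a \<and> c \<bullet>\<^bsub>C\<^esub> p = p' \<bullet>\<^bsub>C\<^esub> b \<longrightarrow>
        ar H a \<bullet>\<^bsub>T\<^esub> \<delta> (i, p) = \<delta> (i', p') \<bullet>\<^bsub>T\<^esub> ar (Loop T) (ar H c))"

text \<open>
  \<open>A[t]\<close>, \<open>M\<^sub>X A\<close> and \<open>M\<^sub>\<plusminus> A\<close> are objects of the category only up to isomorphism, their literal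
  carriers being of other types.  So a functor inverts, say, \<open>A \<rightarrow> A[t]\<close> if it inverts the
  composite of it with every isomorphism \<open>e\<close> from \<open>A[t]\<close> to an object \<open>P\<close>; for tensor products all
  objects \<open>P\<close> with the universal property are considered.
\<close>

definition homotopy_invariant ::
    "'u ring \<Rightarrow> ('p, 'n) tricat \<Rightarrow> (('u, 'u) module, 'u alg_arrow, 'p, 'n) func \<Rightarrow> bool" where
  "homotopy_invariant l T H \<longleftrightarrow>
    (\<forall>A :: ('u, 'u) module. \<forall>P e. is_algebra l A \<and> is_algebra l P \<and>
      e \<in> alg_homs l (poly_alg A) P \<and> bij_betw e (carrier (poly_alg A)) (carrier P) \<longrightarrow>
      iso_arrow T (ar H (arrow A (\<lambda>a. e (monom (UP A) a 0)) P)))"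

definition star_homotopy_invariant ::
    "'u ring \<Rightarrow> ('u \<Rightarrow> 'u) \<Rightarrow> ('p, 'n) tricat \<Rightarrow> (('u, 'u) star_alg, 'u star_alg_arrow, 'p, 'n) func \<Rightarrow> bool" where
  "star_homotopy_invariant l \<sigma> T H \<longleftrightarrow>
    (\<forall>A :: ('u, 'u) star_alg. \<forall>P e. is_star_algebra l \<sigma> A \<and> is_star_algebra l \<sigma> P \<and>
      e \<in> star_homs l (poly_star_alg A) P \<and>
      bij_betw e (carrier (poly_star_alg A)) (carrier P) \<longrightarrow>
      iso_arrow T (ar H (arrow A (\<lambda>a. e (monom (UP A) a 0)) P)))"

definition matrix_stable ::
    "'u ring \<Rightarrow> 'u set \<Rightarrow> ('p, 'n) tricat \<Rightarrow> (('u, 'u) module, 'u alg_arrow, 'p, 'n) func \<Rightarrow> bool" where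
  "matrix_stable l X T H \<longleftrightarrow>
    (\<exists>x\<in>X. \<forall>A P \<tau>. is_algebra l A \<and> is_tensor l (mat_alg l X) (A :: ('u, 'u) module) P \<tau> \<longrightarrow>
      iso_arrow T (ar H (arrow A (\<tau> (mat_unit l x x)) P)))"

definition star_matrix_stable ::
    "'u ring \<Rightarrow> ('u \<Rightarrow> 'u) \<Rightarrow> 'u set \<Rightarrow> ('p, 'n) tricat \<Rightarrow> (('u, 'u) star_alg, 'u star_alg_arrow, 'p, 'n) func \<Rightarrow> bool" where
  "star_matrix_stable l \<sigma> X T H \<longleftrightarrow>
    (\<exists>x\<in>X. \<forall>A P \<tau>. is_star_algebra l \<sigma> A \<and> is_star_tensor l \<sigma> (mat_star_alg l \<sigma> X) A P \<tau> \<longrightarrow>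
      iso_arrow T (ar H (arrow A (\<tau> (mat_unit l x x)) P)))"

text \<open>Under \<open>l \<otimes> A = A\<close>, the map \<open>\<iota>\<^sub>+ \<otimes> id\<close> sends \<open>a\<close> to \<open>E\<^sub>1\<^sub>1 \<otimes> a\<close>.\<close>

definition iota_stable ::
    "'u ring \<Rightarrow> ('u \<Rightarrow> 'u) \<Rightarrow> ('p, 'n) tricat \<Rightarrow> (('u, 'u) star_alg, 'u star_alg_arrow, 'p, 'n) func \<Rightarrow> bool" where
  "iota_stable l \<sigma> T H \<longleftrightarrow>
    (\<forall>A P \<tau>. is_star_algebra l \<sigma> A \<and> is_star_tensor l \<sigma> (M_pm l \<sigma>) A P \<tau> \<longrightarrow>
      iso_arrow T (ar H (arrow A (\<tau> (mat_unit l 1 1)) P)))"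

definition kk_theory ::
    "'u ring \<Rightarrow> underlying \<Rightarrow> 'u set \<Rightarrow> ('p, 'n) tricat \<Rightarrow>
      (('u, 'u) module, 'u alg_arrow, 'p, 'n) func \<Rightarrow> ('u alg_arrow \<times> 'u alg_arrow \<Rightarrow> 'n) \<Rightarrow> bool" where
  "kk_theory l U X T H \<delta> \<longleftrightarrow>
    excisive (Alg l) (semi_split_extensions l U (Alg l)) T H \<delta> \<and>
    homotopy_invariant l T H \<and> matrix_stable l X T H"

definition kkh_theory ::
    "'u ring \<Rightarrow> ('u \<Rightarrow> 'u) \<Rightarrow> underlying \<Rightarrow> 'u set \<Rightarrow> ('p, 'n) tricat \<Rightarrow>
      (('u, 'u) star_alg, 'u star_alg_arrow, 'p, 'n) func \<Rightarrow> ('u star_alg_arrow \<times> 'u star_alg_arrow \<Rightarrow> 'n) \<Rightarrow> bool" where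
  "kkh_theory l \<sigma> U X T H \<delta> \<longleftrightarrow>
    excisive (StarAlg l \<sigma>) (semi_split_extensions l U (StarAlg l \<sigma>)) T H \<delta> \<and>
    star_homotopy_invariant l \<sigma> T H \<and> iota_stable l \<sigma> T H \<and> star_matrix_stable l \<sigma> X T H"

definition factors_through ::
    "('o, 'm, 'z) category_scheme \<Rightarrow> ('m \<times> 'm) set \<Rightarrow>
      ('p, 'n) tricat \<Rightarrow> ('o, 'm, 'p, 'n) func \<Rightarrow> ('m \<times> 'm \<Rightarrow> 'n) \<Rightarrow>
      ('q, 'k) tricat \<Rightarrow> ('o, 'm, 'q, 'k) func \<Rightarrow> ('m \<times> 'm \<Rightarrow> 'k) \<Rightarrow>
      ('p, 'n, 'q, 'k) func \<Rightarrow> ('p \<Rightarrow> 'k) \<Rightarrow> bool" where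
  "factors_through C Ext K J \<delta>J T H \<delta>H F \<phi> \<longleftrightarrow> triangulated_functor K T F \<phi> \<and>
    eq_func C H (comp_func F J) \<and>
    (\<forall>(i, p)\<in>Ext. \<delta>H (i, p) = ar F (\<delta>J (i, p)) \<bullet>\<^bsub>T\<^esub> \<phi> (ob J (Cod C p)))"

definition factors_uniquely ::
    "('o, 'm, 'z) category_scheme \<Rightarrow> ('m \<times> 'm) set \<Rightarrow>
      ('p, 'n) tricat \<Rightarrow> ('o, 'm, 'p, 'n) func \<Rightarrow> ('m \<times> 'm \<Rightarrow> 'n) \<Rightarrow>
      ('q, 'k) tricat \<Rightarrow> ('o, 'm, 'q, 'k) func \<Rightarrow> ('m \<times> 'm \<Rightarrow> 'k) \<Rightarrow> bool" where
  "factors_uniquely C Ext K J \<delta>J T H \<delta>H \<longleftrightarrow>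
    (\<exists>F \<phi>. factors_through C Ext K J \<delta>J T H \<delta>H F \<phi>) \<and>
    (\<forall>F \<phi> F' \<phi>'. factors_through C Ext K J \<delta>J T H \<delta>H F \<phi> \<and>
      factors_through C Ext K J \<delta>J T H \<delta>H F' \<phi>' \<longrightarrow>
      eq_func K F F' \<and> (\<forall>A\<in>Obj K. \<phi> A = \<phi>' A))"

text \<open>
  \<open>K\<close> with \<open>J\<close> and its boundary maps is initial among the theories with values in a triangulated
  category whose objects and arrows have the types \<open>'q\<close>, \<open>'k\<close> given by the last argument (types
  cannot be quantified inside a formula).
\<close>

definition universal_kk ::
    "'u ring \<Rightarrow> underlying \<Rightarrow> 'u set \<Rightarrow> (('u, 'u) module, 'n) tricat \<Rightarrow>
      (('u, 'u) module, 'u alg_arrow, ('u, 'u) module, 'n) func \<Rightarrow> ('u alg_arrow \<times> 'u alg_arrow \<Rightarrow> 'n) \<Rightarrow> ('q \<times> 'k) itself \<Rightarrow> bool" where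
  "universal_kk l U X K J \<delta>J Ty \<longleftrightarrow>
    kk_theory l U X K J \<delta>J \<and> Obj K = Obj (Alg l) \<and> (\<forall>A\<in>Obj (Alg l). ob J A = A) \<and>
    (\<forall>(T :: ('q, 'k) tricat) H \<delta>H. kk_theory l U X T H \<delta>H \<longrightarrow>
      factors_uniquely (Alg l) (semi_split_extensions l U (Alg l)) K J \<delta>J T H \<delta>H)"

definition universal_kkh ::
    "'u ring \<Rightarrow> ('u \<Rightarrow> 'u) \<Rightarrow> underlying \<Rightarrow> 'u set \<Rightarrow> (('u, 'u) star_alg, 'm) tricat \<Rightarrow>
      (('u, 'u) star_alg, 'u star_alg_arrow, ('u, 'u) star_alg, 'm) func \<Rightarrow> ('u star_alg_arrow \<times> 'u star_alg_arrow \<Rightarrow> 'm) \<Rightarrow> ('q \<times> 'k) itself \<Rightarrow> bool" where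
  "universal_kkh l \<sigma> U X K J \<delta>J Ty \<longleftrightarrow>
    kkh_theory l \<sigma> U X K J \<delta>J \<and> Obj K = Obj (StarAlg l \<sigma>) \<and> (\<forall>A\<in>Obj (StarAlg l \<sigma>). ob J A = A) \<and>
    (\<forall>(T :: ('q, 'k) tricat) H \<delta>H. kkh_theory l \<sigma> U X T H \<delta>H \<longrightarrow>
      factors_uniquely (StarAlg l \<sigma>) (semi_split_extensions l U (StarAlg l \<sigma>)) K J \<delta>J T H \<delta>H)"


section \<open>Restriction and induction\<close>

definition res_alg ::
    "(('u, 'u) star_alg, 'u star_alg_arrow, ('u, 'u) module, 'u alg_arrow) func" where
  "res_alg = \<lparr>ob = module.truncate,
    ar = (\<lambda>(A, f, B). arrow (module.truncate A) f (module.truncate B))\<rparr>"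

definition ind_object :: "('a \<Rightarrow> 'a) \<Rightarrow> ('a, 'b) module \<Rightarrow> ('a, 'b \<times> 'b) star_alg" where
  "ind_object \<sigma> B = \<lparr>carrier = carrier B \<times> carrier B,
    mult = (\<lambda>(x, y) (x', y'). (x \<otimes>\<^bsub>B\<^esub> x', y' \<otimes>\<^bsub>B\<^esub> y)),
    one = (\<zero>\<^bsub>B\<^esub>, \<zero>\<^bsub>B\<^esub>),
    zero = (\<zero>\<^bsub>B\<^esub>, \<zero>\<^bsub>B\<^esub>),
    add = (\<lambda>(x, y) (x', y'). (x \<oplus>\<^bsub>B\<^esub> x', y \<oplus>\<^bsub>B\<^esub> y')),
    smult = (\<lambda>r (x, y). (r \<odot>\<^bsub>B\<^esub> x, \<sigma> r \<odot>\<^bsub>B\<^esub> y)),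
    star = (\<lambda>(x, y). (y, x))\<rparr>"

definition transport :: "('b \<Rightarrow> 'c) \<Rightarrow> ('a, 'b) star_alg \<Rightarrow> ('a, 'c) star_alg" where
  "transport e A = (let d = inv_into (carrier A) e in
    \<lparr>carrier = e ` carrier A,
    mult = (\<lambda>x y. e (d x \<otimes>\<^bsub>A\<^esub> d y)),
    one = e \<one>\<^bsub>A\<^esub>,
    zero = e \<zero>\<^bsub>A\<^esub>,
    add = (\<lambda>x y. e (d x \<oplus>\<^bsub>A\<^esub> d y)),
    smult = (\<lambda>r x. e (r \<odot>\<^bsub>A\<^esub> d x)),
    star = (\<lambda>x. e (star A (d x)))\<rparr>)"

text \<open>The injection \<open>pr\<close> encodes pairs, so that \<open>B \<oplus> B\<^sup>o\<^sup>p\<close> becomes an object of \<open>StarAlg\<close>.\<close>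

definition ind_alg ::
    "('u \<Rightarrow> 'u) \<Rightarrow> ('u \<times> 'u \<Rightarrow> 'u) \<Rightarrow> (('u, 'u) module, 'u alg_arrow, ('u, 'u) star_alg, 'u star_alg_arrow) func" where
  "ind_alg \<sigma> pr =
    \<lparr>ob = (\<lambda>B. transport pr (ind_object \<sigma> B)),
     ar = (\<lambda>(B, f, C). arrow (transport pr (ind_object \<sigma> B))
       (\<lambda>z. pr (map_prod f f (inv_into UNIV pr z))) (transport pr (ind_object \<sigma> C)))\<rparr>"

text \<open>
  The theory \<open>H \<circ> R\<close> on the source of a functor \<open>R\<close> has as boundary map of an extension that of
  its image under \<open>R\<close>.  Thus \<open>res\<close> and \<open>ind\<close> on the level of \<open>kk\<close> are given by the factorizations
  of \<open>j \<circ> res\<close> and \<open>j\<^sup>h \<circ> ind\<close>.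
\<close>

definition pull_boundary :: "('m \<times> 'm \<Rightarrow> 'n) \<Rightarrow> ('o, 'k, 'p, 'm) func \<Rightarrow> 'k \<times> 'k \<Rightarrow> 'n" where
  "pull_boundary \<delta> R = \<delta> \<circ> map_prod (ar R) (ar R)"

definition induced_res ::
    "'u ring \<Rightarrow> ('u \<Rightarrow> 'u) \<Rightarrow> underlying \<Rightarrow>
      (('u, 'u) star_alg, 'm) tricat \<Rightarrow> (('u, 'u) star_alg, 'u star_alg_arrow, ('u, 'u) star_alg, 'm) func \<Rightarrow> ('u star_alg_arrow \<times> 'u star_alg_arrow \<Rightarrow> 'm) \<Rightarrow>
      (('u, 'u) module, 'n) tricat \<Rightarrow> (('u, 'u) module, 'u alg_arrow, ('u, 'u) module, 'n) func \<Rightarrow> ('u alg_arrow \<times> 'u alg_arrow \<Rightarrow> 'n) \<Rightarrow>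
      (('u, 'u) star_alg, 'm, ('u, 'u) module, 'n) func \<Rightarrow> (('u, 'u) star_alg \<Rightarrow> 'n) \<Rightarrow> bool" where
  "induced_res l \<sigma> U kkh jh \<delta>h kk j \<delta> F \<phi> \<longleftrightarrow>
    factors_through (StarAlg l \<sigma>) (semi_split_extensions l U (StarAlg l \<sigma>)) kkh jh \<delta>h
      kk (comp_func j res_alg) (pull_boundary \<delta> res_alg) F \<phi>"

definition induced_ind ::
    "'u ring \<Rightarrow> ('u \<Rightarrow> 'u) \<Rightarrow> underlying \<Rightarrow> ('u \<times> 'u \<Rightarrow> 'u) \<Rightarrow>
      (('u, 'u) star_alg, 'm) tricat \<Rightarrow> (('u, 'u) star_alg, 'u star_alg_arrow, ('u, 'u) star_alg, 'm) func \<Rightarrow> ('u star_alg_arrow \<times> 'u star_alg_arrow \<Rightarrow> 'm) \<Rightarrow>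
      (('u, 'u) module, 'n) tricat \<Rightarrow> (('u, 'u) module, 'u alg_arrow, ('u, 'u) module, 'n) func \<Rightarrow> ('u alg_arrow \<times> 'u alg_arrow \<Rightarrow> 'n) \<Rightarrow>
      (('u, 'u) module, 'n, ('u, 'u) star_alg, 'm) func \<Rightarrow> (('u, 'u) module \<Rightarrow> 'm) \<Rightarrow> bool" where
  "induced_ind l \<sigma> U pr kkh jh \<delta>h kk j \<delta> F \<phi> \<longleftrightarrow>
    factors_through (Alg l) (semi_split_extensions l U (Alg l)) kk j \<delta>
      kkh (comp_func jh (ind_alg \<sigma> pr)) (pull_boundary \<delta>h (ind_alg \<sigma> pr)) F \<phi>"


section \<open>Adjunctions\<close>

text \<open>\<open>F : C \<rightarrow> D\<close> is left adjoint to \<open>G : D \<rightarrow> C\<close>, through isomorphisms of hom groups.\<close>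

definition left_adjoint ::
    "('o, 'm) tricat \<Rightarrow> ('p, 'n) tricat \<Rightarrow> ('o, 'm, 'p, 'n) func \<Rightarrow> ('p, 'n, 'o, 'm) func \<Rightarrow> bool" where
  "left_adjoint C D F G \<longleftrightarrow>
    (\<exists>\<Phi>. (\<forall>A\<in>Obj C. \<forall>B\<in>Obj D. \<Phi> A B \<in> iso (hom_group D (ob F A) B) (hom_group C A (ob G B))) \<and>
      (\<forall>A\<in>Obj C. \<forall>A'\<in>Obj C. \<forall>B\<in>Obj D. \<forall>B'\<in>Obj D.
        \<forall>a\<in>arrows C A' A. \<forall>b\<in>arrows D B B'. \<forall>f\<in>arrows D (ob F A) B.
          \<Phi> A' B' (b \<bullet>\<^bsub>D\<^esub> f \<bullet>\<^bsub>D\<^esub> ar F a) = ar G b \<bullet>\<^bsub>C\<^esub> \<Phi> A B f \<bullet>\<^bsub>C\<^esub> a))"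

end

theory Submission
  imports Defs
begin

text \<open>
  On algebras, \<open>res\<close> is left adjoint to \<open>ind\<close>, with unit \<open>a \<mapsto> (a, a*)\<close> and counit the first projection.  For the
  other adjunction the unit is \<open>b \<mapsto> (b, 0)\<close>, and the counit is the map
  \<open>ind (res A) \<rightarrow> M\<^sub>\<plusminus> A, (a, b) \<mapsto> p a + p* b*\<close> followed by the inverse of \<open>\<iota>\<^sub>+\<close> in \<open>kk\<^sup>h\<close>, where
  \<open>p = (\<lambda>* \<lambda>*; \<lambda> \<lambda>)\<close> is an idempotent with \<open>p p* = p* p = 0\<close>.  Both triangle identities then reduce to the equality in \<open>kk\<close> of \<open>x \<mapsto> p x\<close> and \<open>x \<mapsto> E\<^sub>1\<^sub>1 x\<close> as maps
  \<open>B \<rightarrow> M\<^sub>2 B\<close>, which are polynomially homotopic.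

  That these transformations are natural for all arrows of \<open>kk\<close> and \<open>kk\<^sup>h\<close>, and not only for the images of
  homomorphisms, follows from the uniqueness of factorizations: a transformation \<open>\<alpha> : F J \<rightarrow> G J\<close> compatible with
  boundary maps gives an automorphism of the theory \<open>(F \<oplus> G) J\<close>, and conjugating the functor \<open>F \<oplus> G\<close> by it yields a
  second factorization of the same theory.
\<close>

section \<open>Additive categories\<close>

text \<open>Nothing is known about the arrows of kk and kk^h beyond the universal property, so a
  statement about all of them can only come from uniqueness. Uniqueness compares functors on the
  nose; hence the two versions of F \<oplus> G must have equal objects and differ only in their
  structure maps. It also asks that F \<oplus> G be triangulated, and so that a direct sum of
  distinguished triangles be distinguished, which has to be derived from the axioms. The functors
  compared are endofunctors of kk or of kk^h, so each universal property is applied with the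
  category itself as target. Sending (a, b) to a + b* in A is not multiplicative, because of the
  cross terms; p and p* give the two summands orthogonal places in M_pm A. The involution of M_pm is
  the adjoint for the form diag(1, -1). There (1, -1) is isotropic, and lambda provides a second
  isotropic vector (lambda*, lambda) whose pairing with the first is lambda* + lambda = 1. The
  idempotent p projects onto the second line along the first, and p + p* = 1.\<close>

locale catg =
  fixes C :: "('o, 'm, 'z) category_scheme" (structure)
  assumes cat: "is_category C"
begin

lemma Dom_Obj [simp]: "f \<in> Arr C \<Longrightarrow> Dom C f \<in> Obj C"
  and Cod_Obj [simp]: "f \<in> Arr C \<Longrightarrow> Cod C f \<in> Obj C"
  and Id_Arr [simp]: "A \<in> Obj C \<Longrightarrow> Id C A \<in> Arr C"
  and Dom_Id [simp]: "A \<in> Obj C \<Longrightarrow> Dom C (Id C A) = A"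
  and Cod_Id [simp]: "A \<in> Obj C \<Longrightarrow> Cod C (Id C A) = A"
  and comp_Arr [simp]: "\<lbrakk>f \<in> Arr C; g \<in> Arr C; Cod C f = Dom C g\<rbrakk> \<Longrightarrow> g \<bullet> f \<in> Arr C"
  and Dom_comp [simp]: "\<lbrakk>f \<in> Arr C; g \<in> Arr C; Cod C f = Dom C g\<rbrakk> \<Longrightarrow> Dom C (g \<bullet> f) = Dom C f"
  and Cod_comp [simp]: "\<lbrakk>f \<in> Arr C; g \<in> Arr C; Cod C f = Dom C g\<rbrakk> \<Longrightarrow> Cod C (g \<bullet> f) = Cod C g"
  and comp_assoc [simp]: "\<lbrakk>f \<in> Arr C; g \<in> Arr C; h \<in> Arr C; Cod C f = Dom C g; Cod C g = Dom C h\<rbrakk>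
    \<Longrightarrow> (h \<bullet> g) \<bullet> f = h \<bullet> g \<bullet> f"
  using cat unfolding is_category_def arrows_def by auto

lemma comp_Id [simp]: "\<lbrakk>f \<in> Arr C; Dom C f = A\<rbrakk> \<Longrightarrow> f \<bullet> Id C A = f"
  and Id_comp [simp]: "\<lbrakk>f \<in> Arr C; Cod C f = A\<rbrakk> \<Longrightarrow> Id C A \<bullet> f = f"
  using cat unfolding is_category_def by auto

text \<open>Composites are kept associated to the right, so the left side of an equation
  \<open>g \<bullet> f = h\<close> no longer occurs once something precedes \<open>f\<close>. This
  is the same equation with a tail \<open>x\<close>, ready for rewriting.\<close>

lemma comp_reassoc:
  assumes "g \<bullet> f = h" "f \<in> Arr C" "g \<in> Arr C" "x \<in> Arr C" "Cod C f = Dom C g" "Cod C x = Dom C f"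
  shows "g \<bullet> f \<bullet> x = h \<bullet> x"
  using assms by (metis comp_assoc)

lemma iso_arrow_Id [simp]: "A \<in> Obj C \<Longrightarrow> iso_arrow C (Id C A)"
  unfolding iso_arrow_def by (auto simp: arrows_def intro!: bexI[of _ "Id C A"])

lemma iso_arrowE:
  assumes "iso_arrow C f"
  obtains g where "f \<in> Arr C" "g \<in> Arr C" "Dom C g = Cod C f" "Cod C g = Dom C f"
    "g \<bullet> f = Id C (Dom C f)" "f \<bullet> g = Id C (Cod C f)"
  using assms unfolding iso_arrow_def arrows_def by auto

lemma iso_arrowI:
  assumes "f \<in> arrows C A B" "g \<in> arrows C B A" "g \<bullet> f = Id C A" "f \<bullet> g = Id C B"
  shows "iso_arrow C f"
  using assms unfolding iso_arrow_def by (auto simp: arrows_def)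

lemma iso_arrow_comp:
  assumes "iso_arrow C f" "iso_arrow C g" "Cod C f = Dom C g"
  shows "iso_arrow C (g \<bullet> f)"
proof -
  obtain f' where f: "f \<in> Arr C" "f' \<in> Arr C" "Dom C f' = Cod C f" "Cod C f' = Dom C f"
    "f' \<bullet> f = Id C (Dom C f)" "f \<bullet> f' = Id C (Cod C f)" using iso_arrowE[OF assms(1)] .
  obtain g' where g: "g \<in> Arr C" "g' \<in> Arr C" "Dom C g' = Cod C g" "Cod C g' = Dom C g"
    "g' \<bullet> g = Id C (Dom C g)" "g \<bullet> g' = Id C (Cod C g)" using iso_arrowE[OF assms(2)] .
  show ?thesis
    by (rule iso_arrowI[of _ "Dom C f" "Cod C g" "f' \<bullet> g'"])
      (use f g assms(3) in \<open>simp_all add: arrows_def comp_reassoc[OF f(5)] comp_reassoc[OF f(6)]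
        comp_reassoc[OF g(5)] comp_reassoc[OF g(6)]\<close>)
qed

end

locale functr = S: catg C + T: catg D
  for C :: "('o, 'm, 'z) category_scheme" and D :: "('p, 'n, 'w) category_scheme" +
  fixes F :: "('o, 'm, 'p, 'n) func"
  assumes is_fun: "is_functor C D F"
begin

lemma ob_Obj [simp]: "A \<in> Obj C \<Longrightarrow> ob F A \<in> Obj D"
  and ar_Id [simp]: "A \<in> Obj C \<Longrightarrow> ar F (Id C A) = Id D (ob F A)"
  and ar_Arr [simp]: "f \<in> Arr C \<Longrightarrow> ar F f \<in> Arr D"
  and Dom_ar [simp]: "f \<in> Arr C \<Longrightarrow> Dom D (ar F f) = ob F (Dom C f)"
  and Cod_ar [simp]: "f \<in> Arr C \<Longrightarrow> Cod D (ar F f) = ob F (Cod C f)"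
  and ar_comp [simp]: "\<lbrakk>f \<in> Arr C; g \<in> Arr C; Cod C f = Dom C g\<rbrakk> \<Longrightarrow>
    ar F (g \<bullet>\<^bsub>C\<^esub> f) = ar F g \<bullet>\<^bsub>D\<^esub> ar F f"
  using is_fun unfolding is_functor_def arrows_def by auto

lemma ar_iso [simp]: assumes "iso_arrow C f" shows "iso_arrow D (ar F f)"
proof -
  obtain g where g: "f \<in> Arr C" "g \<in> Arr C" "Dom C g = Cod C f" "Cod C g = Dom C f"
    "g \<bullet>\<^bsub>C\<^esub> f = Id C (Dom C f)" "f \<bullet>\<^bsub>C\<^esub> g = Id C (Cod C f)" using S.iso_arrowE[OF assms] .
  show ?thesis
    by (rule T.iso_arrowI[of _ "ob F (Dom C f)" "ob F (Cod C f)" "ar F g"])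
      (use g in \<open>simp_all add: arrows_def flip: ar_comp\<close>)
qed

end

locale preadd =
  fixes T :: "('o, 'm) tricat" (structure)
  assumes pre: "preadditive T"

sublocale preadd \<subseteq> catg T
  using pre by unfold_locales (simp add: preadditive_def)

context preadd
begin

lemma group_hom_group: "\<lbrakk>A \<in> Obj T; B \<in> Obj T\<rbrakk> \<Longrightarrow> comm_group (hom_group T A B)"
  using pre by (simp add: preadditive_def)

lemma Zero_Arr [simp]: "\<lbrakk>A \<in> Obj T; B \<in> Obj T\<rbrakk> \<Longrightarrow> Zero T A B \<in> Arr T"
  and Dom_Zero [simp]: "\<lbrakk>A \<in> Obj T; B \<in> Obj T\<rbrakk> \<Longrightarrow> Dom T (Zero T A B) = A"
  and Cod_Zero [simp]: "\<lbrakk>A \<in> Obj T; B \<in> Obj T\<rbrakk> \<Longrightarrow> Cod T (Zero T A B) = B"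
  using monoid.one_closed[of "hom_group T A B"] group_hom_group[of A B]
  by (auto simp: comm_group_def comm_monoid_def hom_group_def arrows_def)

lemma Neg_arrows: "f \<in> Arr T \<Longrightarrow> Neg T f \<in> arrows T (Dom T f) (Cod T f)"
  using group.inv_closed[of "hom_group T (Dom T f) (Cod T f)" f] group_hom_group[of "Dom T f" "Cod T f"]
  by (auto simp: comm_group_def Neg_def hom_group_def arrows_def)

lemma Neg_Arr [simp]: "f \<in> Arr T \<Longrightarrow> Neg T f \<in> Arr T"
  and Dom_Neg [simp]: "f \<in> Arr T \<Longrightarrow> Dom T (Neg T f) = Dom T f"
  and Cod_Neg [simp]: "f \<in> Arr T \<Longrightarrow> Cod T (Neg T f) = Cod T f"
  using Neg_arrows by (auto simp: arrows_def)

lemma Add_arrows: "\<lbrakk>f \<in> arrows T A B; g \<in> arrows T A B\<rbrakk> \<Longrightarrow> Add T f g \<in> arrows T A B"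
  using monoid.m_closed[of "hom_group T A B" f g] group_hom_group[of A B]
  by (auto simp: comm_group_def comm_monoid_def hom_group_def arrows_def)

lemma Add_Arr [simp]: "\<lbrakk>f \<in> Arr T; g \<in> Arr T; Dom T f = Dom T g; Cod T f = Cod T g\<rbrakk> \<Longrightarrow> Add T f g \<in> Arr T"
  and Dom_Add [simp]: "\<lbrakk>f \<in> Arr T; g \<in> Arr T; Dom T f = Dom T g; Cod T f = Cod T g\<rbrakk> \<Longrightarrow> Dom T (Add T f g) = Dom T g"
  and Cod_Add [simp]: "\<lbrakk>f \<in> Arr T; g \<in> Arr T; Dom T f = Dom T g; Cod T f = Cod T g\<rbrakk> \<Longrightarrow> Cod T (Add T f g) = Cod T g"
  using Add_arrows[of f "Dom T g" "Cod T g" g] by (auto simp: arrows_def)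

lemma Add_commute: "\<lbrakk>f \<in> Arr T; g \<in> Arr T; Dom T f = Dom T g; Cod T f = Cod T g\<rbrakk> \<Longrightarrow> Add T f g = Add T g f"
  using comm_monoid.m_comm[of "hom_group T (Dom T f) (Cod T f)" f g] group_hom_group[of "Dom T f" "Cod T f"]
  by (auto simp: comm_group_def hom_group_def arrows_def)

lemma Add_assoc [simp]: "\<lbrakk>f \<in> Arr T; g \<in> Arr T; h \<in> Arr T; Dom T f = Dom T g; Cod T f = Cod T g;
    Dom T g = Dom T h; Cod T g = Cod T h\<rbrakk> \<Longrightarrow> Add T (Add T f g) h = Add T f (Add T g h)"
  using monoid.m_assoc[of "hom_group T (Dom T f) (Cod T f)" f g h] group_hom_group[of "Dom T f" "Cod T f"]
  by (auto simp: comm_group_def comm_monoid_def hom_group_def arrows_def)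

lemma Add_left_commute: "\<lbrakk>f \<in> Arr T; g \<in> Arr T; h \<in> Arr T; Dom T f = Dom T g; Cod T f = Cod T g;
    Dom T g = Dom T h; Cod T g = Cod T h\<rbrakk> \<Longrightarrow> Add T f (Add T g h) = Add T g (Add T f h)"
  by (metis Add_assoc Add_commute)

lemma Add_Zero [simp]: "\<lbrakk>f \<in> Arr T; Dom T f = A; Cod T f = B\<rbrakk> \<Longrightarrow> Add T f (Zero T A B) = f"
  and Zero_Add [simp]: "\<lbrakk>f \<in> Arr T; Dom T f = A; Cod T f = B\<rbrakk> \<Longrightarrow> Add T (Zero T A B) f = f"
  using monoid.r_one[of "hom_group T (Dom T f) (Cod T f)" f] monoid.l_one[of "hom_group T (Dom T f) (Cod T f)" f]
    group_hom_group[of "Dom T f" "Cod T f"]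
  by (auto simp: comm_group_def comm_monoid_def hom_group_def arrows_def)

lemma Neg_Add [simp]: "f \<in> Arr T \<Longrightarrow> Add T (Neg T f) f = Zero T (Dom T f) (Cod T f)"
  using group.l_inv[of "hom_group T (Dom T f) (Cod T f)" f] group_hom_group[of "Dom T f" "Cod T f"]
  by (auto simp: comm_group_def hom_group_def Neg_def arrows_def)

lemma Add_Neg [simp]: "f \<in> Arr T \<Longrightarrow> Add T f (Neg T f) = Zero T (Dom T f) (Cod T f)"
  using Neg_Add[of f] Add_commute[of f "Neg T f"] by simp

lemma Neg_Add_cancel [simp]: "\<lbrakk>f \<in> Arr T; g \<in> Arr T; Dom T f = Dom T g; Cod T f = Cod T g\<rbrakk> \<Longrightarrow>
    Add T (Neg T f) (Add T f g) = g"
  and Add_Neg_cancel [simp]: "\<lbrakk>f \<in> Arr T; g \<in> Arr T; Dom T f = Dom T g; Cod T f = Cod T g\<rbrakk> \<Longrightarrow>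
    Add T f (Add T (Neg T f) g) = g"
  by (simp_all flip: Add_assoc)

lemma Add_left_cancel: "\<lbrakk>Add T f g = Add T f h; f \<in> Arr T; g \<in> Arr T; h \<in> Arr T; Dom T f = Dom T g;
    Cod T f = Cod T g; Dom T f = Dom T h; Cod T f = Cod T h\<rbrakk> \<Longrightarrow> g = h"
  by (metis Neg_Add_cancel)

lemma Neg_unique: "\<lbrakk>Add T f g = Zero T (Dom T f) (Cod T f); f \<in> Arr T; g \<in> Arr T; Dom T f = Dom T g;
    Cod T f = Cod T g\<rbrakk> \<Longrightarrow> g = Neg T f"
  by (metis Neg_Add_cancel Add_Zero Neg_Arr Dom_Neg Cod_Neg)

lemma comp_Add [simp]: "\<lbrakk>f \<in> Arr T; f' \<in> Arr T; g \<in> Arr T; Dom T f = Dom T f'; Cod T f = Cod T f';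
    Cod T f' = Dom T g\<rbrakk> \<Longrightarrow> g \<bullet> Add T f f' = Add T (g \<bullet> f) (g \<bullet> f')"
  and Add_comp [simp]: "\<lbrakk>f \<in> Arr T; g' \<in> Arr T; g \<in> Arr T; Dom T g = Dom T g'; Cod T g = Cod T g';
    Cod T f = Dom T g'\<rbrakk> \<Longrightarrow> Add T g g' \<bullet> f = Add T (g \<bullet> f) (g' \<bullet> f)"
proof -
  have *: "\<And>A B C f f' g g'. \<lbrakk>A \<in> Obj T; B \<in> Obj T; C \<in> Obj T; f \<in> arrows T A B; f' \<in> arrows T A B;
      g \<in> arrows T B C; g' \<in> arrows T B C\<rbrakk> \<Longrightarrow>
        g \<bullet>\<^bsub>T\<^esub> Add T f f' = Add T (g \<bullet>\<^bsub>T\<^esub> f) (g \<bullet>\<^bsub>T\<^esub> f') \<and>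
        Add T g g' \<bullet>\<^bsub>T\<^esub> f = Add T (g \<bullet>\<^bsub>T\<^esub> f) (g' \<bullet>\<^bsub>T\<^esub> f)"
    using pre unfolding preadditive_def by blast
  show "\<lbrakk>f \<in> Arr T; f' \<in> Arr T; g \<in> Arr T; Dom T f = Dom T f'; Cod T f = Cod T f';
    Cod T f' = Dom T g\<rbrakk> \<Longrightarrow> g \<bullet> Add T f f' = Add T (g \<bullet> f) (g \<bullet> f')"
    using *[of "Dom T f'" "Dom T g" "Cod T g" f f' g g] by (simp add: arrows_def)
  show "\<lbrakk>f \<in> Arr T; g' \<in> Arr T; g \<in> Arr T; Dom T g = Dom T g'; Cod T g = Cod T g';
    Cod T f = Dom T g'\<rbrakk> \<Longrightarrow> Add T g g' \<bullet> f = Add T (g \<bullet> f) (g' \<bullet> f)"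
    using *[of "Dom T f" "Dom T g'" "Cod T g'" f f g g'] by (simp add: arrows_def)
qed

lemma comp_Zero [simp]: "\<lbrakk>g \<in> Arr T; Dom T g = B; A \<in> Obj T\<rbrakk> \<Longrightarrow> g \<bullet> Zero T A B = Zero T A (Cod T g)"
proof -
  assume a: "g \<in> Arr T" "Dom T g = B" "A \<in> Obj T"
  then have [simp]: "B \<in> Obj T" by auto
  have "Add T (g \<bullet> Zero T A B) (g \<bullet> Zero T A B) = g \<bullet> Add T (Zero T A B) (Zero T A B)"
    using a by (subst comp_Add) simp_all
  also have "\<dots> = Add T (g \<bullet> Zero T A B) (Zero T A (Cod T g))"
    using a by simp
  finally show ?thesis by (rule Add_left_cancel) (use a in simp_all)
qed

lemma Zero_comp [simp]: "\<lbrakk>f \<in> Arr T; Cod T f = B; C \<in> Obj T\<rbrakk> \<Longrightarrow> Zero T B C \<bullet> f = Zero T (Dom T f) C"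
proof -
  assume a: "f \<in> Arr T" "Cod T f = B" "C \<in> Obj T"
  then have [simp]: "B \<in> Obj T" by auto
  have "Add T (Zero T B C \<bullet> f) (Zero T B C \<bullet> f) = Add T (Zero T B C) (Zero T B C) \<bullet> f"
    using a by (subst Add_comp) simp_all
  also have "\<dots> = Add T (Zero T B C \<bullet> f) (Zero T (Dom T f) C)"
    using a by simp
  finally show ?thesis by (rule Add_left_cancel) (use a in simp_all)
qed

lemma comp_Neg [simp]: "\<lbrakk>f \<in> Arr T; g \<in> Arr T; Cod T f = Dom T g\<rbrakk> \<Longrightarrow> g \<bullet> Neg T f = Neg T (g \<bullet> f)"
  by (rule Neg_unique) (simp_all flip: comp_Add)

lemma Neg_comp [simp]: "\<lbrakk>f \<in> Arr T; g \<in> Arr T; Cod T f = Dom T g\<rbrakk> \<Longrightarrow> Neg T g \<bullet> f = Neg T (g \<bullet> f)"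
  by (rule Neg_unique) (simp_all flip: Add_comp)

lemma Neg_Zero [simp]: "\<lbrakk>A \<in> Obj T; B \<in> Obj T\<rbrakk> \<Longrightarrow> Neg T (Zero T A B) = Zero T A B"
  by (rule Neg_unique[symmetric]) simp_all

lemma Neg_Neg: "f \<in> Arr T \<Longrightarrow> Neg T (Neg T f) = f"
  by (rule Neg_unique[symmetric]) simp_all

end

locale addfun = S: preadd T + T: preadd T'
  for T :: "('o, 'm) tricat" and T' :: "('p, 'n) tricat" +
  fixes F :: "('o, 'm, 'p, 'n) func"
  assumes addfun: "additive_functor T T' F"

sublocale addfun \<subseteq> functr T T' F
  using addfun by unfold_locales (simp add: additive_functor_def)

context addfun
begin

lemma ar_Add [simp]: "\<lbrakk>f \<in> Arr T; g \<in> Arr T; Dom T f = Dom T g; Cod T f = Cod T g\<rbrakk> \<Longrightarrow>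
    ar F (Add T f g) = Add T' (ar F f) (ar F g)"
proof -
  assume a: "f \<in> Arr T" "g \<in> Arr T" "Dom T f = Dom T g" "Cod T f = Cod T g"
  have "\<forall>A\<in>Obj T. \<forall>B\<in>Obj T. \<forall>f\<in>arrows T A B. \<forall>g\<in>arrows T A B. ar F (Add T f g) = Add T' (ar F f) (ar F g)"
    using addfun unfolding additive_functor_def by blast
  from this[rule_format, of "Dom T g" "Cod T g" f g] show ?thesis using a by (simp add: arrows_def)
qed

lemma ar_Zero [simp]: "\<lbrakk>A \<in> Obj T; B \<in> Obj T\<rbrakk> \<Longrightarrow> ar F (Zero T A B) = Zero T' (ob F A) (ob F B)"
proof -
  assume a: "A \<in> Obj T" "B \<in> Obj T"
  have "Add T' (ar F (Zero T A B)) (ar F (Zero T A B)) = ar F (Add T (Zero T A B) (Zero T A B))"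
    using a by (subst ar_Add) simp_all
  also have "\<dots> = Add T' (ar F (Zero T A B)) (Zero T' (ob F A) (ob F B))"
    using a by simp
  finally show ?thesis by (rule T.Add_left_cancel) (use a in simp_all)
qed

lemma ar_Neg [simp]: "f \<in> Arr T \<Longrightarrow> ar F (Neg T f) = Neg T' (ar F f)"
  by (rule T.Neg_unique) (simp_all flip: ar_Add)

end

section \<open>Triangulated categories\<close>

locale triang =
  fixes T :: "('o, 'm) tricat" (structure)
  assumes tri: "triangulated T"

sublocale triang \<subseteq> preadd T
  using tri by unfold_locales (simp add: triangulated_def additive_category_def)

sublocale triang \<subseteq> L: addfun T T "Loop T"
  using tri by unfold_locales (simp add: triangulated_def)

context triang
begin

lemma Tri_candidate: "(h, f, g) \<in> Tri T \<Longrightarrow> candidate_triangle T h f g"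
  using tri[unfolded triangulated_def, THEN conjunct2, THEN conjunct2, THEN conjunct2, THEN conjunct1] by fast

lemma Tri_Arr:
  assumes "(h, f, g) \<in> Tri T"
  shows "h \<in> Arr T" "f \<in> Arr T" "g \<in> Arr T" "Dom T h = ob (Loop T) (Cod T g)"
    "Cod T h = Dom T f" "Cod T f = Dom T g"
  using Tri_candidate[OF assms] unfolding candidate_triangle_def by auto

lemma Tri_iso: "\<lbrakk>(h, f, g) \<in> Tri T; candidate_triangle T h' f' g';
    triangle_map T (h, f, g) (h', f', g') a b c; iso_arrow T a; iso_arrow T b; iso_arrow T c\<rbrakk>
    \<Longrightarrow> (h', f', g') \<in> Tri T"
  using tri[unfolded triangulated_def, THEN conjunct2, THEN conjunct2, THEN conjunct2, THEN conjunct2, THEN conjunct1] by fast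

lemma Tri_Id: "\<lbrakk>A \<in> Obj T; zero_object T Z\<rbrakk> \<Longrightarrow> (Zero T (ob (Loop T) A) Z, Zero T Z A, Id T A) \<in> Tri T"
  using tri[unfolded triangulated_def, THEN conjunct2, THEN conjunct2, THEN conjunct2, THEN conjunct2, THEN conjunct2, THEN conjunct1] by fast

lemma Tri_complete: "g \<in> Arr T \<Longrightarrow> \<exists>h f. (h, f, g) \<in> Tri T"
  using tri[unfolded triangulated_def, THEN conjunct2, THEN conjunct2, THEN conjunct2, THEN conjunct2, THEN conjunct2, THEN conjunct2, THEN conjunct1] by fast

lemma Tri_rotate: "candidate_triangle T h f g \<Longrightarrow>
    (h, f, g) \<in> Tri T \<longleftrightarrow> (Neg T (ar (Loop T) g), h, f) \<in> Tri T"
  using tri[unfolded triangulated_def, THEN conjunct2, THEN conjunct2, THEN conjunct2, THEN conjunct2, THEN conjunct2, THEN conjunct2, THEN conjunct2, THEN conjunct1] by fast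

text \<open>As triangles begin at C[1], the missing map is the one on the first object, dual to the
  usual filling of cones.\<close>

lemma Tri_fill: "\<lbrakk>(h, f, g) \<in> Tri T; (h', f', g') \<in> Tri T; b \<in> arrows T (Dom T g) (Dom T g');
    c \<in> arrows T (Cod T g) (Cod T g'); c \<bullet> g = g' \<bullet> b\<rbrakk> \<Longrightarrow>
    \<exists>a. triangle_map T (h, f, g) (h', f', g') a b c"
  by (rule tri[unfolded triangulated_def, THEN conjunct2, THEN conjunct2, THEN conjunct2, THEN conjunct2, THEN conjunct2, THEN conjunct2, THEN conjunct2, THEN conjunct2, THEN conjunct1, rule_format]) blast

lemma Tri_rotated: "(h, f, g) \<in> Tri T \<Longrightarrow> (Neg T (ar (Loop T) g), h, f) \<in> Tri T"
  using Tri_rotate Tri_candidate by blast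

lemma ex_zero_object: "\<exists>Z. zero_object T Z"
  and ex_biproduct: "\<lbrakk>A \<in> Obj T; B \<in> Obj T\<rbrakk> \<Longrightarrow> has_biproduct T A B"
  using tri[unfolded triangulated_def, THEN conjunct1] unfolding additive_category_def by auto

lemma zero_objectI:
  assumes "Z \<in> Obj T" "Id T Z = Zero T Z Z"
  shows "zero_object T Z"
proof -
  have "f = Zero T A Z" if "A \<in> Obj T" "f \<in> arrows T A Z" for A f
  proof -
    have "f = Id T Z \<bullet> f" using that by (simp add: arrows_def)
    then show ?thesis using that assms by (simp add: arrows_def)
  qed
  moreover have "f = Zero T Z A" if "A \<in> Obj T" "f \<in> arrows T Z A" for A f
  proof -
    have "f = f \<bullet> Id T Z" using that by (simp add: arrows_def)
    then show ?thesis using that assms by (simp add: arrows_def)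
  qed
  ultimately show ?thesis using assms unfolding zero_object_def by (auto simp: arrows_def)
qed

lemma zero_object_Loop:
  assumes "zero_object T Z"
  shows "zero_object T (ob (Loop T) Z)"
proof -
  have ZZ: "Z \<in> Obj T" "arrows T Z Z = {Zero T Z Z}"
    using assms unfolding zero_object_def by blast+
  have "Id T Z \<in> arrows T Z Z"
    using ZZ(1) by (simp add: arrows_def)
  then have Z: "Id T Z = Zero T Z Z"
    unfolding ZZ(2) by blast
  show ?thesis
  proof (rule zero_objectI)
    show "Id T (ob (Loop T) Z) = Zero T (ob (Loop T) Z) (ob (Loop T) Z)"
      using L.ar_Id[OF ZZ(1)] unfolding Z L.ar_Zero[OF ZZ(1) ZZ(1)] by (rule sym)
  qed (use ZZ(1) in simp)
qed

text \<open>The identity on \<open>Cod T g\<close> and \<open>g\<close> itself form a square from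
  the given triangle to the one on \<open>Id T (Cod T g)\<close>, whose first object is zero; the
  filler shows that \<open>g \<bullet> f\<close> factors through zero.\<close>

lemma Tri_comp_Zero:
  assumes "(h, f, g) \<in> Tri T"
  shows "g \<bullet> f = Zero T (Dom T f) (Cod T g)"
proof -
  note [simp] = Tri_Arr[OF assms]
  obtain Z where Z: "zero_object T Z" using ex_zero_object ..
  then have ZO[simp]: "Z \<in> Obj T" by (simp add: zero_object_def)
  note t = Tri_Id[OF Cod_Obj Z, of g]
  obtain a where a: "triangle_map T (h, f, g) (Zero T (ob (Loop T) (Cod T g)) Z, Zero T Z (Cod T g), Id T (Cod T g)) a g (Id T (Cod T g))"
    using Tri_fill[OF assms t, of g "Id T (Cod T g)"] by (auto simp: arrows_def)
  then have "a \<in> Arr T" "Dom T a = Dom T f" "Cod T a = Z" "g \<bullet> f = Zero T Z (Cod T g) \<bullet> a"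
    by (simp_all add: triangle_map_def arrows_def)
  then show ?thesis by simp
qed

lemma triangle_mapD:
  assumes "triangle_map T (h, f, g) (h', f', g') a b c"
  shows "a \<in> Arr T" "Dom T a = Dom T f" "Cod T a = Dom T f'"
    "b \<in> arrows T (Dom T g) (Dom T g')" "c \<in> arrows T (Cod T g) (Cod T g')"
    "a \<bullet> h = h' \<bullet> ar (Loop T) c" "c \<bullet> g = g' \<bullet> b" "b \<bullet> f = f' \<bullet> a"
  using assms by (auto simp: triangle_map_def arrows_def)

text \<open>Exactness of Hom(W, -) at the middle object. An \<open>x\<close> killed by
  \<open>g\<close> is a square from W -> 0 to \<open>g\<close>, and the filler of the corresponding
  map of triangles is the required lift.\<close>

lemma Tri_exact:
  assumes t: "(h, f, g) \<in> Tri T" and x: "x \<in> arrows T W (Dom T g)" "g \<bullet> x = Zero T W (Cod T g)"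
  shows "\<exists>a. a \<in> Arr T \<and> Dom T a = W \<and> Cod T a = Dom T f \<and> x = f \<bullet> a"
proof -
  note [simp] = Tri_Arr[OF t] x(2)
  have [simp]: "x \<in> Arr T" "Dom T x = W" "Cod T x = Dom T g" using x(1) by (simp_all add: arrows_def)
  have [simp]: "W \<in> Obj T" using Dom_Obj[of x] by simp
  obtain Z where Z: "zero_object T Z" using ex_zero_object ..
  then have [simp]: "Z \<in> Obj T" by (simp add: zero_object_def)
  let ?t = "(Zero T (ob (Loop T) Z) W, Id T W, Zero T W Z)"
  \<comment> \<open>The shifted zero object is used here so that this identity triangle is exactly
    the rotation of \<open>?t\<close>.\<close>
  have "(Zero T (ob (Loop T) W) (ob (Loop T) Z), Zero T (ob (Loop T) Z) W, Id T W) \<in> Tri T"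
    by (rule Tri_Id[OF _ zero_object_Loop[OF Z]]) simp
  moreover have "candidate_triangle T (Zero T (ob (Loop T) Z) W) (Id T W) (Zero T W Z)"
    by (simp add: candidate_triangle_def)
  ultimately have "?t \<in> Tri T"
    by (subst Tri_rotate) simp_all
  then have "\<exists>a. triangle_map T ?t (h, f, g) a x (Zero T Z (Cod T g))"
    by (rule Tri_fill[OF _ t]) (simp_all add: arrows_def)
  then obtain a where "triangle_map T ?t (h, f, g) a x (Zero T Z (Cod T g))" ..
  note a = triangle_mapD[OF this]
  have "x = f \<bullet> a" using a(8) by simp
  then show ?thesis using a(1-3) by (intro exI[of _ a]) simp
qed

end

section \<open>Biproducts and their images under additive functors\<close>

locale biprod = preadd +
  fixes A B P i j p q
  assumes i [simp]: "i \<in> Arr T" "Dom T i = A" "Cod T i = P"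
    and j [simp]: "j \<in> Arr T" "Dom T j = B" "Cod T j = P"
    and p [simp]: "p \<in> Arr T" "Dom T p = P" "Cod T p = A"
    and q [simp]: "q \<in> Arr T" "Dom T q = P" "Cod T q = B"
    and pi [simp]: "p \<bullet> i = Id T A" and qj [simp]: "q \<bullet> j = Id T B"
    and pj [simp]: "p \<bullet> j = Zero T B A" and qi [simp]: "q \<bullet> i = Zero T A B"
    and sum: "Add T (i \<bullet> p) (j \<bullet> q) = Id T P"
begin

lemma Objs [simp]: "A \<in> Obj T" "B \<in> Obj T" "P \<in> Obj T"
  using Dom_Obj[OF i(1)] Dom_Obj[OF j(1)] Cod_Obj[OF i(1)] by auto

lemma reassoc [simp]:
  assumes "x \<in> Arr T"
  shows "Cod T x = A \<Longrightarrow> p \<bullet> i \<bullet> x = x"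
    "Cod T x = B \<Longrightarrow> q \<bullet> j \<bullet> x = x"
    "Cod T x = A \<Longrightarrow> q \<bullet> i \<bullet> x = Zero T (Dom T x) B"
    "Cod T x = B \<Longrightarrow> p \<bullet> j \<bullet> x = Zero T (Dom T x) A"
  using assms by (simp_all add: comp_reassoc[OF pi] comp_reassoc[OF qj] comp_reassoc[OF pj] comp_reassoc[OF qi])

lemma decompose:
  assumes "x \<in> Arr T" "Cod T x = P"
  shows "Add T (i \<bullet> p \<bullet> x) (j \<bullet> q \<bullet> x) = x"
proof -
  have "Add T (i \<bullet> p \<bullet> x) (j \<bullet> q \<bullet> x) = Add T (i \<bullet> p) (j \<bullet> q) \<bullet> x"
    using assms by simp
  then show ?thesis using assms by (simp add: sum)
qed

end

locale addfun_biprod = addfun + S: biprod T A B P i j p q for A B P i j p q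

sublocale addfun_biprod \<subseteq> im: biprod T' "ob F A" "ob F B" "ob F P" "ar F i" "ar F j" "ar F p" "ar F q"
proof
  show "Add T' (ar F i \<bullet>\<^bsub>T'\<^esub> ar F p) (ar F j \<bullet>\<^bsub>T'\<^esub> ar F q) = Id T' (ob F P)"
    using arg_cong[OF S.sum, of "ar F"] by simp
qed (simp_all flip: ar_comp)

lemma (in triang) biproductE:
  assumes "A \<in> Obj T" "B \<in> Obj T"
  obtains P i j p q where "biprod T A B P i j p q"
proof -
  obtain P i j p q where "P\<in>Obj T" "i\<in>arrows T A P" "j\<in>arrows T B P" "p\<in>arrows T P A" "q\<in>arrows T P B"
      "p \<bullet>\<^bsub>T\<^esub> i = Id T A" "q \<bullet>\<^bsub>T\<^esub> j = Id T B"
      "p \<bullet>\<^bsub>T\<^esub> j = Zero T B A" "q \<bullet>\<^bsub>T\<^esub> i = Zero T A B"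
      "Add T (i \<bullet>\<^bsub>T\<^esub> p) (j \<bullet>\<^bsub>T\<^esub> q) = Id T P"
    using ex_biproduct[OF assms] unfolding has_biproduct_def by blast
  then have "biprod T A B P i j p q" by unfold_locales (simp_all add: arrows_def)
  then show ?thesis by (rule that)
qed

section \<open>Direct sums of distinguished triangles\<close>

context triang
begin

text \<open>After two rotations \<open>h\<close> is the last map and the shift of \<open>g\<close>,
  up to sign, the middle one.\<close>

lemma Tri_comp_Loop_Zero:
  assumes "(h, f, g) \<in> Tri T"
  shows "h \<bullet> ar (Loop T) g = Zero T (ob (Loop T) (Dom T g)) (Dom T f)"
proof -
  note [simp] = Tri_Arr[OF assms]
  have "Neg T (h \<bullet> ar (Loop T) g) = Zero T (ob (Loop T) (Dom T g)) (Dom T f)"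
    using Tri_comp_Zero[OF Tri_rotated[OF Tri_rotated[OF assms]]] by simp
  then have "Neg T (Neg T (h \<bullet> ar (Loop T) g)) = Neg T (Zero T (ob (Loop T) (Dom T g)) (Dom T f))"
    by (rule arg_cong)
  then show ?thesis by (simp add: Neg_Neg)
qed

text \<open>Complete the summed map \<open>gD\<close> to some triangle. The inclusions extend to
  maps from both given triangles, which add up to \<open>\<theta>\<close> from the summed first
  object to the new one. The argument of the five lemma makes \<open>\<theta>\<close> invertible:
  the Hom sequences of the sum are exact because those of the summands are, which does not
  presuppose that the sum is distinguished. The inverse of \<open>\<theta>\<close> then carries the
  completed triangle to the sum.\<close>

lemma Tri_biproduct:
  assumes t1: "(h1, f1, g1) \<in> Tri T" and t2: "(h2, f2, g2) \<in> Tri T"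
    and "biprod T (Dom T f1) (Dom T f2) PA iA jA pA qA"
    and "biprod T (Dom T g1) (Dom T g2) PB iB jB pB qB"
    and "biprod T (Cod T g1) (Cod T g2) PC iC jC pC qC"
  shows "(Add T (iA \<bullet> h1 \<bullet> ar (Loop T) pC) (jA \<bullet> h2 \<bullet> ar (Loop T) qC),
    Add T (iB \<bullet> f1 \<bullet> pA) (jB \<bullet> f2 \<bullet> qA), Add T (iC \<bullet> g1 \<bullet> pB) (jC \<bullet> g2 \<bullet> qB)) \<in> Tri T"
proof -
  interpret A: biprod T "Dom T f1" "Dom T f2" PA iA jA pA qA by fact
  interpret B: biprod T "Dom T g1" "Dom T g2" PB iB jB pB qB by fact
  interpret C: biprod T "Cod T g1" "Cod T g2" PC iC jC pC qC by fact
  interpret LC: addfun_biprod T T "Loop T" "Cod T g1" "Cod T g2" PC iC jC pC qC ..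
  interpret LB: addfun_biprod T T "Loop T" "Dom T g1" "Dom T g2" PB iB jB pB qB ..
  note [simp] = Tri_Arr[OF t1] Tri_Arr[OF t2]
  define gD where "gD = Add T (iC \<bullet> g1 \<bullet> pB) (jC \<bullet> g2 \<bullet> qB)"
  define fD where "fD = Add T (iB \<bullet> f1 \<bullet> pA) (jB \<bullet> f2 \<bullet> qA)"
  define hD where "hD = Add T (iA \<bullet> h1 \<bullet> ar (Loop T) pC) (jA \<bullet> h2 \<bullet> ar (Loop T) qC)"
  have gD [simp]: "gD \<in> Arr T" "Dom T gD = PB" "Cod T gD = PC"
    and fD [simp]: "fD \<in> Arr T" "Dom T fD = PA" "Cod T fD = PB"
    and hD [simp]: "hD \<in> Arr T" "Dom T hD = ob (Loop T) PC" "Cod T hD = PA"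
    by (simp_all add: gD_def fD_def hD_def)
  obtain h0 f0 where t0: "(h0, f0, gD) \<in> Tri T" using Tri_complete[OF gD(1)] by blast
  note [simp] = Tri_Arr[OF t0, unfolded gD]
  have "\<exists>a. triangle_map T (h1, f1, g1) (h0, f0, gD) a iB iC"
    by (rule Tri_fill[OF t1 t0]) (simp_all add: arrows_def gD_def)
  then obtain a1 where a1: "triangle_map T (h1, f1, g1) (h0, f0, gD) a1 iB iC" ..
  have "\<exists>a. triangle_map T (h2, f2, g2) (h0, f0, gD) a jB jC"
    by (rule Tri_fill[OF t2 t0]) (simp_all add: arrows_def gD_def)
  then obtain a2 where a2: "triangle_map T (h2, f2, g2) (h0, f0, gD) a2 jB jC" ..
  note [simp] = triangle_mapD(1-3)[OF a1] triangle_mapD(1-3)[OF a2]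
  note a1 = triangle_mapD(6,8)[OF a1] and a2 = triangle_mapD(6,8)[OF a2]
  define \<theta> where "\<theta> = Add T (a1 \<bullet> pA) (a2 \<bullet> qA)"
  have \<theta> [simp]: "\<theta> \<in> Arr T" "Dom T \<theta> = PA" "Cod T \<theta> = Dom T f0"
    by (simp_all add: \<theta>_def)
  have \<theta>h: "\<theta> \<bullet> hD = h0"
  proof -
    have "\<theta> \<bullet> hD = Add T (a1 \<bullet> h1 \<bullet> ar (Loop T) pC) (a2 \<bullet> h2 \<bullet> ar (Loop T) qC)"
      by (simp add: \<theta>_def hD_def)
    also have "\<dots> = h0 \<bullet> Add T (ar (Loop T) iC \<bullet> ar (Loop T) pC) (ar (Loop T) jC \<bullet> ar (Loop T) qC)"
      by (simp add: comp_reassoc[OF a1(1)] comp_reassoc[OF a2(1)])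
    also have "\<dots> = h0" unfolding LC.im.sum by simp
    finally show ?thesis .
  qed
  have f\<theta>: "f0 \<bullet> \<theta> = fD"
    by (simp add: \<theta>_def fD_def comp_reassoc[OF a1(2)[symmetric]] comp_reassoc[OF a2(2)[symmetric]])
  \<comment> \<open>Injectivity of \<open>\<theta>\<close> on arrows from any object. From
    \<open>\<theta> \<bullet> x = 0\<close> both components of \<open>fD \<bullet> x\<close> vanish,
    so \<open>x = hD \<bullet> z\<close>; then \<open>h0 \<bullet> z = 0\<close>, so
    \<open>z\<close> factors through the shift of \<open>gD\<close>, which \<open>hD\<close>
    kills.\<close>
  have inj: "x = Zero T (Dom T x) PA" if x: "x \<in> Arr T" "Cod T x = PA" "\<theta> \<bullet> x = Zero T (Dom T x) (Dom T f0)" for x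
  proof -
    note [simp] = x
    have fx: "fD \<bullet> x = Zero T (Dom T x) PB"
      unfolding f\<theta>[symmetric] by simp
    have "f1 \<bullet> pA \<bullet> x = pB \<bullet> fD \<bullet> x" "f2 \<bullet> qA \<bullet> x = qB \<bullet> fD \<bullet> x"
      by (simp_all add: fD_def)
    then have *: "f1 \<bullet> pA \<bullet> x = Zero T (Dom T x) (Dom T g1)" "f2 \<bullet> qA \<bullet> x = Zero T (Dom T x) (Dom T g2)"
      by (simp_all add: fx)
    have "\<exists>a. a \<in> Arr T \<and> Dom T a = Dom T x \<and> Cod T a = ob (Loop T) (Cod T g1) \<and> pA \<bullet> x = h1 \<bullet> a"
      using Tri_exact[OF Tri_rotated[OF t1], of "pA \<bullet> x" "Dom T x"] by (simp add: arrows_def *)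
    then obtain z1 where [simp]: "z1 \<in> Arr T" "Dom T z1 = Dom T x" "Cod T z1 = ob (Loop T) (Cod T g1)" and z1: "pA \<bullet> x = h1 \<bullet> z1"
      by blast
    have "\<exists>a. a \<in> Arr T \<and> Dom T a = Dom T x \<and> Cod T a = ob (Loop T) (Cod T g2) \<and> qA \<bullet> x = h2 \<bullet> a"
      using Tri_exact[OF Tri_rotated[OF t2], of "qA \<bullet> x" "Dom T x"] by (simp add: arrows_def *)
    then obtain z2 where [simp]: "z2 \<in> Arr T" "Dom T z2 = Dom T x" "Cod T z2 = ob (Loop T) (Cod T g2)" and z2: "qA \<bullet> x = h2 \<bullet> z2"
      by blast
    define z where "z = Add T (ar (Loop T) iC \<bullet> z1) (ar (Loop T) jC \<bullet> z2)"
    have z [simp]: "z \<in> Arr T" "Dom T z = Dom T x" "Cod T z = ob (Loop T) PC"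
      by (simp_all add: z_def)
    have "x = Add T (iA \<bullet> pA \<bullet> x) (jA \<bullet> qA \<bullet> x)"
      by (rule A.decompose[symmetric]) simp_all
    also have "\<dots> = hD \<bullet> z"
      unfolding z1 z2 by (simp add: hD_def z_def)
    finally have xz: "x = hD \<bullet> z" .
    have "h0 \<bullet> z = \<theta> \<bullet> hD \<bullet> z"
      by (simp flip: \<theta>h)
    then have h0z: "h0 \<bullet> z = Zero T (Dom T x) (Dom T f0)"
      unfolding xz[symmetric] x .
    have "\<exists>a. a \<in> Arr T \<and> Dom T a = Dom T x \<and> Cod T a = ob (Loop T) PB \<and> z = Neg T (ar (Loop T) gD) \<bullet> a"
      using Tri_exact[OF Tri_rotated[OF Tri_rotated[OF t0]], of z "Dom T x"] by (simp add: arrows_def h0z)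
    then obtain w where [simp]: "w \<in> Arr T" "Dom T w = Dom T x" "Cod T w = ob (Loop T) PB" and w: "z = Neg T (ar (Loop T) gD) \<bullet> w"
      by blast
    note c1 = Tri_comp_Loop_Zero[OF t1] and c2 = Tri_comp_Loop_Zero[OF t2]
    have "hD \<bullet> ar (Loop T) gD = Zero T (ob (Loop T) PB) PA"
      by (simp add: hD_def gD_def comp_reassoc[OF c1] comp_reassoc[OF c2])
    then have "hD \<bullet> ar (Loop T) gD \<bullet> w = Zero T (Dom T x) PA"
      by (simp add: comp_reassoc)
    then have "hD \<bullet> z = Zero T (Dom T x) PA"
      by (simp add: w)
    with xz show ?thesis by (rule trans)
  qed
  \<comment> \<open>Surjectivity. The components of \<open>f0 \<bullet> y\<close> lift through
    \<open>f1\<close> and \<open>f2\<close> to some \<open>x\<close>; then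
    \<open>\<theta> \<bullet> x - y\<close> is killed by \<open>f0\<close>, hence equals
    \<open>h0 \<bullet> z = \<theta> \<bullet> hD \<bullet> z\<close>, and
    \<open>x - hD \<bullet> z\<close> is the preimage.\<close>
  have surj: "\<exists>x. x \<in> Arr T \<and> Dom T x = Dom T y \<and> Cod T x = PA \<and> \<theta> \<bullet> x = y" if y: "y \<in> Arr T" "Cod T y = Dom T f0" for y
  proof -
    note [simp] = y
    have "gD \<bullet> f0 = Zero T (Dom T f0) PC" using Tri_comp_Zero[OF t0] by simp
    then have g0: "gD \<bullet> f0 \<bullet> y = Zero T (Dom T y) PC" by (simp add: comp_reassoc)
    have "g1 \<bullet> pB \<bullet> f0 \<bullet> y = pC \<bullet> gD \<bullet> f0 \<bullet> y" "g2 \<bullet> qB \<bullet> f0 \<bullet> y = qC \<bullet> gD \<bullet> f0 \<bullet> y"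
      by (simp_all add: gD_def)
    then have *: "g1 \<bullet> pB \<bullet> f0 \<bullet> y = Zero T (Dom T y) (Cod T g1)" "g2 \<bullet> qB \<bullet> f0 \<bullet> y = Zero T (Dom T y) (Cod T g2)"
      unfolding g0 by simp_all
    have "\<exists>a. a \<in> Arr T \<and> Dom T a = Dom T y \<and> Cod T a = Dom T f1 \<and> pB \<bullet> f0 \<bullet> y = f1 \<bullet> a"
      using Tri_exact[OF t1, of "pB \<bullet> f0 \<bullet> y" "Dom T y"] by (simp add: arrows_def *)
    then obtain x1 where [simp]: "x1 \<in> Arr T" "Dom T x1 = Dom T y" "Cod T x1 = Dom T f1" and x1: "pB \<bullet> f0 \<bullet> y = f1 \<bullet> x1"
      by blast
    have "\<exists>a. a \<in> Arr T \<and> Dom T a = Dom T y \<and> Cod T a = Dom T f2 \<and> qB \<bullet> f0 \<bullet> y = f2 \<bullet> a"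
      using Tri_exact[OF t2, of "qB \<bullet> f0 \<bullet> y" "Dom T y"] by (simp add: arrows_def *)
    then obtain x2 where [simp]: "x2 \<in> Arr T" "Dom T x2 = Dom T y" "Cod T x2 = Dom T f2" and x2: "qB \<bullet> f0 \<bullet> y = f2 \<bullet> x2"
      by blast
    define x where "x = Add T (iA \<bullet> x1) (jA \<bullet> x2)"
    have [simp]: "x \<in> Arr T" "Dom T x = Dom T y" "Cod T x = PA" by (simp_all add: x_def)
    have "f0 \<bullet> \<theta> \<bullet> x = fD \<bullet> x"
      by (simp flip: f\<theta>)
    also have "\<dots> = Add T (iB \<bullet> pB \<bullet> f0 \<bullet> y) (jB \<bullet> qB \<bullet> f0 \<bullet> y)"
      unfolding x1 x2 by (simp add: fD_def x_def)
    also have "\<dots> = f0 \<bullet> y"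
      by (rule B.decompose) simp_all
    finally have f0z: "f0 \<bullet> Add T (\<theta> \<bullet> x) (Neg T y) = Zero T (Dom T y) PB"
      by simp
    have "\<exists>a. a \<in> Arr T \<and> Dom T a = Dom T y \<and> Cod T a = ob (Loop T) PC \<and> Add T (\<theta> \<bullet> x) (Neg T y) = h0 \<bullet> a"
      using Tri_exact[OF Tri_rotated[OF t0], of "Add T (\<theta> \<bullet> x) (Neg T y)" "Dom T y"] f0z by (simp add: arrows_def)
    then obtain z where [simp]: "z \<in> Arr T" "Dom T z = Dom T y" "Cod T z = ob (Loop T) PC" and z: "Add T (\<theta> \<bullet> x) (Neg T y) = h0 \<bullet> z"
      by blast
    have "\<theta> \<bullet> hD \<bullet> z = Add T (\<theta> \<bullet> x) (Neg T y)"
      unfolding z by (simp flip: \<theta>h)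
    then have "\<theta> \<bullet> Add T x (Neg T (hD \<bullet> z)) = Add T (\<theta> \<bullet> x) (Neg T (Add T (\<theta> \<bullet> x) (Neg T y)))"
      by simp
    also have "\<dots> = y"
      by (rule Add_left_cancel[of "Add T (\<theta> \<bullet> x) (Neg T y)"]) (simp_all add: Add_left_commute Add_commute)
    finally show ?thesis by (intro exI[of _ "Add T x (Neg T (hD \<bullet> z))"]) simp
  qed
  \<comment> \<open>Surjectivity at the identity yields a right inverse \<open>\<rho>\<close>;
    injectivity applied to \<open>\<rho> \<bullet> \<theta> - 1\<close> makes it two-sided.\<close>
  obtain \<rho> where \<rho> [simp]: "\<rho> \<in> Arr T" "Dom T \<rho> = Dom T f0" "Cod T \<rho> = PA" and \<theta>\<rho>: "\<theta> \<bullet> \<rho> = Id T (Dom T f0)"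
    using surj[of "Id T (Dom T f0)"] by auto
  have "Add T (\<rho> \<bullet> \<theta>) (Neg T (Id T PA)) = Zero T PA PA"
    using inj[of "Add T (\<rho> \<bullet> \<theta>) (Neg T (Id T PA))"] by (simp add: comp_reassoc[OF \<theta>\<rho>])
  then have \<rho>\<theta>: "\<rho> \<bullet> \<theta> = Id T PA"
    using Add_left_cancel[of "Neg T (Id T PA)" "\<rho> \<bullet> \<theta>" "Id T PA"] by (simp add: Add_commute)
  have "(hD, fD, gD) \<in> Tri T"
  proof (rule Tri_iso[OF t0])
    show "candidate_triangle T hD fD gD" by (simp add: candidate_triangle_def)
    show "iso_arrow T \<rho>" by (rule iso_arrowI[of _ "Dom T f0" PA \<theta>]) (simp_all add: arrows_def \<theta>\<rho> \<rho>\<theta>)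
    show "triangle_map T (h0, f0, gD) (hD, fD, gD) \<rho> (Id T PB) (Id T PC)"
      by (simp add: triangle_map_def arrows_def comp_reassoc[OF \<rho>\<theta>] comp_reassoc[OF \<theta>\<rho>] \<theta>\<rho> flip: \<theta>h f\<theta>)
  qed simp_all
  then show ?thesis by (simp add: hD_def fD_def gD_def)
qed

end

section \<open>Triangulated functors\<close>

locale trifun = K: triang K + T: triang T
  for K :: "('o, 'm) tricat" and T :: "('p, 'n) tricat" +
  fixes F :: "('o, 'm, 'p, 'n) func" and \<phi> :: "'o \<Rightarrow> 'n"
  assumes trifun: "triangulated_functor K T F \<phi>"

sublocale trifun \<subseteq> addfun K T F
  using trifun by unfold_locales (simp add: triangulated_functor_def)

context trifun
begin

lemma \<phi>_Arr [simp]: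
  assumes "A \<in> Obj K"
  shows "\<phi> A \<in> Arr T" "Dom T (\<phi> A) = ob (Loop T) (ob F A)" "Cod T (\<phi> A) = ob F (ob (Loop K) A)"
    "iso_arrow T (\<phi> A)"
  using trifun[unfolded triangulated_functor_def, THEN conjunct2, THEN conjunct1] assms
  by (auto simp: arrows_def)

lemma \<phi>_natural: "f \<in> Arr K \<Longrightarrow> ar F (ar (Loop K) f) \<bullet>\<^bsub>T\<^esub> \<phi> (Dom K f) = \<phi> (Cod K f) \<bullet>\<^bsub>T\<^esub> ar (Loop T) (ar F f)"
  using trifun[unfolded triangulated_functor_def, THEN conjunct2, THEN conjunct2, THEN conjunct1] by blast

lemma \<phi>_natural': "\<lbrakk>f \<in> Arr K; x \<in> Arr T; Dom K f = A; Cod T x = ob (Loop T) (ob F A)\<rbrakk> \<Longrightarrow>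
    ar F (ar (Loop K) f) \<bullet>\<^bsub>T\<^esub> \<phi> A \<bullet>\<^bsub>T\<^esub> x = \<phi> (Cod K f) \<bullet>\<^bsub>T\<^esub> ar (Loop T) (ar F f) \<bullet>\<^bsub>T\<^esub> x"
  using T.comp_reassoc[OF \<phi>_natural, of f x] by auto

lemma Tri_map: "(h, f, g) \<in> Tri K \<Longrightarrow> (ar F h \<bullet>\<^bsub>T\<^esub> \<phi> (Cod K g), ar F f, ar F g) \<in> Tri T"
  using trifun[unfolded triangulated_functor_def, THEN conjunct2, THEN conjunct2, THEN conjunct2] by fast

end

section \<open>Direct sums of triangulated functors\<close>

text \<open>The biproduct data are parameters rather than a fixed choice, because the same
  \<open>F\<close> and \<open>G\<close> are later summed along two different splittings of the same
  objects \<open>P\<close>.\<close>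

definition sum_func where
  "sum_func K T F G P i j p q = \<lparr>ob = P,
    ar = (\<lambda>f. Add T (i (Cod K f) \<bullet>\<^bsub>T\<^esub> ar F f \<bullet>\<^bsub>T\<^esub> p (Dom K f)) (j (Cod K f) \<bullet>\<^bsub>T\<^esub> ar G f \<bullet>\<^bsub>T\<^esub> q (Dom K f)))\<rparr>"

definition sum_shift where
  "sum_shift K T \<phi> \<gamma> i j p q A = Add T
    (i (ob (Loop K) A) \<bullet>\<^bsub>T\<^esub> \<phi> A \<bullet>\<^bsub>T\<^esub> ar (Loop T) (p A))
    (j (ob (Loop K) A) \<bullet>\<^bsub>T\<^esub> \<gamma> A \<bullet>\<^bsub>T\<^esub> ar (Loop T) (q A))"

locale sum_trifun = F: trifun K T F \<phi> + G: trifun K T G \<gamma>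
  for K :: "('o, 'm) tricat" and T :: "('p, 'n) tricat" (structure) and F \<phi> G \<gamma> +
  fixes P i j p q
  assumes bip: "A \<in> Obj K \<Longrightarrow> biprod T (ob F A) (ob G A) (P A) (i A) (j A) (p A) (q A)"
begin

lemmas bip_simps [simp] = biprod.i[OF bip] biprod.j[OF bip] biprod.p[OF bip] biprod.q[OF bip]
  biprod.pi[OF bip] biprod.qj[OF bip] biprod.pj[OF bip] biprod.qi[OF bip] biprod.reassoc[OF bip]
  biprod.Objs(3)[OF bip]

lemma bip_Loop: "A \<in> Obj K \<Longrightarrow> addfun_biprod T T (Loop T) (ob F A) (ob G A) (P A) (i A) (j A) (p A) (q A)"
  by (intro addfun_biprod.intro F.T.L.addfun_axioms bip)

lemma bip_L: "A \<in> Obj K \<Longrightarrow> biprod T (ob (Loop T) (ob F A)) (ob (Loop T) (ob G A)) (ob (Loop T) (P A))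
    (ar (Loop T) (i A)) (ar (Loop T) (j A)) (ar (Loop T) (p A)) (ar (Loop T) (q A))"
proof -
  assume A: "A \<in> Obj K"
  interpret addfun_biprod T T "Loop T" "ob F A" "ob G A" "P A" "i A" "j A" "p A" "q A"
    by (rule bip_Loop[OF A])
  show ?thesis by (rule im.biprod_axioms)
qed

lemmas bip_L_simps [simp] = biprod.pi[OF bip_L] biprod.qj[OF bip_L] biprod.pj[OF bip_L] biprod.qi[OF bip_L]
  biprod.reassoc[OF bip_L]

abbreviation "D \<equiv> sum_func K T F G P i j p q"
abbreviation "\<chi> \<equiv> sum_shift K T \<phi> \<gamma> i j p q"

lemma D_functor: "is_functor K T D"
  unfolding is_functor_def sum_func_def
  by (auto simp: arrows_def biprod.sum[OF bip])

lemma D_additive: "additive_functor K T D"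
  unfolding additive_functor_def using D_functor
  by (auto simp: arrows_def sum_func_def F.T.Add_commute F.T.Add_left_commute)

lemma \<chi>_Arr [simp]:
  assumes "A \<in> Obj K"
  shows "\<chi> A \<in> Arr T" "Dom T (\<chi> A) = ob (Loop T) (P A)" "Cod T (\<chi> A) = P (ob (Loop K) A)"
  using assms by (simp_all add: sum_shift_def)

lemma \<chi>_iso:
  assumes A: "A \<in> Obj K"
  shows "iso_arrow T (\<chi> A)"
proof -
  note [simp] = A
  obtain f where f [simp]: "f \<in> Arr T" "Dom T f = ob F (ob (Loop K) A)" "Cod T f = ob (Loop T) (ob F A)"
    "f \<bullet> \<phi> A = Id T (ob (Loop T) (ob F A))" "\<phi> A \<bullet> f = Id T (ob F (ob (Loop K) A))"
    using F.T.iso_arrowE[OF F.\<phi>_Arr(4)[OF A]] by (simp only: F.\<phi>_Arr[OF A]) blast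
  obtain g where g [simp]: "g \<in> Arr T" "Dom T g = ob G (ob (Loop K) A)" "Cod T g = ob (Loop T) (ob G A)"
    "g \<bullet> \<gamma> A = Id T (ob (Loop T) (ob G A))" "\<gamma> A \<bullet> g = Id T (ob G (ob (Loop K) A))"
    using F.T.iso_arrowE[OF G.\<phi>_Arr(4)[OF A]] by (simp only: G.\<phi>_Arr[OF A]) blast
  show ?thesis
    by (rule F.T.iso_arrowI[of _ "ob (Loop T) (P A)" "P (ob (Loop K) A)"
        "Add T (ar (Loop T) (i A) \<bullet> f \<bullet> p (ob (Loop K) A)) (ar (Loop T) (j A) \<bullet> g \<bullet> q (ob (Loop K) A))"])
      (simp_all add: arrows_def sum_shift_def F.T.comp_reassoc[OF f(4)] F.T.comp_reassoc[OF f(5)]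
        F.T.comp_reassoc[OF g(4)] F.T.comp_reassoc[OF g(5)] biprod.sum[OF bip] biprod.sum[OF bip_L])
qed

text \<open>Up to reassociation, the image of a triangle is the direct sum of its images under
  \<open>F\<close> and \<open>G\<close>, so \<open>Tri_biproduct\<close> applies.\<close>

lemma D_triangulated: "triangulated_functor K T D \<chi>"
  unfolding triangulated_functor_def
proof (intro conjI ballI)
  show "additive_functor K T D" by (rule D_additive)
  show "\<chi> A \<in> arrows T (ob (Loop T) (ob D A)) (ob D (ob (Loop K) A))" if "A \<in> Obj K" for A
    using that by (simp add: arrows_def sum_func_def)
  show "iso_arrow T (\<chi> A)" if "A \<in> Obj K" for A using \<chi>_iso[OF that] .
  show "ar D (ar (Loop K) f) \<bullet> \<chi> (Dom K f) = \<chi> (Cod K f) \<bullet> ar (Loop T) (ar D f)" if "f \<in> Arr K" for f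
    using that by (simp add: sum_func_def sum_shift_def F.\<phi>_natural' G.\<phi>_natural')
  fix t assume "t \<in> Tri K"
  then obtain h f g where t: "t = (h, f, g)" "(h, f, g) \<in> Tri K" by (cases t) auto
  note [simp] = F.K.Tri_Arr[OF t(2)]
  have "(Add T (i (Dom K f) \<bullet> (ar F h \<bullet> \<phi> (Cod K g)) \<bullet> ar (Loop T) (p (Cod K g))) (j (Dom K f) \<bullet> (ar G h \<bullet> \<gamma> (Cod K g)) \<bullet> ar (Loop T) (q (Cod K g))),
    Add T (i (Dom K g) \<bullet> ar F f \<bullet> p (Dom K f)) (j (Dom K g) \<bullet> ar G f \<bullet> q (Dom K f)),
    Add T (i (Cod K g) \<bullet> ar F g \<bullet> p (Dom K g)) (j (Cod K g) \<bullet> ar G g \<bullet> q (Dom K g))) \<in> Tri T"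
    by (rule F.T.Tri_biproduct[where PA = "P (Dom K f)" and PB = "P (Dom K g)" and PC = "P (Cod K g)", OF F.Tri_map[OF t(2)] G.Tri_map[OF t(2)]]) (simp_all add: bip)
  then show "case t of (h, f, g) \<Rightarrow> (ar D h \<bullet> \<chi> (Cod K g), ar D f, ar D g) \<in> Tri T"
    by (simp add: t(1) sum_func_def sum_shift_def)
qed

end

section \<open>Natural transformations of homology theories\<close>

definition theory_map where
  "theory_map C Ext T H \<delta>H H' \<delta>H' \<alpha> \<longleftrightarrow>
    (\<forall>A\<in>Obj C. \<alpha> A \<in> arrows T (ob H A) (ob H' A)) \<and>
    (\<forall>f\<in>Arr C. \<alpha> (Cod C f) \<bullet>\<^bsub>T\<^esub> ar H f = ar H' f \<bullet>\<^bsub>T\<^esub> \<alpha> (Dom C f)) \<and>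
    (\<forall>(i, p)\<in>Ext. \<alpha> (Dom C i) \<bullet>\<^bsub>T\<^esub> \<delta>H (i, p) = \<delta>H' (i, p) \<bullet>\<^bsub>T\<^esub> ar (Loop T) (\<alpha> (Cod C p)))"

text \<open>The boundary for which \<open>D\<close>, together with its shift isomorphism
  \<open>\<chi>\<close>, factors the theory \<open>comp_func D J\<close> by construction.\<close>

definition composite_boundary where
  "composite_boundary C J \<delta> T D \<chi> e = ar D (\<delta> e) \<bullet>\<^bsub>T\<^esub> \<chi> (ob J (Cod C (snd e)))"

text \<open>The universal property is only asked for theories of the form
  \<open>comp_func D J\<close>. These inherit every stability condition from \<open>J\<close>, so
  the locale need not know which conditions define the theory and covers kk and kk^h alike.\<close>

locale universal_theory = C: catg C + K: triang K + T: triang T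
  for C :: "('o, 'c, 'z) category_scheme" and K :: "('o, 'm) tricat" and T :: "('p, 'n) tricat" (structure) +
  fixes Ext J \<delta>
  assumes exc: "excisive C Ext K J \<delta>"
    and Ext: "(i, p) \<in> Ext \<Longrightarrow> i \<in> Arr C \<and> p \<in> Arr C"
    and Obj_K: "Obj K = Obj C"
    and ob_J: "A \<in> Obj C \<Longrightarrow> ob J A = A"
    and uniq: "triangulated_functor K T D \<chi> \<Longrightarrow>
      factors_uniquely C Ext K J \<delta> T (comp_func D J) (composite_boundary C J \<delta> T D \<chi>)"
begin

lemma boundary_Arr:
  assumes "(i, p) \<in> Ext"
  shows "\<delta> (i, p) \<in> Arr K" "Dom K (\<delta> (i, p)) = ob (Loop K) (Cod C p)" "Cod K (\<delta> (i, p)) = Dom C i"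
proof -
  have J: "functr C K J" using exc by unfold_locales (simp add: excisive_def)
  interpret J: functr C K J by (rule J)
  have t: "(\<delta> (i, p), ar J i, ar J p) \<in> Tri K" using exc assms unfolding excisive_def by fast
  show "\<delta> (i, p) \<in> Arr K" "Dom K (\<delta> (i, p)) = ob (Loop K) (Cod C p)" "Cod K (\<delta> (i, p)) = Dom C i"
    using K.Tri_Arr[OF t] Ext[OF assms] by (simp_all add: ob_J)
qed

text \<open>The equations make \<open>D'\<close> a factorization of the very theory that
  \<open>D\<close> factors by construction.\<close>

lemma factors_eq:
  assumes D: "triangulated_functor K T D \<chi>" and D': "triangulated_functor K T D' \<chi>'"
    and "\<And>A. A \<in> Obj C \<Longrightarrow> ob D (ob J A) = ob D' (ob J A)"
    and "\<And>f. f \<in> Arr C \<Longrightarrow> ar D (ar J f) = ar D' (ar J f)"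
    and "\<And>i p. (i, p) \<in> Ext \<Longrightarrow> ar D (\<delta> (i, p)) \<bullet> \<chi> (Cod C p) = ar D' (\<delta> (i, p)) \<bullet> \<chi>' (Cod C p)"
  shows "eq_func K D D'"
proof -
  have "factors_through C Ext K J \<delta> T (comp_func D J) (composite_boundary C J \<delta> T D \<chi>) D \<chi>"
    using D by (auto simp: factors_through_def eq_func_def composite_boundary_def)
  moreover have "factors_through C Ext K J \<delta> T (comp_func D J) (composite_boundary C J \<delta> T D \<chi>) D' \<chi>'"
    using D' assms(3-5) Ext by (auto simp: factors_through_def eq_func_def composite_boundary_def comp_func_def ob_J)
  ultimately show ?thesis using uniq[OF D] unfolding factors_uniquely_def by blast
qed

end

lemma (in preadd) Add_Neg_swap [simp]: "\<lbrakk>f \<in> Arr T; g \<in> Arr T; Dom T f = Dom T g; Cod T f = Cod T g\<rbrakk> \<Longrightarrow>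
    Add T f (Add T g (Neg T f)) = g"
  by (subst Add_left_commute) simp_all

text \<open>The automorphism \<open>(1 0; \<alpha> 1)\<close> of \<open>F \<oplus> G\<close> on the theory level changes the biproduct data, hence the
  functor \<open>F \<oplus> G\<close>, but not the theory that it factors.  Uniqueness of factorizations therefore
  gives the naturality of \<open>\<alpha>\<close> on all of \<open>K\<close>.\<close>

lemma (in universal_theory) theory_map_natural:
  assumes F: "triangulated_functor K T F \<phi>" and G: "triangulated_functor K T G \<gamma>"
    and \<alpha>: "theory_map C Ext T (comp_func F J) (composite_boundary C J \<delta> T F \<phi>)
      (comp_func G J) (composite_boundary C J \<delta> T G \<gamma>) \<alpha>"
    and f: "f \<in> Arr K"
  shows "\<alpha> (Cod K f) \<bullet> ar F f = ar G f \<bullet> \<alpha> (Dom K f)"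
proof -
  interpret F: trifun K T F \<phi> using F by unfold_locales
  interpret G: trifun K T G \<gamma> using G by unfold_locales
  interpret J: functr C K J using exc by unfold_locales (simp add: excisive_def)
  have \<alpha>_Arr [simp]: "\<alpha> A \<in> Arr T" "Dom T (\<alpha> A) = ob F A" "Cod T (\<alpha> A) = ob G A" if "A \<in> Obj K" for A
    using \<alpha> that unfolding theory_map_def by (auto simp: arrows_def comp_func_def ob_J Obj_K)
  have \<alpha>J: "\<alpha> (Cod C f) \<bullet> ar F (ar J f) = ar G (ar J f) \<bullet> \<alpha> (Dom C f)" if "f \<in> Arr C" for f
    using \<alpha> that unfolding theory_map_def by (auto simp: comp_func_def)
  have \<alpha>\<delta>: "\<alpha> (Dom C i) \<bullet> ar F (\<delta> (i, p)) \<bullet> \<phi> (Cod C p) = (ar G (\<delta> (i, p)) \<bullet> \<gamma> (Cod C p)) \<bullet> ar (Loop T) (\<alpha> (Cod C p))"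
    if "(i, p) \<in> Ext" for i p
  proof -
    have "\<alpha> (Dom C i) \<bullet> composite_boundary C J \<delta> T F \<phi> (i, p) =
        composite_boundary C J \<delta> T G \<gamma> (i, p) \<bullet> ar (Loop T) (\<alpha> (Cod C p))"
      using \<alpha> that unfolding theory_map_def by blast
    then show ?thesis using Ext[OF that] by (simp add: composite_boundary_def ob_J)
  qed
  define t where "t A = (SOME t. case t of (P, i, j, p, q) \<Rightarrow> biprod T (ob F A) (ob G A) P i j p q)" for A
  have t: "case t A of (P, i, j, p, q) \<Rightarrow> biprod T (ob F A) (ob G A) P i j p q" if A: "A \<in> Obj K" for A
  proof -
    obtain P i j p q where "biprod T (ob F A) (ob G A) P i j p q"
      by (rule T.biproductE[OF F.ob_Obj[OF A] G.ob_Obj[OF A]])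
    then have "case (P, i, j, p, q) of (P, i, j, p, q) \<Rightarrow> biprod T (ob F A) (ob G A) P i j p q"
      by (simp only: prod.case)
    then show ?thesis unfolding t_def by (rule someI)
  qed
  obtain P i j p q where bip: "\<And>A. A \<in> Obj K \<Longrightarrow> biprod T (ob F A) (ob G A) (P A) (i A) (j A) (p A) (q A)"
  proof
    fix A assume "A \<in> Obj K"
    from t[OF this] show "biprod T (ob F A) (ob G A) (fst (t A)) (fst (snd (t A))) (fst (snd (snd (t A))))
        (fst (snd (snd (snd (t A))))) (snd (snd (snd (snd (t A)))))"
      unfolding case_prod_beta .
  qed
  interpret D: sum_trifun K T F \<phi> G \<gamma> P i j p q
    by (intro sum_trifun.intro sum_trifun_axioms.intro F.trifun_axioms G.trifun_axioms bip)
  \<comment> \<open>A second splitting of the same \<open>P A\<close>: \<open>F A\<close> is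
    embedded as the graph of \<open>\<alpha> A\<close>, and the projection to \<open>G A\<close> is
    corrected to vanish on that graph; \<open>j\<close> and \<open>p\<close> stay.\<close>
  define i' where "i' A = Add T (i A) (j A \<bullet> \<alpha> A)" for A
  define q' where "q' A = Add T (q A) (Neg T (\<alpha> A \<bullet> p A))" for A
  interpret D': sum_trifun K T F \<phi> G \<gamma> P i' j p q'
  proof (intro sum_trifun.intro sum_trifun_axioms.intro F.trifun_axioms G.trifun_axioms)
    fix A assume [simp]: "A \<in> Obj K"
    show "biprod T (ob F A) (ob G A) (P A) (i' A) (j A) (p A) (q' A)"
    proof (intro biprod.intro biprod_axioms.intro)
      show "preadd T" by (rule T.preadd_axioms)
      have "Add T (i' A \<bullet> p A) (j A \<bullet> q' A) = Add T (i A \<bullet> p A) (j A \<bullet> q A)"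
        by (simp add: i'_def q'_def)
      then show "Add T (i' A \<bullet> p A) (j A \<bullet> q' A) = Id T (P A)"
        by (simp add: biprod.sum[OF bip])
      show "i' A \<in> Arr T" "Dom T (i' A) = ob F A" "Cod T (i' A) = P A"
        "q' A \<in> Arr T" "Dom T (q' A) = P A" "Cod T (q' A) = ob G A"
        by (simp_all add: i'_def q'_def)
      show "p A \<bullet> i' A = Id T (ob F A)"
        by (simp add: i'_def q'_def)
      show "q' A \<bullet> j A = Id T (ob G A)"
        by (simp add: i'_def q'_def)
      show "q' A \<bullet> i' A = Zero T (ob F A) (ob G A)"
        by (simp add: i'_def q'_def)
      show "j A \<in> Arr T" "Dom T (j A) = ob G A" "Cod T (j A) = P A"
        "p A \<in> Arr T" "Dom T (p A) = P A" "Cod T (p A) = ob F A" "p A \<bullet> j A = Zero T (ob G A) (ob F A)"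
        by simp_all
    qed
  qed
  have "eq_func K D.D D'.D"
  proof (rule factors_eq[OF D.D_triangulated D'.D_triangulated])
    show "ar D.D (ar J f) = ar D'.D (ar J f)" if f: "f \<in> Arr C" for f
    proof -
      have [simp]: "Dom C f \<in> Obj K" "Cod C f \<in> Obj K" using f by (simp_all add: Obj_K)
      show ?thesis using f
        by (simp add: sum_func_def i'_def q'_def ob_J T.comp_reassoc[OF \<alpha>J])
    qed
    show "ar D.D (\<delta> (u, v)) \<bullet> D.\<chi> (Cod C v) = ar D'.D (\<delta> (u, v)) \<bullet> D'.\<chi> (Cod C v)" if uv: "(u, v) \<in> Ext" for u v
    proof -
      have [simp]: "Dom C u \<in> Obj K" "Cod C v \<in> Obj K" using Ext[OF uv] by (simp_all add: Obj_K)
      note [simp] = boundary_Arr[OF uv]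
      have \<alpha>\<delta>': "\<alpha> (Dom C u) \<bullet> ar F (\<delta> (u, v)) \<bullet> \<phi> (Cod C v) \<bullet> ar (Loop T) (p (Cod C v)) =
         ar G (\<delta> (u, v)) \<bullet> \<gamma> (Cod C v) \<bullet> ar (Loop T) (\<alpha> (Cod C v)) \<bullet> ar (Loop T) (p (Cod C v))"
        using arg_cong[OF \<alpha>\<delta>[OF uv], of "\<lambda>x. x \<bullet> ar (Loop T) (p (Cod C v))"] by simp
      show ?thesis
        by (simp add: sum_func_def sum_shift_def i'_def q'_def \<alpha>\<delta>')
    qed
  qed (simp add: sum_func_def)
  then have "ar D'.D f = ar D.D f" using f by (simp add: eq_func_def)
  \<comment> \<open>The entry from \<open>F\<close> to \<open>G\<close> of the two equal arrows,
    read in the old splitting: it is zero for the sum along the old splitting and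
    \<open>\<alpha> F f - G f \<alpha>\<close> for the sum along the new one.\<close>
  then have "q (Cod K f) \<bullet> ar D'.D f \<bullet> i (Dom K f) = q (Cod K f) \<bullet> ar D.D f \<bullet> i (Dom K f)"
    by simp
  then have *: "Add T (\<alpha> (Cod K f) \<bullet> ar F f) (Neg T (ar G f \<bullet> \<alpha> (Dom K f))) = Zero T (ob F (Dom K f)) (ob G (Cod K f))"
    using f by (simp add: sum_func_def i'_def q'_def)
  show ?thesis
    using T.Add_left_cancel[of "Neg T (ar G f \<bullet> \<alpha> (Dom K f))" "\<alpha> (Cod K f) \<bullet> ar F f" "ar G f \<bullet> \<alpha> (Dom K f)"] f *
    by (simp add: T.Add_commute)
qed

lemma (in triang) triangulated_Id:
  "triangulated_functor T T \<lparr>ob = \<lambda>A. A, ar = \<lambda>f. f\<rparr> (\<lambda>A. Id T (ob (Loop T) A))"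
  unfolding triangulated_functor_def additive_functor_def is_functor_def
  by (auto simp: arrows_def Tri_Arr)

lemma triangulated_comp:
  assumes "triangulated K" "triangulated T" "triangulated V"
    and F: "triangulated_functor K T F \<phi>" and G: "triangulated_functor T V G \<gamma>"
  shows "triangulated_functor K V (comp_func G F) (\<lambda>A. ar G (\<phi> A) \<bullet>\<^bsub>V\<^esub> \<gamma> (ob F A))"
proof -
  interpret F: trifun K T F \<phi> using assms by unfold_locales
  interpret G: trifun T V G \<gamma> using assms by unfold_locales
  show ?thesis
    unfolding triangulated_functor_def
  proof (intro conjI ballI)
    show "additive_functor K V (comp_func G F)"
      unfolding additive_functor_def is_functor_def by (auto simp: arrows_def comp_func_def)
    show "ar G (\<phi> A) \<bullet>\<^bsub>V\<^esub> \<gamma> (ob F A) \<in> arrows V (ob (Loop V) (ob (comp_func G F) A)) (ob (comp_func G F) (ob (Loop K) A))"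
      if "A \<in> Obj K" for A
      using that by (simp add: arrows_def comp_func_def)
    show "iso_arrow V (ar G (\<phi> A) \<bullet>\<^bsub>V\<^esub> \<gamma> (ob F A))" if "A \<in> Obj K" for A
      using that by (intro G.T.iso_arrow_comp) simp_all
    show "ar (comp_func G F) (ar (Loop K) f) \<bullet>\<^bsub>V\<^esub> ar G (\<phi> (Dom K f)) \<bullet>\<^bsub>V\<^esub> \<gamma> (ob F (Dom K f)) =
        (ar G (\<phi> (Cod K f)) \<bullet>\<^bsub>V\<^esub> \<gamma> (ob F (Cod K f))) \<bullet>\<^bsub>V\<^esub> ar (Loop V) (ar (comp_func G F) f)"
      if f: "f \<in> Arr K" for f
    proof -
      have 1: "ar G (ar F (ar (Loop K) f)) \<bullet>\<^bsub>V\<^esub> ar G (\<phi> (Dom K f)) = ar G (\<phi> (Cod K f)) \<bullet>\<^bsub>V\<^esub> ar G (ar (Loop T) (ar F f))"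
        using arg_cong[OF F.\<phi>_natural[OF f], of "ar G"] f by simp
      have 2: "ar G (ar (Loop T) (ar F f)) \<bullet>\<^bsub>V\<^esub> \<gamma> (ob F (Dom K f)) = \<gamma> (ob F (Cod K f)) \<bullet>\<^bsub>V\<^esub> ar (Loop V) (ar G (ar F f))"
        using G.\<phi>_natural[of "ar F f"] f by simp
      show ?thesis using f 2 by (simp add: comp_func_def G.T.comp_reassoc[OF 1])
    qed
    fix t assume "t \<in> Tri K"
    then obtain h f g where t: "t = (h, f, g)" "(h, f, g) \<in> Tri K" by (cases t) auto
    note [simp] = F.K.Tri_Arr[OF t(2)]
    show "case t of (h, f, g) \<Rightarrow> (ar (comp_func G F) h \<bullet>\<^bsub>V\<^esub> ar G (\<phi> (Cod K g)) \<bullet>\<^bsub>V\<^esub> \<gamma> (ob F (Cod K g)),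
        ar (comp_func G F) f, ar (comp_func G F) g) \<in> Tri V"
      using G.Tri_map[OF F.Tri_map[OF t(2)]] by (simp add: t(1) comp_func_def)
  qed
qed

lemma excisive_composite:
  assumes "is_category C" "triangulated T" "excisive C Ext K J \<delta>" "triangulated_functor K T D \<chi>"
    and Ext: "\<And>i p. (i, p) \<in> Ext \<Longrightarrow> i \<in> Arr C \<and> p \<in> Arr C"
  shows "excisive C Ext T (comp_func D J) (composite_boundary C J \<delta> T D \<chi>)"
proof -
  interpret C: catg C using assms by unfold_locales
  have K: "triangulated K" "is_functor C K J" using assms(3) by (simp_all add: excisive_def)
  interpret D: trifun K T D \<chi> using assms K by unfold_locales
  interpret J: functr C K J using K by unfold_locales
  have tri: "(\<delta> (i, p), ar J i, ar J p) \<in> Tri K" if "(i, p) \<in> Ext" for i p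
    using assms(3) that unfolding excisive_def by fast
  have key: "ar (comp_func D J) a \<bullet>\<^bsub>T\<^esub> composite_boundary C J \<delta> T D \<chi> (i, p) =
        composite_boundary C J \<delta> T D \<chi> (i', p') \<bullet>\<^bsub>T\<^esub> ar (Loop T) (ar (comp_func D J) c)"
    if e: "(i, p) \<in> Ext" "(i', p') \<in> Ext"
      and abc: "a \<in> arrows C (Dom C i) (Dom C i')" "b \<in> arrows C (Cod C i) (Cod C i')"
        "c \<in> arrows C (Cod C p) (Cod C p')" "b \<bullet>\<^bsub>C\<^esub> i = i' \<bullet>\<^bsub>C\<^esub> a" "c \<bullet>\<^bsub>C\<^esub> p = p' \<bullet>\<^bsub>C\<^esub> b" for i p i' p' a b c
  proof -
    have [simp]: "i \<in> Arr C" "p \<in> Arr C" "i' \<in> Arr C" "p' \<in> Arr C" using e Ext by auto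
    note [simp] = D.K.Tri_Arr[OF tri[OF e(1)]] D.K.Tri_Arr[OF tri[OF e(2)]]
    have nat: "ar J a \<bullet>\<^bsub>K\<^esub> \<delta> (i, p) = \<delta> (i', p') \<bullet>\<^bsub>K\<^esub> ar (Loop K) (ar J c)"
      using assms(3)[unfolded excisive_def, THEN conjunct2, THEN conjunct2, THEN conjunct2] abc e by blast
    have [simp]: "a \<in> Arr C" "Dom C a = Dom C i" "Cod C a = Dom C i'" "c \<in> Arr C" "Dom C c = Cod C p" "Cod C c = Cod C p'"
      using abc by (simp_all add: arrows_def)
    have 1: "ar D (ar J a) \<bullet>\<^bsub>T\<^esub> ar D (\<delta> (i, p)) = ar D (\<delta> (i', p')) \<bullet>\<^bsub>T\<^esub> ar D (ar (Loop K) (ar J c))"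
      using arg_cong[OF nat, of "ar D"] by simp
    show ?thesis
      using D.\<phi>_natural[of "ar J c"]
      by (simp add: comp_func_def composite_boundary_def D.T.comp_reassoc[OF 1])
  qed
  show ?thesis unfolding excisive_def
  proof (intro conjI)
    show "triangulated T" by fact
    show "is_functor C T (comp_func D J)"
      unfolding is_functor_def by (auto simp: comp_func_def arrows_def)
    show "\<forall>(i, p)\<in>Ext. (composite_boundary C J \<delta> T D \<chi> (i, p), ar (comp_func D J) i, ar (comp_func D J) p) \<in> Tri T"
    proof clarify
      fix i p assume e: "(i, p) \<in> Ext"
      show "(composite_boundary C J \<delta> T D \<chi> (i, p), ar (comp_func D J) i, ar (comp_func D J) p) \<in> Tri T"
        using D.Tri_map[OF tri[OF e]] Ext[OF e] by (simp add: comp_func_def composite_boundary_def)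
    qed
  qed (use key in blast)
qed

section \<open>Adjunctions\<close>

text \<open>The transpose of \<open>f\<close> is \<open>ar G f\<close> after the unit; it is a group
  homomorphism because \<open>G\<close> is additive and composition is bilinear.\<close>

lemma left_adjointI:
  assumes C: "preadditive C" and D: "preadditive D"
    and F: "additive_functor C D F" and G: "additive_functor D C G"
    and \<eta>: "\<And>A. A \<in> Obj C \<Longrightarrow> \<eta> A \<in> arrows C A (ob G (ob F A))"
    and \<epsilon>: "\<And>B. B \<in> Obj D \<Longrightarrow> \<epsilon> B \<in> arrows D (ob F (ob G B)) B"
    and \<eta>_nat: "\<And>f. f \<in> Arr C \<Longrightarrow> \<eta> (Cod C f) \<bullet>\<^bsub>C\<^esub> f = ar G (ar F f) \<bullet>\<^bsub>C\<^esub> \<eta> (Dom C f)"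
    and \<epsilon>_nat: "\<And>f. f \<in> Arr D \<Longrightarrow> \<epsilon> (Cod D f) \<bullet>\<^bsub>D\<^esub> ar F (ar G f) = f \<bullet>\<^bsub>D\<^esub> \<epsilon> (Dom D f)"
    and FT: "\<And>A. A \<in> Obj C \<Longrightarrow> \<epsilon> (ob F A) \<bullet>\<^bsub>D\<^esub> ar F (\<eta> A) = Id D (ob F A)"
    and GT: "\<And>B. B \<in> Obj D \<Longrightarrow> ar G (\<epsilon> B) \<bullet>\<^bsub>C\<^esub> \<eta> (ob G B) = Id C (ob G B)"
  shows "left_adjoint C D F G"
proof -
  interpret F: addfun C D F using C D F by unfold_locales
  interpret G: addfun D C G using C D G by unfold_locales
  have [simp]: "\<eta> A \<in> Arr C" "Dom C (\<eta> A) = A" "Cod C (\<eta> A) = ob G (ob F A)" if "A \<in> Obj C" for A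
    using \<eta>[OF that] by (simp_all add: arrows_def)
  have [simp]: "\<epsilon> B \<in> Arr D" "Dom D (\<epsilon> B) = ob F (ob G B)" "Cod D (\<epsilon> B) = B" if "B \<in> Obj D" for B
    using \<epsilon>[OF that] by (simp_all add: arrows_def)
  define \<Phi> where "\<Phi> A B f = ar G f \<bullet>\<^bsub>C\<^esub> \<eta> A" for A and B :: 'c and f
  show ?thesis unfolding left_adjoint_def
  proof (intro exI[of _ \<Phi>] conjI ballI)
    fix A B assume A: "A \<in> Obj C" and B: "B \<in> Obj D"
    have 1: "\<epsilon> B \<bullet>\<^bsub>D\<^esub> ar F (\<Phi> A B f) = f" if f: "f \<in> arrows D (ob F A) B" for f
    proof -
      have [simp]: "f \<in> Arr D" "Dom D f = ob F A" "Cod D f = B" using f by (simp_all add: arrows_def)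
      have "\<epsilon> B \<bullet>\<^bsub>D\<^esub> ar F (\<Phi> A B f) = \<epsilon> B \<bullet>\<^bsub>D\<^esub> ar F (ar G f) \<bullet>\<^bsub>D\<^esub> ar F (\<eta> A)"
        using A by (simp add: \<Phi>_def)
      also have "\<dots> = f \<bullet>\<^bsub>D\<^esub> \<epsilon> (ob F A) \<bullet>\<^bsub>D\<^esub> ar F (\<eta> A)"
        using A B \<epsilon>_nat[of f] by (simp flip: F.T.comp_assoc)
      also have "\<dots> = f" using A by (simp add: FT)
      finally show ?thesis .
    qed
    have 2: "\<Phi> A B (\<epsilon> B \<bullet>\<^bsub>D\<^esub> ar F g) = g" if g: "g \<in> arrows C A (ob G B)" for g
    proof -
      have [simp]: "g \<in> Arr C" "Dom C g = A" "Cod C g = ob G B" using g by (simp_all add: arrows_def)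
      have "\<Phi> A B (\<epsilon> B \<bullet>\<^bsub>D\<^esub> ar F g) = ar G (\<epsilon> B) \<bullet>\<^bsub>C\<^esub> \<eta> (ob G B) \<bullet>\<^bsub>C\<^esub> g"
        using A B \<eta>_nat[of g] by (simp add: \<Phi>_def)
      also have "\<dots> = g" using B GT by (simp flip: F.S.comp_assoc)
      finally show ?thesis .
    qed
    have 3: "\<Phi> A B f \<in> arrows C A (ob G B)" if "f \<in> arrows D (ob F A) B" for f
      using that A B by (simp add: \<Phi>_def arrows_def)
    have 4: "\<epsilon> B \<bullet>\<^bsub>D\<^esub> ar F g \<in> arrows D (ob F A) B" if "g \<in> arrows C A (ob G B)" for g
      using that A B by (simp add: arrows_def)
    have "bij_betw (\<Phi> A B) (arrows D (ob F A) B) (arrows C A (ob G B))"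
      using 1 2 3 4 by (intro bij_betw_byWitness[where f' = "\<lambda>g. \<epsilon> B \<bullet>\<^bsub>D\<^esub> ar F g"]) auto
    moreover have "\<Phi> A B (Add D f g) = Add C (\<Phi> A B f) (\<Phi> A B g)"
      if "f \<in> arrows D (ob F A) B" "g \<in> arrows D (ob F A) B" for f g
      using that A by (simp add: \<Phi>_def arrows_def)
    ultimately show "\<Phi> A B \<in> iso (hom_group D (ob F A) B) (hom_group C A (ob G B))"
      using 3 by (auto simp: iso_def hom_def hom_group_def)
  next
    fix A A' B B' a b f
    assume "A \<in> Obj C" "A' \<in> Obj C" "B \<in> Obj D" "B' \<in> Obj D"
      and "a \<in> arrows C A' A" "b \<in> arrows D B B'" "f \<in> arrows D (ob F A) B"
    then have [simp]: "A \<in> Obj C" "A' \<in> Obj C" "B \<in> Obj D" "B' \<in> Obj D" "a \<in> Arr C" "Dom C a = A'" "Cod C a = A"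
      "b \<in> Arr D" "Dom D b = B" "Cod D b = B'" "f \<in> Arr D" "Dom D f = ob F A" "Cod D f = B"
      by (simp_all add: arrows_def)
    show "\<Phi> A' B' (b \<bullet>\<^bsub>D\<^esub> f \<bullet>\<^bsub>D\<^esub> ar F a) = ar G b \<bullet>\<^bsub>C\<^esub> \<Phi> A B f \<bullet>\<^bsub>C\<^esub> a"
      using \<eta>_nat[of a] by (simp add: \<Phi>_def)
  qed
qed

section \<open>Induced functors\<close>

definition Id_func where "Id_func = \<lparr>ob = \<lambda>A. A, ar = \<lambda>f. f\<rparr>"

lemma comp_func_Id [simp]: "comp_func F Id_func = F" "comp_func Id_func F = F"
  by (simp_all add: comp_func_def Id_func_def comp_def)

lemma pull_boundary_Id [simp]: "pull_boundary \<delta> Id_func = \<delta>"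
  by (simp add: pull_boundary_def Id_func_def map_prod.identity map_prod_def comp_def)

definition preserves_ext where
  "preserves_ext C Ext C' Ext' R \<longleftrightarrow> is_functor C C' R \<and> (\<forall>(i, p)\<in>Ext. (ar R i, ar R p) \<in> Ext')"

definition ext_arrows where
  "ext_arrows C Ext \<longleftrightarrow> is_category C \<and> (\<forall>(i, p)\<in>Ext. i \<in> Arr C \<and> p \<in> Arr C \<and> Cod C i = Dom C p)"

lemma preserves_ext_Id: "is_category C \<Longrightarrow> preserves_ext C Ext C Ext Id_func"
  by (auto simp: preserves_ext_def Id_func_def is_functor_def is_category_def arrows_def)

lemma preserves_ext_comp:
  assumes "is_category C" "is_category C'" "is_category C''"
    and "preserves_ext C Ext C' Ext' R" "preserves_ext C' Ext' C'' Ext'' S"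
  shows "preserves_ext C Ext C'' Ext'' (comp_func S R)"
proof -
  interpret R: functr C C' R using assms by unfold_locales (simp_all add: preserves_ext_def)
  interpret S: functr C' C'' S using assms by unfold_locales (simp_all add: preserves_ext_def)
  show ?thesis using assms(4,5) unfolding preserves_ext_def is_functor_def
    by (auto simp: comp_func_def arrows_def)
qed

lemma excisive_boundary:
  assumes "ext_arrows C Ext" "excisive C Ext T H \<delta>" "(i, p) \<in> Ext"
  shows "\<delta> (i, p) \<in> Arr T" "Dom T (\<delta> (i, p)) = ob (Loop T) (ob H (Cod C p))" "Cod T (\<delta> (i, p)) = ob H (Dom C i)"
proof -
  interpret T: triang T using assms(2) by unfold_locales (simp add: excisive_def)
  interpret H: functr C T H using assms(1,2) by unfold_locales (simp_all add: excisive_def ext_arrows_def)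
  have t: "(\<delta> (i, p), ar H i, ar H p) \<in> Tri T" using assms(2,3) unfolding excisive_def by fast
  have [simp]: "i \<in> Arr C" "p \<in> Arr C" using assms unfolding ext_arrows_def by fast+
  show "\<delta> (i, p) \<in> Arr T" "Dom T (\<delta> (i, p)) = ob (Loop T) (ob H (Cod C p))" "Cod T (\<delta> (i, p)) = ob H (Dom C i)"
    using T.Tri_Arr[OF t] by simp_all
qed

lemma excisive_natural:
  assumes "excisive C Ext T H \<delta>" "(i, p) \<in> Ext" "(i', p') \<in> Ext"
    "a \<in> arrows C (Dom C i) (Dom C i')" "b \<in> arrows C (Cod C i) (Cod C i')"
    "c \<in> arrows C (Cod C p) (Cod C p')" "b \<bullet>\<^bsub>C\<^esub> i = i' \<bullet>\<^bsub>C\<^esub> a" "c \<bullet>\<^bsub>C\<^esub> p = p' \<bullet>\<^bsub>C\<^esub> b"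
  shows "ar H a \<bullet>\<^bsub>T\<^esub> \<delta> (i, p) = \<delta> (i', p') \<bullet>\<^bsub>T\<^esub> ar (Loop T) (ar H c)"
  using assms(1)[unfolded excisive_def, THEN conjunct2, THEN conjunct2, THEN conjunct2] assms(2-) by blast

lemma theory_mapD:
  assumes "theory_map C Ext T H \<delta>H H' \<delta>H' \<alpha>"
  shows "A \<in> Obj C \<Longrightarrow> \<alpha> A \<in> Arr T" "A \<in> Obj C \<Longrightarrow> Dom T (\<alpha> A) = ob H A" "A \<in> Obj C \<Longrightarrow> Cod T (\<alpha> A) = ob H' A"
    "f \<in> Arr C \<Longrightarrow> \<alpha> (Cod C f) \<bullet>\<^bsub>T\<^esub> ar H f = ar H' f \<bullet>\<^bsub>T\<^esub> \<alpha> (Dom C f)"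
    "(i, p) \<in> Ext \<Longrightarrow> \<alpha> (Dom C i) \<bullet>\<^bsub>T\<^esub> \<delta>H (i, p) = \<delta>H' (i, p) \<bullet>\<^bsub>T\<^esub> ar (Loop T) (\<alpha> (Cod C p))"
  using assms unfolding theory_map_def arrows_def by auto

text \<open>A componentwise inverse of a theory map is again a theory map, so a zigzag from
  \<open>H\<close> to \<open>H'\<close> and back to \<open>H''\<close> can be composed. The second
  counit is such a zigzag: its backward arrow is inverted only in kk^h, not among
  homomorphisms.\<close>

lemma theory_map_comp_inverse:
  assumes ext: "ext_arrows C Ext"
    and H: "excisive C Ext T H \<delta>" "excisive C Ext T H' \<delta>'" "excisive C Ext T H'' \<delta>''"
    and \<alpha>: "theory_map C Ext T H \<delta> H' \<delta>' \<alpha>" and \<beta>: "theory_map C Ext T H'' \<delta>'' H' \<delta>' \<beta>"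
    and inv: "\<And>A. A \<in> Obj C \<Longrightarrow> \<beta>' A \<in> arrows T (ob H' A) (ob H'' A)"
      "\<And>A. A \<in> Obj C \<Longrightarrow> \<beta>' A \<bullet>\<^bsub>T\<^esub> \<beta> A = Id T (ob H'' A)"
      "\<And>A. A \<in> Obj C \<Longrightarrow> \<beta> A \<bullet>\<^bsub>T\<^esub> \<beta>' A = Id T (ob H' A)"
  shows "theory_map C Ext T H \<delta> H'' \<delta>'' (\<lambda>A. \<beta>' A \<bullet>\<^bsub>T\<^esub> \<alpha> A)"
proof -
  interpret T: triang T using H(1) by unfold_locales (simp add: excisive_def)
  interpret H: functr C T H using H ext by unfold_locales (simp_all add: excisive_def ext_arrows_def)
  interpret H': functr C T H' using H ext by unfold_locales (simp_all add: excisive_def ext_arrows_def)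
  interpret H'': functr C T H'' using H ext by unfold_locales (simp_all add: excisive_def ext_arrows_def)
  note [simp] = theory_mapD(1-3)[OF \<alpha>] theory_mapD(1-3)[OF \<beta>]
  have [simp]: "\<beta>' A \<in> Arr T" "Dom T (\<beta>' A) = ob H' A" "Cod T (\<beta>' A) = ob H'' A" if "A \<in> Obj C" for A
    using inv(1)[OF that] by (simp_all add: arrows_def)
  have [simp]: "\<beta>' A \<bullet>\<^bsub>T\<^esub> \<beta> A \<bullet>\<^bsub>T\<^esub> x = x" if "A \<in> Obj C" "x \<in> Arr T" "Cod T x = ob H'' A" for A x
    using that by (simp add: T.comp_reassoc[OF inv(2)])
  have [simp]: "\<beta> A \<bullet>\<^bsub>T\<^esub> \<beta>' A \<bullet>\<^bsub>T\<^esub> x = x" if "A \<in> Obj C" "x \<in> Arr T" "Cod T x = ob H' A" for A x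
    using that by (simp add: T.comp_reassoc[OF inv(3)])
  have 1: "\<beta>' (Cod C f) \<bullet>\<^bsub>T\<^esub> ar H' f = ar H'' f \<bullet>\<^bsub>T\<^esub> \<beta>' (Dom C f)" if f: "f \<in> Arr C" for f
  proof -
    \<comment> \<open>Inserting \<open>\<beta> \<bullet> \<beta>'\<close> on the source side makes
      the naturality square of \<open>\<beta>\<close> applicable.\<close>
    have "\<beta>' (Cod C f) \<bullet>\<^bsub>T\<^esub> ar H' f = \<beta>' (Cod C f) \<bullet>\<^bsub>T\<^esub> (ar H' f \<bullet>\<^bsub>T\<^esub> \<beta> (Dom C f)) \<bullet>\<^bsub>T\<^esub> \<beta>' (Dom C f)"
      using f by (simp add: inv(3))
    also have "\<dots> = ar H'' f \<bullet>\<^bsub>T\<^esub> \<beta>' (Dom C f)"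
      unfolding theory_mapD(4)[OF \<beta> f, symmetric] using f by simp
    finally show ?thesis .
  qed
  have 2: "\<beta>' (Dom C i) \<bullet>\<^bsub>T\<^esub> \<delta>' (i, p) = \<delta>'' (i, p) \<bullet>\<^bsub>T\<^esub> ar (Loop T) (\<beta>' (Cod C p))" if e: "(i, p) \<in> Ext" for i p
  proof -
    have [simp]: "i \<in> Arr C" "p \<in> Arr C" using ext e unfolding ext_arrows_def by fast+
    note [simp] = excisive_boundary[OF ext H(2) e] excisive_boundary[OF ext H(3) e]
    have L: "ar (Loop T) (\<beta> (Cod C p)) \<bullet>\<^bsub>T\<^esub> ar (Loop T) (\<beta>' (Cod C p)) = Id T (ob (Loop T) (ob H' (Cod C p)))"
      using arg_cong[OF inv(3), of "Cod C p" "ar (Loop T)"] by simp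
    have "\<beta>' (Dom C i) \<bullet>\<^bsub>T\<^esub> \<delta>' (i, p) = \<beta>' (Dom C i) \<bullet>\<^bsub>T\<^esub> (\<delta>' (i, p) \<bullet>\<^bsub>T\<^esub> ar (Loop T) (\<beta> (Cod C p))) \<bullet>\<^bsub>T\<^esub> ar (Loop T) (\<beta>' (Cod C p))"
      by (simp add: L)
    also have "\<dots> = \<delta>'' (i, p) \<bullet>\<^bsub>T\<^esub> ar (Loop T) (\<beta>' (Cod C p))"
      unfolding theory_mapD(5)[OF \<beta> e, symmetric] by simp
    finally show ?thesis .
  qed
  show ?thesis unfolding theory_map_def
  proof (intro conjI ballI)
    show "\<beta>' A \<bullet>\<^bsub>T\<^esub> \<alpha> A \<in> arrows T (ob H A) (ob H'' A)" if "A \<in> Obj C" for A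
      using that by (simp add: arrows_def)
    show "(\<beta>' (Cod C f) \<bullet>\<^bsub>T\<^esub> \<alpha> (Cod C f)) \<bullet>\<^bsub>T\<^esub> ar H f = ar H'' f \<bullet>\<^bsub>T\<^esub> \<beta>' (Dom C f) \<bullet>\<^bsub>T\<^esub> \<alpha> (Dom C f)" if f: "f \<in> Arr C" for f
      using f by (simp add: theory_mapD(4)[OF \<alpha> f] T.comp_reassoc[OF 1])
    fix e assume e: "e \<in> Ext"
    obtain i p where ip: "e = (i, p)" by (cases e)
    note e = e[unfolded ip]
    have [simp]: "i \<in> Arr C" "p \<in> Arr C" using ext e unfolding ext_arrows_def by fast+
    note [simp] = excisive_boundary[OF ext H(1) e] excisive_boundary[OF ext H(2) e] excisive_boundary[OF ext H(3) e]
    show "case e of (i, p) \<Rightarrow> (\<beta>' (Dom C i) \<bullet>\<^bsub>T\<^esub> \<alpha> (Dom C i)) \<bullet>\<^bsub>T\<^esub> \<delta> (i, p) = \<delta>'' (i, p) \<bullet>\<^bsub>T\<^esub> ar (Loop T) (\<beta>' (Cod C p) \<bullet>\<^bsub>T\<^esub> \<alpha> (Cod C p))"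
      by (simp add: ip theory_mapD(5)[OF \<alpha> e] T.comp_reassoc[OF 2[OF e]])
  qed
qed

lemma excisive_pull:
  assumes ext: "ext_arrows C Ext" "ext_arrows C' Ext'" and J: "excisive C' Ext' T J \<delta>" and R: "preserves_ext C Ext C' Ext' R"
  shows "excisive C Ext T (comp_func J R) (pull_boundary \<delta> R)"
proof -
  interpret R: functr C C' R using ext R by unfold_locales (simp_all add: ext_arrows_def preserves_ext_def)
  interpret T: triang T using J by unfold_locales (simp add: excisive_def)
  interpret J: functr C' T J using ext J by unfold_locales (simp_all add: ext_arrows_def excisive_def)
  have Ext': "(ar R i, ar R p) \<in> Ext'" if "(i, p) \<in> Ext" for i p
    using R that unfolding preserves_ext_def by fast
  have ip [simp]: "i \<in> Arr C" "p \<in> Arr C" if "(i, p) \<in> Ext" for i p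
    using ext that unfolding ext_arrows_def by fast+
  have key: "ar (comp_func J R) a \<bullet>\<^bsub>T\<^esub> pull_boundary \<delta> R (i, p) =
        pull_boundary \<delta> R (i', p') \<bullet>\<^bsub>T\<^esub> ar (Loop T) (ar (comp_func J R) c)"
    if e: "(i, p) \<in> Ext" "(i', p') \<in> Ext"
      and abc: "a \<in> arrows C (Dom C i) (Dom C i')" "b \<in> arrows C (Cod C i) (Cod C i')"
        "c \<in> arrows C (Cod C p) (Cod C p')" "b \<bullet>\<^bsub>C\<^esub> i = i' \<bullet>\<^bsub>C\<^esub> a" "c \<bullet>\<^bsub>C\<^esub> p = p' \<bullet>\<^bsub>C\<^esub> b" for i p i' p' a b c
  proof -
    note [simp] = ip[OF e(1)] ip[OF e(2)]
    have [simp]: "Cod C i = Dom C p" "Cod C i' = Dom C p'" using e ext unfolding ext_arrows_def by fast+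
    have eq: "ar R (b \<bullet>\<^bsub>C\<^esub> i) = ar R (i' \<bullet>\<^bsub>C\<^esub> a)" "ar R (c \<bullet>\<^bsub>C\<^esub> p) = ar R (p' \<bullet>\<^bsub>C\<^esub> b)"
      unfolding abc by (rule refl)+
    show ?thesis
      using excisive_natural[OF J Ext'[OF e(1)] Ext'[OF e(2)], of "ar R a" "ar R b" "ar R c"] eq abc(1-3)
      by (simp add: arrows_def comp_func_def pull_boundary_def)
  qed
  show ?thesis unfolding excisive_def
  proof (intro conjI)
    show "triangulated T" by (rule T.tri)
    show "is_functor C T (comp_func J R)"
      unfolding is_functor_def by (auto simp: comp_func_def arrows_def)
    show "\<forall>(i, p)\<in>Ext. (pull_boundary \<delta> R (i, p), ar (comp_func J R) i, ar (comp_func J R) p) \<in> Tri T"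
    proof clarify
      fix i p assume e: "(i, p) \<in> Ext"
      show "(pull_boundary \<delta> R (i, p), ar (comp_func J R) i, ar (comp_func J R) p) \<in> Tri T"
        using J Ext'[OF e] unfolding excisive_def by (fastforce simp: comp_func_def pull_boundary_def)
    qed
  qed (use key in blast)
qed

text \<open>A natural transformation between functors that preserve extensions is a map of the image
  extensions, so compatibility with boundaries is the naturality of the boundary in the target
  theory.\<close>

lemma theory_map_transformation:
  assumes ext: "ext_arrows C Ext" "ext_arrows C' Ext'" and J: "excisive C' Ext' T J \<delta>"
    and R: "preserves_ext C Ext C' Ext' R" and S: "preserves_ext C Ext C' Ext' S"
    and \<nu>: "\<And>A. A \<in> Obj C \<Longrightarrow> \<nu> A \<in> arrows C' (ob R A) (ob S A)"
      "\<And>f. f \<in> Arr C \<Longrightarrow> \<nu> (Cod C f) \<bullet>\<^bsub>C'\<^esub> ar R f = ar S f \<bullet>\<^bsub>C'\<^esub> \<nu> (Dom C f)"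
  shows "theory_map C Ext T (comp_func J R) (pull_boundary \<delta> R) (comp_func J S) (pull_boundary \<delta> S)
    (\<lambda>A. ar J (\<nu> A))"
proof -
  interpret R: functr C C' R using ext R by unfold_locales (simp_all add: ext_arrows_def preserves_ext_def)
  interpret S: functr C C' S using ext S by unfold_locales (simp_all add: ext_arrows_def preserves_ext_def)
  interpret T: triang T using J by unfold_locales (simp add: excisive_def)
  interpret J: functr C' T J using ext J by unfold_locales (simp_all add: ext_arrows_def excisive_def)
  have [simp]: "\<nu> A \<in> Arr C'" "Dom C' (\<nu> A) = ob R A" "Cod C' (\<nu> A) = ob S A" if "A \<in> Obj C" for A
    using \<nu>(1)[OF that] by (simp_all add: arrows_def)
  show ?thesis unfolding theory_map_def
  proof (intro conjI ballI)
    show "ar J (\<nu> A) \<in> arrows T (ob (comp_func J R) A) (ob (comp_func J S) A)" if "A \<in> Obj C" for A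
      using that by (simp add: arrows_def comp_func_def)
    show "ar J (\<nu> (Cod C f)) \<bullet>\<^bsub>T\<^esub> ar (comp_func J R) f = ar (comp_func J S) f \<bullet>\<^bsub>T\<^esub> ar J (\<nu> (Dom C f))"
      if "f \<in> Arr C" for f
      using that arg_cong[OF \<nu>(2)[OF that], of "ar J"] by (simp add: comp_func_def)
    fix e assume e: "e \<in> Ext"
    obtain i p where ip: "e = (i, p)" by (cases e)
    note e = e[unfolded ip]
    have [simp]: "i \<in> Arr C" "p \<in> Arr C" "Cod C i = Dom C p" using ext e unfolding ext_arrows_def by fast+
    have E: "(ar R i, ar R p) \<in> Ext'" "(ar S i, ar S p) \<in> Ext'"
      using R S e unfolding preserves_ext_def by fast+
    have "ar J (\<nu> (Dom C i)) \<bullet>\<^bsub>T\<^esub> \<delta> (ar R i, ar R p) = \<delta> (ar S i, ar S p) \<bullet>\<^bsub>T\<^esub> ar (Loop T) (ar J (\<nu> (Cod C p)))"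
      by (rule excisive_natural[OF J E, where b = "\<nu> (Dom C p)"])
        (use \<nu>(2)[of i] \<nu>(2)[of p] in \<open>simp_all add: arrows_def\<close>)
    then show "case e of (i, p) \<Rightarrow> ar J (\<nu> (Dom C i)) \<bullet>\<^bsub>T\<^esub> pull_boundary \<delta> R (i, p) =
        pull_boundary \<delta> S (i, p) \<bullet>\<^bsub>T\<^esub> ar (Loop T) (ar J (\<nu> (Cod C p)))"
      by (simp add: ip pull_boundary_def)
  qed
qed

text \<open>Boundaries are pulled back strictly, so the boundary of an image under \<open>R\<close>
  and then \<open>S\<close> is computed by the two factorizations in turn, which yields the
  composite shift isomorphism. Applied below to ind res and to res ind.\<close>

lemma factors_through_comp:
  assumes ext: "ext_arrows C Ext" "ext_arrows C' Ext'"
    and J: "excisive C Ext K J \<delta>" and J': "excisive C' Ext' K' J' \<delta>'" and K'': "triangulated K''"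
    and R: "preserves_ext C Ext C' Ext' R"
    and F: "factors_through C Ext K J \<delta> K' (comp_func J' R) (pull_boundary \<delta>' R) F \<phi>"
    and G: "factors_through C' Ext' K' J' \<delta>' K'' (comp_func J'' S) (pull_boundary \<delta>'' S) G \<gamma>"
  shows "factors_through C Ext K J \<delta> K'' (comp_func J'' (comp_func S R)) (pull_boundary \<delta>'' (comp_func S R))
    (comp_func G F) (\<lambda>A. ar G (\<phi> A) \<bullet>\<^bsub>K''\<^esub> \<gamma> (ob F A))"
proof -
  have tF: "triangulated_functor K K' F \<phi>" and tG: "triangulated_functor K' K'' G \<gamma>"
    using F G by (simp_all add: factors_through_def)
  have K: "triangulated K" "triangulated K'" using J J' by (simp_all add: excisive_def)
  interpret F: trifun K K' F \<phi> using K tF by unfold_locales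
  interpret G: trifun K' K'' G \<gamma> using K K'' tG by unfold_locales
  interpret R: functr C C' R using ext R by unfold_locales (simp_all add: ext_arrows_def preserves_ext_def)
  interpret J: functr C K J using ext J by unfold_locales (simp_all add: ext_arrows_def excisive_def)
  have obF: "ob F (ob J A) = ob J' (ob R A)" if "A \<in> Obj C" for A
    using F that by (auto simp: factors_through_def eq_func_def comp_func_def)
  have arF: "ar F (ar J f) = ar J' (ar R f)" if "f \<in> Arr C" for f
    using F that by (auto simp: factors_through_def eq_func_def comp_func_def)
  have obG: "ob G (ob J' A) = ob J'' (ob S A)" if "A \<in> Obj C'" for A
    using G that by (auto simp: factors_through_def eq_func_def comp_func_def)
  have arG: "ar G (ar J' f) = ar J'' (ar S f)" if "f \<in> Arr C'" for f
    using G that by (auto simp: factors_through_def eq_func_def comp_func_def)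
  show ?thesis unfolding factors_through_def
  proof (intro conjI)
    show "triangulated_functor K K'' (comp_func G F) (\<lambda>A. ar G (\<phi> A) \<bullet>\<^bsub>K''\<^esub> \<gamma> (ob F A))"
      by (rule triangulated_comp[OF K K'' tF tG])
    show "eq_func C (comp_func J'' (comp_func S R)) (comp_func (comp_func G F) J)"
      by (simp add: eq_func_def comp_func_def obF arF obG arG)
    show "\<forall>(i, p)\<in>Ext. pull_boundary \<delta>'' (comp_func S R) (i, p) =
        ar (comp_func G F) (\<delta> (i, p)) \<bullet>\<^bsub>K''\<^esub> ar G (\<phi> (ob J (Cod C p))) \<bullet>\<^bsub>K''\<^esub> \<gamma> (ob F (ob J (Cod C p)))"
    proof clarify
      fix i p assume e: "(i, p) \<in> Ext"
      have ip [simp]: "i \<in> Arr C" "p \<in> Arr C" using ext e unfolding ext_arrows_def by fast+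
      note [simp] = excisive_boundary[OF ext(1) J e]
      have E: "(ar R i, ar R p) \<in> Ext'" using R e unfolding preserves_ext_def by fast
      have "pull_boundary \<delta>'' (comp_func S R) (i, p) = pull_boundary \<delta>'' S (ar R i, ar R p)"
        by (simp add: pull_boundary_def comp_func_def)
      also have "\<dots> = ar G (\<delta>' (ar R i, ar R p)) \<bullet>\<^bsub>K''\<^esub> \<gamma> (ob J' (Cod C' (ar R p)))"
        using G E unfolding factors_through_def by fast
      also have "\<delta>' (ar R i, ar R p) = ar F (\<delta> (i, p)) \<bullet>\<^bsub>K'\<^esub> \<phi> (ob J (Cod C p))"
        using F e unfolding factors_through_def by (auto simp: pull_boundary_def)
      finally show "pull_boundary \<delta>'' (comp_func S R) (i, p) =
        ar (comp_func G F) (\<delta> (i, p)) \<bullet>\<^bsub>K''\<^esub> ar G (\<phi> (ob J (Cod C p))) \<bullet>\<^bsub>K''\<^esub> \<gamma> (ob F (ob J (Cod C p)))"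
        by (simp add: comp_func_def flip: obF)
    qed
  qed
qed

lemma factors_through_Id:
  assumes ext: "ext_arrows C Ext" and J: "excisive C Ext K J \<delta>"
  shows "factors_through C Ext K J \<delta> K J \<delta> Id_func (\<lambda>A. Id K (ob (Loop K) A))"
proof -
  interpret K: triang K using J by unfold_locales (simp add: excisive_def)
  interpret J: functr C K J using ext J by unfold_locales (simp_all add: ext_arrows_def excisive_def)
  have "\<delta> (i, p) = ar Id_func (\<delta> (i, p)) \<bullet>\<^bsub>K\<^esub> Id K (ob (Loop K) (ob J (Cod C p)))" if e: "(i, p) \<in> Ext" for i p
  proof -
    have [simp]: "p \<in> Arr C" using ext e unfolding ext_arrows_def by fast
    show ?thesis using excisive_boundary[OF ext J e] by (simp add: Id_func_def)
  qed
  then show ?thesis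
    using K.triangulated_Id[folded Id_func_def] by (auto simp: factors_through_def eq_func_def)
qed

text \<open>A factorization identifies its theory with \<open>comp_func F J\<close> only on objects,
  homomorphisms and extensions of \<open>C\<close>. This form of \<open>theory_map_natural\<close>
  accepts the theory as it is given, in particular a pulled back one.\<close>

lemma (in universal_theory) factors_through_natural:
  assumes F: "factors_through C Ext K J \<delta> T HF \<delta>F F \<phi>" and G: "factors_through C Ext K J \<delta> T HG \<delta>G G \<gamma>"
    and \<alpha>: "theory_map C Ext T HF \<delta>F HG \<delta>G \<alpha>" and f: "f \<in> Arr K"
  shows "\<alpha> (Cod K f) \<bullet> ar F f = ar G f \<bullet> \<alpha> (Dom K f)"
proof (rule theory_map_natural[OF _ _ _ f])
  show "triangulated_functor K T F \<phi>" "triangulated_functor K T G \<gamma>"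
    using F G by (simp_all add: factors_through_def)
  have F': "\<And>A. A \<in> Obj C \<Longrightarrow> ob HF A = ob (comp_func F J) A" "\<And>f. f \<in> Arr C \<Longrightarrow> ar HF f = ar (comp_func F J) f"
    "\<And>i p. (i, p) \<in> Ext \<Longrightarrow> \<delta>F (i, p) = composite_boundary C J \<delta> T F \<phi> (i, p)"
    using F by (auto simp: factors_through_def eq_func_def composite_boundary_def)
  have G': "\<And>A. A \<in> Obj C \<Longrightarrow> ob HG A = ob (comp_func G J) A" "\<And>f. f \<in> Arr C \<Longrightarrow> ar HG f = ar (comp_func G J) f"
    "\<And>i p. (i, p) \<in> Ext \<Longrightarrow> \<delta>G (i, p) = composite_boundary C J \<delta> T G \<gamma> (i, p)"
    using G by (auto simp: factors_through_def eq_func_def composite_boundary_def)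
  show "theory_map C Ext T (comp_func F J) (composite_boundary C J \<delta> T F \<phi>) (comp_func G J) (composite_boundary C J \<delta> T G \<gamma>) \<alpha>"
    unfolding theory_map_def
  proof (intro conjI ballI)
    fix e assume e: "e \<in> Ext"
    then show "case e of (i, p) \<Rightarrow> \<alpha> (Dom C i) \<bullet> composite_boundary C J \<delta> T F \<phi> (i, p) =
        composite_boundary C J \<delta> T G \<gamma> (i, p) \<bullet> ar (Loop T) (\<alpha> (Cod C p))"
      using theory_mapD(5)[OF \<alpha>] by (cases e) (simp add: F'(3) G'(3))
  qed (use theory_mapD(4)[OF \<alpha>] theory_mapD(1-3)[OF \<alpha>] in \<open>simp_all add: F'(1,2) G'(1,2) arrows_def\<close>)
qed

section \<open>Algebras and transport of structure\<close>

lemma is_algebraI: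
  fixes A :: "('a, 'b, 'z) module_scheme"
  assumes "cring l"
    and "\<And>x y. \<lbrakk>x \<in> carrier A; y \<in> carrier A\<rbrakk> \<Longrightarrow> x \<oplus>\<^bsub>A\<^esub> y \<in> carrier A"
    and "\<zero>\<^bsub>A\<^esub> \<in> carrier A"
    and "\<And>x y z. \<lbrakk>x \<in> carrier A; y \<in> carrier A; z \<in> carrier A\<rbrakk> \<Longrightarrow> (x \<oplus>\<^bsub>A\<^esub> y) \<oplus>\<^bsub>A\<^esub> z = x \<oplus>\<^bsub>A\<^esub> (y \<oplus>\<^bsub>A\<^esub> z)"
    and "\<And>x y. \<lbrakk>x \<in> carrier A; y \<in> carrier A\<rbrakk> \<Longrightarrow> x \<oplus>\<^bsub>A\<^esub> y = y \<oplus>\<^bsub>A\<^esub> x"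
    and "\<And>x. x \<in> carrier A \<Longrightarrow> \<zero>\<^bsub>A\<^esub> \<oplus>\<^bsub>A\<^esub> x = x"
    and "\<And>x. x \<in> carrier A \<Longrightarrow> \<exists>y\<in>carrier A. y \<oplus>\<^bsub>A\<^esub> x = \<zero>\<^bsub>A\<^esub>"
    and "\<And>r x. \<lbrakk>r \<in> carrier l; x \<in> carrier A\<rbrakk> \<Longrightarrow> r \<odot>\<^bsub>A\<^esub> x \<in> carrier A"
    and "\<And>r s x. \<lbrakk>r \<in> carrier l; s \<in> carrier l; x \<in> carrier A\<rbrakk> \<Longrightarrow> (r \<oplus>\<^bsub>l\<^esub> s) \<odot>\<^bsub>A\<^esub> x = r \<odot>\<^bsub>A\<^esub> x \<oplus>\<^bsub>A\<^esub> s \<odot>\<^bsub>A\<^esub> x"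
    and "\<And>r x y. \<lbrakk>r \<in> carrier l; x \<in> carrier A; y \<in> carrier A\<rbrakk> \<Longrightarrow> r \<odot>\<^bsub>A\<^esub> (x \<oplus>\<^bsub>A\<^esub> y) = r \<odot>\<^bsub>A\<^esub> x \<oplus>\<^bsub>A\<^esub> r \<odot>\<^bsub>A\<^esub> y"
    and "\<And>r s x. \<lbrakk>r \<in> carrier l; s \<in> carrier l; x \<in> carrier A\<rbrakk> \<Longrightarrow> (r \<otimes>\<^bsub>l\<^esub> s) \<odot>\<^bsub>A\<^esub> x = r \<odot>\<^bsub>A\<^esub> (s \<odot>\<^bsub>A\<^esub> x)"
    and "\<And>x. x \<in> carrier A \<Longrightarrow> \<one>\<^bsub>l\<^esub> \<odot>\<^bsub>A\<^esub> x = x"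
    and "\<And>x y. \<lbrakk>x \<in> carrier A; y \<in> carrier A\<rbrakk> \<Longrightarrow> x \<otimes>\<^bsub>A\<^esub> y \<in> carrier A"
    and "\<And>x y z. \<lbrakk>x \<in> carrier A; y \<in> carrier A; z \<in> carrier A\<rbrakk> \<Longrightarrow> (x \<otimes>\<^bsub>A\<^esub> y) \<otimes>\<^bsub>A\<^esub> z = x \<otimes>\<^bsub>A\<^esub> (y \<otimes>\<^bsub>A\<^esub> z)"
    and "\<And>x y z. \<lbrakk>x \<in> carrier A; y \<in> carrier A; z \<in> carrier A\<rbrakk> \<Longrightarrow> (x \<oplus>\<^bsub>A\<^esub> y) \<otimes>\<^bsub>A\<^esub> z = x \<otimes>\<^bsub>A\<^esub> z \<oplus>\<^bsub>A\<^esub> y \<otimes>\<^bsub>A\<^esub> z"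
    and "\<And>x y z. \<lbrakk>x \<in> carrier A; y \<in> carrier A; z \<in> carrier A\<rbrakk> \<Longrightarrow> x \<otimes>\<^bsub>A\<^esub> (y \<oplus>\<^bsub>A\<^esub> z) = x \<otimes>\<^bsub>A\<^esub> y \<oplus>\<^bsub>A\<^esub> x \<otimes>\<^bsub>A\<^esub> z"
    and "\<And>r x y. \<lbrakk>r \<in> carrier l; x \<in> carrier A; y \<in> carrier A\<rbrakk> \<Longrightarrow> (r \<odot>\<^bsub>A\<^esub> x) \<otimes>\<^bsub>A\<^esub> y = r \<odot>\<^bsub>A\<^esub> (x \<otimes>\<^bsub>A\<^esub> y)"
    and "\<And>r x y. \<lbrakk>r \<in> carrier l; x \<in> carrier A; y \<in> carrier A\<rbrakk> \<Longrightarrow> x \<otimes>\<^bsub>A\<^esub> (r \<odot>\<^bsub>A\<^esub> y) = r \<odot>\<^bsub>A\<^esub> (x \<otimes>\<^bsub>A\<^esub> y)"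
  shows "is_algebra l A"
proof -
  have "abelian_group A" by (rule abelian_groupI) (use assms in auto)
  then have "module l A" by (intro moduleI) (use assms in auto)
  then show ?thesis unfolding is_algebra_def by (intro conjI ballI) (simp_all add: assms)
qed

locale alg =
  fixes l :: "'a ring" and A :: "('a, 'b, 'z) module_scheme" (structure)
  assumes alg: "is_algebra l A"

sublocale alg \<subseteq> module l A
  using alg by (simp add: is_algebra_def)

context alg
begin

lemma mult_closed [simp]: "\<lbrakk>x \<in> carrier A; y \<in> carrier A\<rbrakk> \<Longrightarrow> x \<otimes> y \<in> carrier A"
  and mult_assoc: "\<lbrakk>x \<in> carrier A; y \<in> carrier A; z \<in> carrier A\<rbrakk> \<Longrightarrow> (x \<otimes> y) \<otimes> z = x \<otimes> (y \<otimes> z)"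
  and l_dist: "\<lbrakk>x \<in> carrier A; y \<in> carrier A; z \<in> carrier A\<rbrakk> \<Longrightarrow> (x \<oplus> y) \<otimes> z = x \<otimes> z \<oplus> y \<otimes> z"
  and r_dist: "\<lbrakk>x \<in> carrier A; y \<in> carrier A; z \<in> carrier A\<rbrakk> \<Longrightarrow> x \<otimes> (y \<oplus> z) = x \<otimes> y \<oplus> x \<otimes> z"
  and smult_mult: "\<lbrakk>r \<in> carrier l; x \<in> carrier A; y \<in> carrier A\<rbrakk> \<Longrightarrow> (r \<odot> x) \<otimes> y = r \<odot> (x \<otimes> y)"
  and mult_smult: "\<lbrakk>r \<in> carrier l; x \<in> carrier A; y \<in> carrier A\<rbrakk> \<Longrightarrow> x \<otimes> (r \<odot> y) = r \<odot> (x \<otimes> y)"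
  using alg unfolding is_algebra_def by auto

lemma mult_zero [simp]: "x \<in> carrier A \<Longrightarrow> x \<otimes> \<zero> = \<zero>"
  using r_dist[of x "\<zero>" "\<zero>"] by simp

lemma zero_mult [simp]: "x \<in> carrier A \<Longrightarrow> \<zero> \<otimes> x = \<zero>"
  using l_dist[of "\<zero>" "\<zero>" x] by simp

lemma mult_neg [simp]: "\<lbrakk>x \<in> carrier A; y \<in> carrier A\<rbrakk> \<Longrightarrow> x \<otimes> (\<ominus> y) = \<ominus> (x \<otimes> y)"
  by (rule M.minus_equality[symmetric]) (simp_all add: M.l_neg flip: r_dist)

lemma neg_mult [simp]: "\<lbrakk>x \<in> carrier A; y \<in> carrier A\<rbrakk> \<Longrightarrow> (\<ominus> x) \<otimes> y = \<ominus> (x \<otimes> y)"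
  by (rule M.minus_equality[symmetric]) (simp_all add: M.l_neg flip: l_dist)

end

lemma truncate_simps [simp]:
  "carrier (module.truncate A) = carrier A" "mult (module.truncate A) = mult A" "one (module.truncate A) = one A"
  "zero (module.truncate A) = zero A" "add (module.truncate A) = add A" "smult (module.truncate A) = smult A"
  by (simp_all add: module.truncate_def)

lemma is_algebra_truncate [simp]: "is_algebra l A \<Longrightarrow> is_algebra l (module.truncate A)"
proof -
  assume A: "is_algebra l A"
  interpret alg l A using A by unfold_locales
  show ?thesis
    by (rule is_algebraI) (use M.l_neg in \<open>auto simp: R.cring_axioms M.a_ac smult_l_distr smult_r_distr smult_assoc1 mult_assoc
      l_dist r_dist smult_mult mult_smult R.is_cring\<close>)
qed

locale star_alg = alg l A for l :: "'a ring" and \<sigma> :: "'a \<Rightarrow> 'a" and A :: "('a, 'b) star_alg" (structure) +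
  assumes sigma: "involutive_ring l \<sigma>" and salg: "is_star_algebra l \<sigma> A"
begin

lemma star_closed [simp]: "x \<in> carrier A \<Longrightarrow> star A x \<in> carrier A"
  and star_star [simp]: "x \<in> carrier A \<Longrightarrow> star A (star A x) = x"
  and star_add [simp]: "\<lbrakk>x \<in> carrier A; y \<in> carrier A\<rbrakk> \<Longrightarrow> star A (x \<oplus> y) = star A x \<oplus> star A y"
  and star_mult [simp]: "\<lbrakk>x \<in> carrier A; y \<in> carrier A\<rbrakk> \<Longrightarrow> star A (x \<otimes> y) = star A y \<otimes> star A x"
  and star_smult [simp]: "\<lbrakk>r \<in> carrier l; x \<in> carrier A\<rbrakk> \<Longrightarrow> star A (r \<odot> x) = \<sigma> r \<odot> star A x"
  using salg unfolding is_star_algebra_def by auto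

lemma star_zero [simp]: "star A \<zero> = \<zero>"
  using star_add[of "\<zero>" "\<zero>"] by simp

lemma star_neg [simp]: "x \<in> carrier A \<Longrightarrow> star A (\<ominus> x) = \<ominus> star A x"
  by (rule M.minus_equality[symmetric]) (simp_all add: M.l_neg flip: star_add)

end

lemma star_algI: "\<lbrakk>involutive_ring l \<sigma>; is_star_algebra l \<sigma> A\<rbrakk> \<Longrightarrow> star_alg l \<sigma> A"
  by unfold_locales (auto simp: is_star_algebra_def)

locale inv_ring =
  fixes l :: "'a ring" and \<sigma> :: "'a \<Rightarrow> 'a"
  assumes inv_ring: "involutive_ring l \<sigma>"

sublocale inv_ring \<subseteq> R?: cring l
  using inv_ring by (simp add: involutive_ring_def)

context inv_ring
begin

lemma sigma_closed [simp]: "r \<in> carrier l \<Longrightarrow> \<sigma> r \<in> carrier l"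
  and sigma_sigma [simp]: "r \<in> carrier l \<Longrightarrow> \<sigma> (\<sigma> r) = r"
  and sigma_add [simp]: "\<lbrakk>r \<in> carrier l; s \<in> carrier l\<rbrakk> \<Longrightarrow> \<sigma> (r \<oplus>\<^bsub>l\<^esub> s) = \<sigma> r \<oplus>\<^bsub>l\<^esub> \<sigma> s"
  and sigma_mult [simp]: "\<lbrakk>r \<in> carrier l; s \<in> carrier l\<rbrakk> \<Longrightarrow> \<sigma> (r \<otimes>\<^bsub>l\<^esub> s) = \<sigma> r \<otimes>\<^bsub>l\<^esub> \<sigma> s"
  and sigma_one [simp]: "\<sigma> \<one>\<^bsub>l\<^esub> = \<one>\<^bsub>l\<^esub>"
  using inv_ring unfolding involutive_ring_def ring_hom_def by auto

lemma sigma_zero [simp]: "\<sigma> \<zero>\<^bsub>l\<^esub> = \<zero>\<^bsub>l\<^esub>"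
  using sigma_add[of "\<zero>\<^bsub>l\<^esub>" "\<zero>\<^bsub>l\<^esub>"] by simp

end

sublocale star_alg \<subseteq> inv_ring l \<sigma>
  using sigma by unfold_locales

lemma transport_simps:
  assumes "inj_on e (carrier A)"
  shows "carrier (transport e A) = e ` carrier A" "zero (transport e A) = e (zero A)"
    "\<lbrakk>x \<in> carrier A; y \<in> carrier A\<rbrakk> \<Longrightarrow> mult (transport e A) (e x) (e y) = e (x \<otimes>\<^bsub>A\<^esub> y)"
    "\<lbrakk>x \<in> carrier A; y \<in> carrier A\<rbrakk> \<Longrightarrow> add (transport e A) (e x) (e y) = e (x \<oplus>\<^bsub>A\<^esub> y)"
    "x \<in> carrier A \<Longrightarrow> smult (transport e A) r (e x) = e (r \<odot>\<^bsub>A\<^esub> x)"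
    "x \<in> carrier A \<Longrightarrow> star (transport e A) (e x) = e (star A x)"
  using assms by (simp_all add: transport_def Let_def)

lemma is_algebra_transport:
  assumes A: "is_algebra l A" and e: "inj_on e (carrier A)"
  shows "is_algebra l (transport e A)"
proof -
  interpret alg l A using A by unfold_locales
  show ?thesis
  proof (rule is_algebraI)
    fix x assume "x \<in> carrier (transport e A)"
    then obtain a where "x = e a" "a \<in> carrier A" by (auto simp: transport_simps[OF e])
    then show "\<exists>y\<in>carrier (transport e A). y \<oplus>\<^bsub>transport e A\<^esub> x = \<zero>\<^bsub>transport e A\<^esub>"
      by (intro bexI[of _ "e (\<ominus>\<^bsub>A\<^esub> a)"]) (simp_all add: transport_simps[OF e] M.l_neg)
  qed (auto simp: transport_simps[OF e] R.is_cring M.a_ac smult_l_distr smult_r_distr smult_assoc1 mult_assoc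
      l_dist r_dist smult_mult mult_smult)
qed

lemma is_star_algebra_transport:
  assumes A: "is_star_algebra l \<sigma> A" and e: "inj_on e (carrier A)"
  shows "is_star_algebra l \<sigma> (transport e A)"
proof -
  have alg: "is_algebra l A" using A by (simp add: is_star_algebra_def)
  interpret alg l A using alg by unfold_locales
  show ?thesis unfolding is_star_algebra_def
    using is_algebra_transport[OF alg e] A by (auto simp: transport_simps[OF e] is_star_algebra_def)
qed

lemma linear_mapsI:
  assumes "\<And>x. x \<in> carrier M \<Longrightarrow> f x \<in> carrier N"
    "\<And>x y. \<lbrakk>x \<in> carrier M; y \<in> carrier M\<rbrakk> \<Longrightarrow> f (x \<oplus>\<^bsub>M\<^esub> y) = f x \<oplus>\<^bsub>N\<^esub> f y"
    "\<And>r x. \<lbrakk>r \<in> carrier l; x \<in> carrier M\<rbrakk> \<Longrightarrow> f (r \<odot>\<^bsub>M\<^esub> x) = r \<odot>\<^bsub>N\<^esub> f x"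
  shows "f \<in> linear_maps l M N"
  using assms by (auto simp: linear_maps_def)

lemma linear_mapsD:
  assumes "f \<in> linear_maps l M N"
  shows "x \<in> carrier M \<Longrightarrow> f x \<in> carrier N"
    "\<lbrakk>x \<in> carrier M; y \<in> carrier M\<rbrakk> \<Longrightarrow> f (x \<oplus>\<^bsub>M\<^esub> y) = f x \<oplus>\<^bsub>N\<^esub> f y"
    "\<lbrakk>r \<in> carrier l; x \<in> carrier M\<rbrakk> \<Longrightarrow> f (r \<odot>\<^bsub>M\<^esub> x) = r \<odot>\<^bsub>N\<^esub> f x"
  using assms by (auto simp: linear_maps_def)

lemma bilinear_mapsD:
  assumes "\<beta> \<in> bilinear_maps l L A P"
  shows "m \<in> carrier L \<Longrightarrow> \<beta> m \<in> linear_maps l A P" "a \<in> carrier A \<Longrightarrow> (\<lambda>m. \<beta> m a) \<in> linear_maps l L P"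
  using assms by (auto simp: bilinear_maps_def)

lemma alg_homsI:
  assumes "\<And>x. x \<in> carrier A \<Longrightarrow> f x \<in> carrier B"
    "\<And>x y. \<lbrakk>x \<in> carrier A; y \<in> carrier A\<rbrakk> \<Longrightarrow> f (x \<oplus>\<^bsub>A\<^esub> y) = f x \<oplus>\<^bsub>B\<^esub> f y"
    "\<And>r x. \<lbrakk>r \<in> carrier l; x \<in> carrier A\<rbrakk> \<Longrightarrow> f (r \<odot>\<^bsub>A\<^esub> x) = r \<odot>\<^bsub>B\<^esub> f x"
    "\<And>x y. \<lbrakk>x \<in> carrier A; y \<in> carrier A\<rbrakk> \<Longrightarrow> f (x \<otimes>\<^bsub>A\<^esub> y) = f x \<otimes>\<^bsub>B\<^esub> f y"
  shows "f \<in> alg_homs l A B"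
  using assms by (auto simp: alg_homs_def linear_maps_def)

lemma star_homsI:
  assumes "f \<in> alg_homs l A B" "\<And>x. x \<in> carrier A \<Longrightarrow> f (star A x) = star B (f x)"
  shows "f \<in> star_homs l A B"
  using assms by (auto simp: star_homs_def)

lemma alg_homsD:
  assumes "f \<in> alg_homs l A B"
  shows "x \<in> carrier A \<Longrightarrow> f x \<in> carrier B"
    "\<lbrakk>x \<in> carrier A; y \<in> carrier A\<rbrakk> \<Longrightarrow> f (x \<oplus>\<^bsub>A\<^esub> y) = f x \<oplus>\<^bsub>B\<^esub> f y"
    "\<lbrakk>r \<in> carrier l; x \<in> carrier A\<rbrakk> \<Longrightarrow> f (r \<odot>\<^bsub>A\<^esub> x) = r \<odot>\<^bsub>B\<^esub> f x"
    "\<lbrakk>x \<in> carrier A; y \<in> carrier A\<rbrakk> \<Longrightarrow> f (x \<otimes>\<^bsub>A\<^esub> y) = f x \<otimes>\<^bsub>B\<^esub> f y"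
  using assms by (auto simp: alg_homs_def linear_maps_def)

lemma alg_hom_zero:
  assumes "is_algebra l A" "is_algebra l B" "f \<in> alg_homs l A B"
  shows "f \<zero>\<^bsub>A\<^esub> = \<zero>\<^bsub>B\<^esub>"
proof -
  interpret A: alg l A using assms by unfold_locales
  interpret B: alg l B using assms by unfold_locales
  show ?thesis using alg_homsD(2)[OF assms(3), of "\<zero>\<^bsub>A\<^esub>" "\<zero>\<^bsub>A\<^esub>"] alg_homsD(1)[OF assms(3), of "\<zero>\<^bsub>A\<^esub>"] by simp
qed

lemma alg_hom_neg:
  assumes "is_algebra l A" "is_algebra l B" "f \<in> alg_homs l A B" "x \<in> carrier A"
  shows "f (\<ominus>\<^bsub>A\<^esub> x) = \<ominus>\<^bsub>B\<^esub> f x"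
proof -
  interpret A: alg l A using assms by unfold_locales
  interpret B: alg l B using assms by unfold_locales
  note h = alg_homsD[OF assms(3)]
  show ?thesis using h(2)[of "\<ominus>\<^bsub>A\<^esub> x" x] h(1)[of x] h(1)[of "\<ominus>\<^bsub>A\<^esub> x"] assms(4) alg_hom_zero[OF assms(1-3)]
    by (simp add: A.M.l_neg B.M.minus_equality)
qed

section \<open>The categories of algebras\<close>

lemma arrow_eq: "(\<And>x. x \<in> carrier A \<Longrightarrow> f x = g x) \<Longrightarrow> arrow A f B = arrow A g B"
  by (auto simp: arrow_def restrict_def fun_eq_iff)

text \<open>The common ground of \<open>alg_homs\<close> and \<open>star_homs\<close>, from which
  the category axioms follow for both at once. Closure under agreement on the carrier is included
  since arrows carry functions restricted to it.\<close>

definition hom_closed where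
  "hom_closed Ob Homs \<longleftrightarrow> (\<forall>A\<in>Ob. \<forall>B\<in>Ob. \<forall>f\<in>Homs A B. f \<in> carrier A \<rightarrow> carrier B \<and>
      (\<forall>g. (\<forall>x\<in>carrier A. f x = g x) \<longrightarrow> g \<in> Homs A B)) \<and>
    (\<forall>A\<in>Ob. (\<lambda>x. x) \<in> Homs A A) \<and>
    (\<forall>A\<in>Ob. \<forall>B\<in>Ob. \<forall>C\<in>Ob. \<forall>f\<in>Homs A B. \<forall>g\<in>Homs B C. g \<circ> f \<in> Homs A C)"

locale conc =
  fixes Ob :: "('u, 'u, 'z) module_scheme set" and Homs
  assumes hom_closed: "hom_closed Ob Homs"
begin

abbreviation "CC \<equiv> concrete_category Ob Homs"

lemma hom_cong: "\<lbrakk>f \<in> Homs A B; A \<in> Ob; B \<in> Ob; \<And>x. x \<in> carrier A \<Longrightarrow> f x = g x\<rbrakk> \<Longrightarrow> g \<in> Homs A B"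
  and hom_maps: "\<lbrakk>f \<in> Homs A B; A \<in> Ob; B \<in> Ob; x \<in> carrier A\<rbrakk> \<Longrightarrow> f x \<in> carrier B"
  and hom_id: "A \<in> Ob \<Longrightarrow> (\<lambda>x. x) \<in> Homs A A"
  and hom_comp: "\<lbrakk>f \<in> Homs A B; g \<in> Homs B C; A \<in> Ob; B \<in> Ob; C \<in> Ob\<rbrakk> \<Longrightarrow> g \<circ> f \<in> Homs A C"
  using hom_closed unfolding hom_closed_def by blast+

lemma arrow_in: "\<lbrakk>A \<in> Ob; B \<in> Ob; f \<in> Homs A B\<rbrakk> \<Longrightarrow> arrow A f B \<in> arrows CC A B"
  using hom_cong[of f A B "restrict f (carrier A)"]
  by (auto simp: arrows_def concrete_category_def arrow_def)

lemma ArrE: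
  assumes "a \<in> Arr CC"
  obtains A f B where "a = arrow A f B" "A \<in> Ob" "B \<in> Ob" "f \<in> Homs A B"
proof -
  obtain A f B where a: "a = (A, f, B)" by (cases a)
  show ?thesis by (rule that[of A f B]) (use assms a in \<open>auto simp: concrete_category_def arrow_def extensional_restrict\<close>)
qed

lemma comp_arrow: "\<lbrakk>A \<in> Ob; B \<in> Ob; f \<in> Homs A B\<rbrakk> \<Longrightarrow>
    arrow B g C \<bullet>\<^bsub>CC\<^esub> arrow A f B = arrow A (g \<circ> f) C"
  using hom_maps[of f A B] by (auto simp: concrete_category_def arrow_def restrict_def fun_eq_iff)

lemma Dom_arrow [simp]: "Dom CC (arrow A f B) = A" and Cod_arrow [simp]: "Cod CC (arrow A f B) = B"
  by (simp_all add: concrete_category_def arrow_def)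

lemma Id_CC [simp]: "Id CC A = arrow A (\<lambda>x. x) A" and Obj_CC [simp]: "Obj CC = Ob"
  by (simp_all add: concrete_category_def)

lemma arrow_Arr [simp]: "\<lbrakk>A \<in> Ob; B \<in> Ob; f \<in> Homs A B\<rbrakk> \<Longrightarrow> arrow A f B \<in> Arr CC"
  using arrow_in by (auto simp: arrows_def)

lemma is_category_CC: "is_category CC"
  unfolding is_category_def
proof (intro conjI ballI impI)
  fix f assume f: "f \<in> Arr CC"
  show "Dom CC f \<in> Obj CC" "Cod CC f \<in> Obj CC" using f by (auto elim!: ArrE)
  show "f \<bullet>\<^bsub>CC\<^esub> Id CC (Dom CC f) = f" "Id CC (Cod CC f) \<bullet>\<^bsub>CC\<^esub> f = f"
    using f by (auto elim!: ArrE simp: comp_arrow hom_id comp_def)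
next
  fix A assume "A \<in> Obj CC"
  then show "Id CC A \<in> arrows CC A A" using arrow_in hom_id by simp
next
  fix f g assume "f \<in> Arr CC" "g \<in> Arr CC" "Cod CC f = Dom CC g"
  then show "g \<bullet>\<^bsub>CC\<^esub> f \<in> arrows CC (Dom CC f) (Cod CC g)"
    by (auto elim!: ArrE simp: comp_arrow intro!: arrow_in hom_comp)
next
  fix f g h assume "f \<in> Arr CC" "g \<in> Arr CC" "h \<in> Arr CC" "Cod CC f = Dom CC g \<and> Cod CC g = Dom CC h"
  then show "(h \<bullet>\<^bsub>CC\<^esub> g) \<bullet>\<^bsub>CC\<^esub> f = h \<bullet>\<^bsub>CC\<^esub> g \<bullet>\<^bsub>CC\<^esub> f"
    by (auto elim!: ArrE simp: comp_arrow hom_comp comp_assoc)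
qed

end

lemma (in alg) cring_l: "cring l"
  using alg by (simp add: is_algebra_def module_def)

lemma alg_homs_comp:
  assumes "f \<in> alg_homs l A B" "g \<in> alg_homs l B C"
  shows "g \<circ> f \<in> alg_homs l A C"
  by (rule alg_homsI) (simp_all add: alg_homsD[OF assms(1)] alg_homsD[OF assms(2)])

lemma star_homs_comp:
  assumes "f \<in> star_homs l A B" "g \<in> star_homs l B C"
  shows "g \<circ> f \<in> star_homs l A C"
  using assms alg_homs_comp[of f l A B g C] alg_homsD(1)[of f l A B] by (simp add: star_homs_def)

lemma conc_Alg: "conc {A :: ('u, 'u) module. is_algebra l A} (alg_homs l)"
proof
  show "hom_closed {A :: ('u, 'u) module. is_algebra l A} (alg_homs l)"
    unfolding hom_closed_def
  proof (intro conjI ballI allI impI; (elim CollectE)?)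
    fix A B :: "('u, 'u) module" and f g
    assume a: "is_algebra l A" "f \<in> alg_homs l A B" "\<forall>x\<in>carrier A. f x = g x"
    interpret alg l A using a by unfold_locales
    have g: "\<And>x. x \<in> carrier A \<Longrightarrow> g x = f x" using a(3) by simp
    show "g \<in> alg_homs l A B"
      by (rule alg_homsI) (simp_all add: g alg_homsD[OF a(2)])
  next
    fix A B C :: "('u, 'u) module" and f g
    assume "f \<in> alg_homs l A B" "g \<in> alg_homs l B C"
    then show "g \<circ> f \<in> alg_homs l A C" by (rule alg_homs_comp)
  qed (auto simp: alg_homs_def linear_maps_def)
qed

lemma conc_StarAlg: "conc {A :: ('u, 'u) star_alg. is_star_algebra l \<sigma> A} (star_homs l)"
proof
  show "hom_closed {A :: ('u, 'u) star_alg. is_star_algebra l \<sigma> A} (star_homs l)"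
    unfolding hom_closed_def
  proof (intro conjI ballI allI impI; (elim CollectE)?)
    fix A B :: "('u, 'u) star_alg" and f g
    assume a: "is_star_algebra l \<sigma> A" "f \<in> star_homs l A B" "\<forall>x\<in>carrier A. f x = g x"
    then have A: "is_algebra l A" and sc: "\<And>x. x \<in> carrier A \<Longrightarrow> star A x \<in> carrier A"
      and f: "f \<in> alg_homs l A B" and fs: "\<And>x. x \<in> carrier A \<Longrightarrow> f (star A x) = star B (f x)"
      by (auto simp: is_star_algebra_def star_homs_def)
    interpret alg l A using A by unfold_locales
    have g: "\<And>x. x \<in> carrier A \<Longrightarrow> g x = f x" using a(3) by simp
    show "g \<in> star_homs l A B"
      by (intro star_homsI alg_homsI) (simp_all add: g alg_homsD[OF f] fs sc)
  next
    fix A B C :: "('u, 'u) star_alg" and f g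
    assume "f \<in> star_homs l A B" "g \<in> star_homs l B C"
    then show "g \<circ> f \<in> star_homs l A C" by (rule star_homs_comp)
  qed (auto simp: star_homs_def alg_homs_def linear_maps_def)
qed

lemma is_star_algebraD: "is_star_algebra l \<sigma> A \<Longrightarrow> is_algebra l A"
  and star_homsD: "f \<in> star_homs l A B \<Longrightarrow> f \<in> alg_homs l A B"
    "\<lbrakk>f \<in> star_homs l A B; x \<in> carrier A\<rbrakk> \<Longrightarrow> f (star A x) = star B (f x)"
  by (auto simp: is_star_algebra_def star_homs_def)

lemmas Alg_simps [simp] = conc.Dom_arrow[OF conc_Alg, folded Alg_def] conc.Cod_arrow[OF conc_Alg, folded Alg_def]
  conc.Id_CC[OF conc_Alg, folded Alg_def] conc.Obj_CC[OF conc_Alg, folded Alg_def]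
lemmas StarAlg_simps [simp] = conc.Dom_arrow[OF conc_StarAlg, folded StarAlg_def] conc.Cod_arrow[OF conc_StarAlg, folded StarAlg_def]
  conc.Id_CC[OF conc_StarAlg, folded StarAlg_def] conc.Obj_CC[OF conc_StarAlg, folded StarAlg_def]
lemmas Alg_arrow = conc.arrow_in[OF conc_Alg, folded Alg_def, simplified]
  and StarAlg_arrow = conc.arrow_in[OF conc_StarAlg, folded StarAlg_def, simplified]
  and Alg_Arr = conc.arrow_Arr[OF conc_Alg, folded Alg_def, simplified]
  and StarAlg_Arr = conc.arrow_Arr[OF conc_StarAlg, folded StarAlg_def, simplified]
  and Alg_comp = conc.comp_arrow[OF conc_Alg, folded Alg_def, simplified]
  and StarAlg_comp = conc.comp_arrow[OF conc_StarAlg, folded StarAlg_def, simplified]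
  and Alg_ArrE = conc.ArrE[OF conc_Alg, folded Alg_def, simplified]
  and StarAlg_ArrE = conc.ArrE[OF conc_StarAlg, folded StarAlg_def, simplified]
  and Alg_category = conc.is_category_CC[OF conc_Alg, folded Alg_def]
  and StarAlg_category = conc.is_category_CC[OF conc_StarAlg, folded StarAlg_def]

section \<open>Semi-split extensions and functors that preserve them\<close>

abbreviation "alg_ext l U \<equiv> semi_split_extensions l U (Alg l)"

abbreviation "star_ext l \<sigma> U \<equiv> semi_split_extensions l U (StarAlg l \<sigma>)"

abbreviation split_maps where
  "split_maps l U C B \<equiv> (case U of Sets \<Rightarrow> carrier C \<rightarrow> carrier B | Modules \<Rightarrow> linear_maps l C B)"

lemma split_maps_closed: "\<lbrakk>s \<in> split_maps l U C B; c \<in> carrier C\<rbrakk> \<Longrightarrow> s c \<in> carrier B"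
  by (cases U) (auto simp: linear_maps_def)

lemma semi_splitI:
  assumes "arrow A i B \<in> Arr Cat" "arrow B p C \<in> Arr Cat" "inj_on i (carrier A)"
    "i ` carrier A = {b \<in> carrier B. p b = \<zero>\<^bsub>C\<^esub>}" "p ` carrier B = carrier C"
    "s \<in> split_maps l U C B" "\<And>c. c \<in> carrier C \<Longrightarrow> p (s c) = c"
  shows "(arrow A i B, arrow B p C) \<in> semi_split_extensions l U Cat"
proof -
  have "\<forall>c\<in>carrier C. restrict p (carrier B) (s c) = c"
    using assms(6,7) split_maps_closed[OF assms(6)] by simp
  then have "\<exists>s. s \<in> split_maps l U C B \<and> (\<forall>c\<in>carrier C. restrict p (carrier B) (s c) = c)"
    using assms(6) by blast
  moreover have "{b \<in> carrier B. restrict p (carrier B) b = \<zero>\<^bsub>C\<^esub>} = {b \<in> carrier B. p b = \<zero>\<^bsub>C\<^esub>}" by auto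
  moreover have "inj_on (restrict i (carrier A)) (carrier A)" using assms(3) by (simp add: inj_on_def)
  ultimately show ?thesis using assms(1,2,4,5) unfolding semi_split_extensions_def arrow_def
    by (simp add: image_restrict_eq)
qed

lemma semi_splitD:
  assumes "((A, i, B), (B', p, C)) \<in> semi_split_extensions l U Cat"
  shows "B' = B" "(A, i, B) \<in> Arr Cat" "(B', p, C) \<in> Arr Cat" "inj_on i (carrier A)"
    "i ` carrier A = {b \<in> carrier B. p b = \<zero>\<^bsub>C\<^esub>}" "p ` carrier B = carrier C"
    "\<exists>s. s \<in> split_maps l U C B \<and> (\<forall>c\<in>carrier C. p (s c) = c)"
  using assms unfolding semi_split_extensions_def by auto

context conc
begin

lemma semi_splitE:
  assumes "e \<in> semi_split_extensions l U CC"
  obtains A i B p C s where "e = (arrow A i B, arrow B p C)" "A \<in> Ob" "B \<in> Ob" "C \<in> Ob"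
    "i \<in> Homs A B" "p \<in> Homs B C" "inj_on i (carrier A)"
    "i ` carrier A = {b \<in> carrier B. p b = \<zero>\<^bsub>C\<^esub>}" "p ` carrier B = carrier C"
    "s \<in> split_maps l U C B" "\<And>c. c \<in> carrier C \<Longrightarrow> p (s c) = c"
proof -
  obtain A i B B' p C where e: "e = ((A, i, B), (B', p, C))" by (metis prod.exhaust)
  note d = semi_splitD[OF assms[unfolded e]]
  have "(A, i, B) = arrow A i B" "(B', p, C) = arrow B p C" "A \<in> Ob" "B \<in> Ob" "C \<in> Ob"
    "i \<in> Homs A B" "p \<in> Homs B C"
    using d(1-3) by (auto simp: concrete_category_def arrow_def extensional_restrict)
  then show ?thesis using that[of A i B p C] d(4-7) unfolding e by blast
qed

lemma ext_arrows_CC: "ext_arrows CC (semi_split_extensions l U CC)"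
  unfolding ext_arrows_def using is_category_CC
  by (auto elim!: semi_splitE)

end

lemma ext_arrows_Alg: "ext_arrows (Alg l) (alg_ext l U)"
  unfolding Alg_def by (rule conc.ext_arrows_CC[OF conc_Alg])

lemma ext_arrows_StarAlg: "ext_arrows (StarAlg l \<sigma>) (star_ext l \<sigma> U)"
  unfolding StarAlg_def by (rule conc.ext_arrows_CC[OF conc_StarAlg])

text \<open>An element of \<open>ob R A\<close> is a family of elements of \<open>A\<close> indexed by \<open>'i\<close> (one for \<open>res\<close>, two for \<open>ind\<close>, four
  for matrices), and homomorphisms act on each member of the family.\<close>

lemma preserves_ext_families:
  fixes Ob :: "('u, 'u, 'z) module_scheme set" and Ob' :: "('u, 'u, 'w) module_scheme set"
    and enc :: "('i \<Rightarrow> 'u) \<Rightarrow> 'u"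
  assumes "conc Ob Homs" "conc Ob' Homs'"
    and ob: "\<And>A. A \<in> Ob \<Longrightarrow> ob R A \<in> Ob'"
    and ar: "\<And>A B f. ar R (arrow A f B) = arrow (ob R A) (lift f) (ob R B)"
    and hom: "\<And>A B f. \<lbrakk>A \<in> Ob; B \<in> Ob; f \<in> Homs A B\<rbrakk> \<Longrightarrow> lift f \<in> Homs' (ob R A) (ob R B)"
    and enc: "inj enc"
    and carr: "\<And>A. A \<in> Ob \<Longrightarrow> carrier (ob R A) = enc ` (UNIV \<rightarrow> carrier A)"
    and zero: "\<And>A. A \<in> Ob \<Longrightarrow> \<zero>\<^bsub>ob R A\<^esub> = enc (\<lambda>_. \<zero>\<^bsub>A\<^esub>)"
    and lift: "\<And>f v. lift f (enc v) = enc (f \<circ> v)"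
    and lin: "\<And>A B f. \<lbrakk>A \<in> Ob; B \<in> Ob; f \<in> linear_maps l A B\<rbrakk> \<Longrightarrow> lift f \<in> linear_maps l (ob R A) (ob R B)"
  shows "preserves_ext (concrete_category Ob Homs) (semi_split_extensions l U (concrete_category Ob Homs))
    (concrete_category Ob' Homs') (semi_split_extensions l U (concrete_category Ob' Homs')) R"
proof -
  interpret C: conc Ob Homs by fact
  interpret C': conc Ob' Homs' by fact
  have enc_eq [simp]: "enc v = enc w \<longleftrightarrow> v = w" for v w using enc by (simp add: inj_eq)
  show ?thesis unfolding preserves_ext_def
  proof (intro conjI ballI)
    show "is_functor C.CC C'.CC R"
      unfolding is_functor_def
    proof (intro conjI ballI impI)
      fix f g assume fg: "f \<in> Arr C.CC" "g \<in> Arr C.CC" "Cod C.CC f = Dom C.CC g"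
      obtain A u B where 1: "f = arrow A u B" "A \<in> Ob" "B \<in> Ob" "u \<in> Homs A B"
        using fg(1) by (rule C.ArrE)
      obtain B' v C where 2: "g = arrow B' v C" "C \<in> Ob" "v \<in> Homs B' C"
        using fg(2) by (rule C.ArrE)
      show "ar R (g \<bullet>\<^bsub>C.CC\<^esub> f) = ar R g \<bullet>\<^bsub>C'.CC\<^esub> ar R f"
        using fg(3) 1(2-) by (auto simp: 1(1) 2(1) ar C.comp_arrow C'.comp_arrow ob hom carr lift comp_assoc intro!: arrow_eq)
    next
      fix A assume "A \<in> Obj C.CC"
      then show "ar R (Id C.CC A) = Id C'.CC (ob R A)"
        by (auto simp: ar carr lift comp_def intro!: arrow_eq)
    qed (auto elim!: C.ArrE simp: ar intro!: ob C'.arrow_in hom)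
    fix e assume "e \<in> semi_split_extensions l U C.CC"
    then show "case e of (i, p) \<Rightarrow> (ar R i, ar R p) \<in> semi_split_extensions l U C'.CC"
    proof (rule C.semi_splitE)
      fix A i B p C s
      assume e: "e = (arrow A i B, arrow B p C)" and [simp]: "A \<in> Ob" "B \<in> Ob" "C \<in> Ob"
        and ip: "i \<in> Homs A B" "p \<in> Homs B C" "inj_on i (carrier A)"
        and im: "i ` carrier A = {b \<in> carrier B. p b = \<zero>\<^bsub>C\<^esub>}" and surj: "p ` carrier B = carrier C"
        and s: "s \<in> split_maps l U C B" "\<And>c. c \<in> carrier C \<Longrightarrow> p (s c) = c"
      have i: "i a \<in> carrier B \<and> p (i a) = \<zero>\<^bsub>C\<^esub>" if "a \<in> carrier A" for a using im that by blast
      have s': "s c \<in> carrier B" if "c \<in> carrier C" for c using split_maps_closed[OF s(1) that] .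
      have "(arrow (ob R A) (lift i) (ob R B), arrow (ob R B) (lift p) (ob R C)) \<in> semi_split_extensions l U C'.CC"
      proof (rule semi_splitI[where s = "lift s"])
        show "inj_on (lift i) (carrier (ob R A))"
          using ip(3) by (auto simp: carr lift inj_on_def fun_eq_iff Pi_iff)
        show "lift i ` carrier (ob R A) = {b \<in> carrier (ob R B). lift p b = \<zero>\<^bsub>ob R C\<^esub>}"
        proof (intro Set.set_eqI iffI)
          fix z assume "z \<in> {b \<in> carrier (ob R B). lift p b = \<zero>\<^bsub>ob R C\<^esub>}"
          then obtain v where v: "z = enc v" "v \<in> UNIV \<rightarrow> carrier B" "p \<circ> v = (\<lambda>_. \<zero>\<^bsub>C\<^esub>)"
            by (auto simp: carr lift zero)
          \<comment> \<open>A family in the kernel of \<open>p\<close> is lifted through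
            \<open>i\<close> member by member.\<close>
          define w where "w k = inv_into (carrier A) i (v k)" for k
          have "v k \<in> i ` carrier A" for k using v(2) fun_cong[OF v(3), of k] by (auto simp: im)
          then have "w k \<in> carrier A" "i (w k) = v k" for k
            by (simp_all add: w_def inv_into_into f_inv_into_f)
          then show "z \<in> lift i ` carrier (ob R A)"
            by (intro image_eqI[of _ _ "enc w"]) (auto simp: v(1) carr lift fun_eq_iff)
        qed (use i in \<open>auto simp: carr lift zero fun_eq_iff Pi_iff\<close>)
        show splits: "lift p (lift s c) = c" if "c \<in> carrier (ob R C)" for c
          using that s(2) by (auto simp: carr lift fun_eq_iff Pi_iff)
        have closed: "lift s c \<in> carrier (ob R B)" if "c \<in> carrier (ob R C)" for c
          using that s' by (auto simp: carr lift Pi_iff)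
        have "lift p b \<in> carrier (ob R C)" if b: "b \<in> carrier (ob R B)" for b
        proof -
          obtain v where v: "b = enc v" "v \<in> UNIV \<rightarrow> carrier B" using b by (auto simp: carr)
          have "p (v k) \<in> carrier C" for k using v(2) unfolding surj[symmetric] by (intro imageI) (simp add: Pi_iff)
          then show ?thesis by (simp add: v(1) lift carr)
        qed
        then show "lift p ` carrier (ob R B) = carrier (ob R C)"
          using closed splits[symmetric] by (intro equalityI subsetI) (blast, rule image_eqI)
        \<comment> \<open>The section need not be a homomorphism, so \<open>hom\<close> says nothing
          about it; over modules the separate hypothesis \<open>lin\<close> supplies
          linearity.\<close>
        show "lift s \<in> split_maps l U (ob R C) (ob R B)"
          using s(1) closed by (cases U) (simp_all add: lin)
      qed (use ip in \<open>auto intro!: C'.arrow_Arr ob hom\<close>)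
      then show ?thesis by (simp add: e ar)
    qed
  qed
qed

lemma alg_homs_truncate: "f \<in> alg_homs l A B \<Longrightarrow> f \<in> alg_homs l (module.truncate A) (module.truncate B)"
  by (simp add: alg_homs_def linear_maps_def)

lemma res_simps [simp]: "ob res_alg A = module.truncate A"
  "ar res_alg (arrow A f B) = arrow (module.truncate A) f (module.truncate B)"
  by (simp_all add: res_alg_def arrow_def)

lemma preserves_ext_res:
  "preserves_ext (StarAlg l \<sigma>) (star_ext l \<sigma> U) (Alg l) (alg_ext l U) res_alg"
  unfolding StarAlg_def Alg_def
proof (rule preserves_ext_families[where enc = "\<lambda>v. v ()" and lift = "\<lambda>f. f", OF conc_StarAlg conc_Alg])
  show "inj (\<lambda>v :: unit \<Rightarrow> 'a. v ())" by (auto simp: inj_def fun_eq_iff)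
  show "carrier (ob res_alg A) = (\<lambda>v. v ()) ` (UNIV \<rightarrow> carrier A)" for A :: "('a, 'a) star_alg"
    by (auto intro!: image_eqI[of _ _ "\<lambda>_. _"])
qed (auto simp: is_star_algebraD linear_maps_def intro!: alg_homs_truncate dest: star_homsD(1))

section \<open>Induction\<close>

locale pairing = inv_ring l \<sigma> for l :: "'u ring" and \<sigma> :: "'u \<Rightarrow> 'u" +
  fixes pr :: "'u \<times> 'u \<Rightarrow> 'u" and U :: underlying
  assumes inj_pr: "inj pr"
begin

lemma pr_eq [simp]: "pr x = pr y \<longleftrightarrow> x = y"
  using inj_pr by (simp add: inj_eq)

lemma inv_pr [simp]: "inv_into UNIV pr (pr x) = x"
  using inj_pr by simp

lemma inj_on_pr [simp]: "inj_on pr S"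
  using inj_pr by (rule inj_on_subset) simp

abbreviation "ind_ob B \<equiv> transport pr (ind_object \<sigma> B)"

definition "ind_map f z = pr (map_prod f f (inv_into UNIV pr z))"

lemma ind_map_pr [simp]: "ind_map f (pr (x, y)) = pr (f x, f y)"
  by (simp add: ind_map_def)

lemma ind_object_star_algebra:
  assumes "is_algebra l B"
  shows "is_star_algebra l \<sigma> (ind_object \<sigma> B)"
proof -
  interpret B: alg l B using assms by unfold_locales
  have "is_algebra l (ind_object \<sigma> B)"
  proof (rule is_algebraI)
    fix x assume "x \<in> carrier (ind_object \<sigma> B)"
    then obtain a b where "x = (a, b)" "a \<in> carrier B" "b \<in> carrier B" by (auto simp: ind_object_def)
    then show "\<exists>y\<in>carrier (ind_object \<sigma> B). y \<oplus>\<^bsub>ind_object \<sigma> B\<^esub> x = \<zero>\<^bsub>ind_object \<sigma> B\<^esub>"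
      by (intro bexI[of _ "(\<ominus>\<^bsub>B\<^esub> a, \<ominus>\<^bsub>B\<^esub> b)"]) (simp_all add: ind_object_def B.M.l_neg)
  qed (auto simp: ind_object_def B.cring_l B.M.a_ac B.smult_l_distr B.smult_r_distr B.smult_assoc1 B.mult_assoc
      B.l_dist B.r_dist B.smult_mult B.mult_smult)
  then show ?thesis
    by (auto simp: is_star_algebra_def ind_object_def)
qed

lemma ind_ob_simps [simp]:
  "carrier (ind_ob B) = pr ` (carrier B \<times> carrier B)" "\<zero>\<^bsub>ind_ob B\<^esub> = pr (\<zero>\<^bsub>B\<^esub>, \<zero>\<^bsub>B\<^esub>)"
  "\<lbrakk>x \<in> carrier B; y \<in> carrier B; x' \<in> carrier B; y' \<in> carrier B\<rbrakk> \<Longrightarrow>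
    pr (x, y) \<oplus>\<^bsub>ind_ob B\<^esub> pr (x', y') = pr (x \<oplus>\<^bsub>B\<^esub> x', y \<oplus>\<^bsub>B\<^esub> y')"
  "\<lbrakk>x \<in> carrier B; y \<in> carrier B; x' \<in> carrier B; y' \<in> carrier B\<rbrakk> \<Longrightarrow>
    pr (x, y) \<otimes>\<^bsub>ind_ob B\<^esub> pr (x', y') = pr (x \<otimes>\<^bsub>B\<^esub> x', y' \<otimes>\<^bsub>B\<^esub> y)"
  "\<lbrakk>x \<in> carrier B; y \<in> carrier B\<rbrakk> \<Longrightarrow> r \<odot>\<^bsub>ind_ob B\<^esub> pr (x, y) = pr (r \<odot>\<^bsub>B\<^esub> x, \<sigma> r \<odot>\<^bsub>B\<^esub> y)"
  "\<lbrakk>x \<in> carrier B; y \<in> carrier B\<rbrakk> \<Longrightarrow> star (ind_ob B) (pr (x, y)) = pr (y, x)"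
  using transport_simps[of pr "ind_object \<sigma> B"] by (auto simp: ind_object_def)

lemma ind_ob_star_algebra [simp]: "is_algebra l B \<Longrightarrow> is_star_algebra l \<sigma> (ind_ob B)"
  by (intro is_star_algebra_transport ind_object_star_algebra) auto

lemma ind_simps [simp]: "ob (ind_alg \<sigma> pr) B = ind_ob B"
  "ar (ind_alg \<sigma> pr) (arrow B f C) = arrow (ind_ob B) (ind_map f) (ind_ob C)"
  by (auto simp: ind_alg_def arrow_def[of B] ind_map_def intro!: arrow_eq)

lemma ind_map_hom:
  assumes "is_algebra l B" "is_algebra l C" "f \<in> alg_homs l B C"
  shows "ind_map f \<in> star_homs l (ind_ob B) (ind_ob C)"
proof -
  interpret B: alg l B using assms by unfold_locales
  note f = alg_homsD[OF assms(3)]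
  show ?thesis by (intro star_homsI alg_homsI) (auto simp: f)
qed

lemma preserves_ext_ind:
  "preserves_ext (Alg l) (alg_ext l U) (StarAlg l \<sigma>) (star_ext l \<sigma> U) (ind_alg \<sigma> pr)"
  unfolding StarAlg_def Alg_def
proof (rule preserves_ext_families[where enc = "\<lambda>v. pr (v True, v False)" and lift = ind_map, OF conc_Alg conc_StarAlg])
  show "inj (\<lambda>v. pr (v True, v False))" by (simp add: inj_def fun_eq_iff all_bool_eq)
  show "carrier (ob (ind_alg \<sigma> pr) A) = (\<lambda>v. pr (v True, v False)) ` (UNIV \<rightarrow> carrier A)" for A
  proof -
    have "pr (x, y) \<in> (\<lambda>v. pr (v True, v False)) ` (UNIV \<rightarrow> carrier A)" if "x \<in> carrier A" "y \<in> carrier A" for x y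
      using that by (intro image_eqI[of _ _ "\<lambda>k. if k then x else y"]) auto
    then show ?thesis by (auto simp: Pi_iff)
  qed
  show "ind_map f \<in> linear_maps l (ob (ind_alg \<sigma> pr) A) (ob (ind_alg \<sigma> pr) B)" if "f \<in> linear_maps l A B" for A B f
    by (rule linear_mapsI) (auto simp: linear_mapsD[OF that])
qed (auto intro: ind_map_hom)

end

section \<open>Matrices\<close>

text \<open>Entries are nested pairs, ready for the encoding by \<open>pr\<close>. The involution is
  a parameter so that one construction yields both M_pm A and the plain matrix algebra M_2
  B.\<close>

definition mat2 :: "('a, 'b, 'z) module_scheme \<Rightarrow> (('b \<times> 'b) \<times> ('b \<times> 'b) \<Rightarrow> ('b \<times> 'b) \<times> ('b \<times> 'b)) \<Rightarrow>
    ('a, ('b \<times> 'b) \<times> ('b \<times> 'b)) star_alg" where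
  "mat2 A st = \<lparr>carrier = (carrier A \<times> carrier A) \<times> (carrier A \<times> carrier A),
    mult = (\<lambda>((a, b), (c, d)) ((a', b'), (c', d')).
      ((a \<otimes>\<^bsub>A\<^esub> a' \<oplus>\<^bsub>A\<^esub> b \<otimes>\<^bsub>A\<^esub> c', a \<otimes>\<^bsub>A\<^esub> b' \<oplus>\<^bsub>A\<^esub> b \<otimes>\<^bsub>A\<^esub> d'),
       (c \<otimes>\<^bsub>A\<^esub> a' \<oplus>\<^bsub>A\<^esub> d \<otimes>\<^bsub>A\<^esub> c', c \<otimes>\<^bsub>A\<^esub> b' \<oplus>\<^bsub>A\<^esub> d \<otimes>\<^bsub>A\<^esub> d'))),
    one = ((\<zero>\<^bsub>A\<^esub>, \<zero>\<^bsub>A\<^esub>), (\<zero>\<^bsub>A\<^esub>, \<zero>\<^bsub>A\<^esub>)),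
    zero = ((\<zero>\<^bsub>A\<^esub>, \<zero>\<^bsub>A\<^esub>), (\<zero>\<^bsub>A\<^esub>, \<zero>\<^bsub>A\<^esub>)),
    add = (\<lambda>((a, b), (c, d)) ((a', b'), (c', d')). ((a \<oplus>\<^bsub>A\<^esub> a', b \<oplus>\<^bsub>A\<^esub> b'), (c \<oplus>\<^bsub>A\<^esub> c', d \<oplus>\<^bsub>A\<^esub> d'))),
    smult = (\<lambda>r ((a, b), (c, d)). ((r \<odot>\<^bsub>A\<^esub> a, r \<odot>\<^bsub>A\<^esub> b), (r \<odot>\<^bsub>A\<^esub> c, r \<odot>\<^bsub>A\<^esub> d))),
    star = st\<rparr>"

text \<open>The conjugate transpose, conjugated by diag(1, -1): the involution of
  \<open>M_pm\<close> with entries in \<open>A\<close>.\<close>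

definition pm_star :: "('a, 'b) star_alg \<Rightarrow> ('b \<times> 'b) \<times> ('b \<times> 'b) \<Rightarrow> ('b \<times> 'b) \<times> ('b \<times> 'b)" where
  "pm_star A = (\<lambda>((a, b), (c, d)). ((star A a, \<ominus>\<^bsub>A\<^esub> star A c), (\<ominus>\<^bsub>A\<^esub> star A b, star A d)))"

lemma is_algebra_mat2:
  assumes "is_algebra l A"
  shows "is_algebra l (mat2 A st)"
proof -
  interpret alg l A using assms by unfold_locales
  show ?thesis
  proof (rule is_algebraI)
    fix x assume "x \<in> carrier (mat2 A st)"
    then obtain a b c d where "x = ((a, b), (c, d))" "a \<in> carrier A" "b \<in> carrier A" "c \<in> carrier A" "d \<in> carrier A"
      by (auto simp: mat2_def)
    then show "\<exists>y\<in>carrier (mat2 A st). y \<oplus>\<^bsub>mat2 A st\<^esub> x = \<zero>\<^bsub>mat2 A st\<^esub>"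
      by (intro bexI[of _ "((\<ominus>\<^bsub>A\<^esub> a, \<ominus>\<^bsub>A\<^esub> b), (\<ominus>\<^bsub>A\<^esub> c, \<ominus>\<^bsub>A\<^esub> d))"]) (simp_all add: mat2_def M.l_neg)
  qed (auto simp: mat2_def cring_l M.a_ac smult_l_distr smult_r_distr smult_assoc1 mult_assoc
      l_dist r_dist smult_mult mult_smult)
qed

lemma is_star_algebra_mat2:
  assumes l: "involutive_ring l \<sigma>" and A: "is_star_algebra l \<sigma> A"
  shows "is_star_algebra l \<sigma> (mat2 A (pm_star A))"
proof -
  interpret star_alg l \<sigma> A by (rule star_algI[OF l A])
  have "is_algebra l (mat2 A (pm_star A))" by (rule is_algebra_mat2[OF alg])
  then show ?thesis unfolding is_star_algebra_def
    by (auto simp: mat2_def pm_star_def M.minus_add smult_r_minus M.a_ac)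
qed

context pairing
begin

definition e4 :: "('u \<times> 'u) \<times> ('u \<times> 'u) \<Rightarrow> 'u" where
  "e4 z = pr (map_prod pr pr z)"

lemma e4_eq [simp]: "e4 x = e4 y \<longleftrightarrow> x = y"
  by (cases x; cases y) (simp add: e4_def)

lemma inj_e4 [simp]: "inj_on e4 S"
  by (simp add: inj_on_def)

lemma inv_e4 [simp]: "inv_into UNIV e4 (e4 x) = x"
  by simp

definition mat_ob :: "('u, 'u) star_alg \<Rightarrow> ('u, 'u) star_alg" where
  "mat_ob A = transport e4 (mat2 A (pm_star A))"

text \<open>The identity only fills the \<open>star\<close> field, which \<open>truncate\<close>
  discards.\<close>

definition mat_alg2 :: "('u, 'u) module \<Rightarrow> ('u, 'u) module" where
  "mat_alg2 B = module.truncate (transport e4 (mat2 B (\<lambda>x. x)))"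

text \<open>An equality and not just an isomorphism: restricting M_pm A lands on the very object for
  which the homotopy between \<open>iota\<close> and \<open>pmap\<close> is constructed.\<close>

lemma truncate_mat_ob: "module.truncate (mat_ob A) = mat_alg2 (module.truncate A)"
  by (simp add: mat_ob_def mat_alg2_def module.truncate_def transport_def Let_def mat2_def)

definition "quads S = (S \<times> S) \<times> (S \<times> S)"

lemma quads_iff [simp]: "((a, b), (c, d)) \<in> quads S \<longleftrightarrow> a \<in> S \<and> b \<in> S \<and> c \<in> S \<and> d \<in> S"
  by (auto simp: quads_def)

lemma quadsE [elim!]:
  assumes "z \<in> quads S"
  obtains a b c d where "z = ((a, b), (c, d))" "a \<in> S" "b \<in> S" "c \<in> S" "d \<in> S"
  using assms by (auto simp: quads_def)

lemma transport_mat2_simps: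
  fixes A :: "('u, 'u, 'z) module_scheme" (structure) and st
  defines "P \<equiv> transport e4 (mat2 A st)"
  shows "carrier P = e4 ` quads (carrier A)" "\<zero>\<^bsub>P\<^esub> = e4 ((\<zero>, \<zero>), (\<zero>, \<zero>))"
  "\<lbrakk>a \<in> carrier A; b \<in> carrier A; c \<in> carrier A; d \<in> carrier A;
    a' \<in> carrier A; b' \<in> carrier A; c' \<in> carrier A; d' \<in> carrier A\<rbrakk> \<Longrightarrow>
    e4 ((a, b), (c, d)) \<oplus>\<^bsub>P\<^esub> e4 ((a', b'), (c', d')) = e4 ((a \<oplus> a', b \<oplus> b'), (c \<oplus> c', d \<oplus> d'))"
  "\<lbrakk>a \<in> carrier A; b \<in> carrier A; c \<in> carrier A; d \<in> carrier A;
    a' \<in> carrier A; b' \<in> carrier A; c' \<in> carrier A; d' \<in> carrier A\<rbrakk> \<Longrightarrow>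
    e4 ((a, b), (c, d)) \<otimes>\<^bsub>P\<^esub> e4 ((a', b'), (c', d')) =
      e4 ((a \<otimes> a' \<oplus> b \<otimes> c', a \<otimes> b' \<oplus> b \<otimes> d'), (c \<otimes> a' \<oplus> d \<otimes> c', c \<otimes> b' \<oplus> d \<otimes> d'))"
  "\<lbrakk>a \<in> carrier A; b \<in> carrier A; c \<in> carrier A; d \<in> carrier A\<rbrakk> \<Longrightarrow>
    r \<odot>\<^bsub>P\<^esub> e4 ((a, b), (c, d)) = e4 ((r \<odot> a, r \<odot> b), (r \<odot> c, r \<odot> d))"
  "\<lbrakk>a \<in> carrier A; b \<in> carrier A; c \<in> carrier A; d \<in> carrier A\<rbrakk> \<Longrightarrow>
    star P (e4 ((a, b), (c, d))) = e4 (st ((a, b), (c, d)))"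
  using transport_simps[of e4 "mat2 A st"] by (auto simp: P_def mat2_def quads_def)

lemmas mat_ob_simps [simp] =
  transport_mat2_simps[where A = A and st = "pm_star A" for A, folded mat_ob_def, unfolded pm_star_def prod.case]

lemma mat_alg2_simps [simp]:
  "carrier (mat_alg2 A) = carrier (transport e4 (mat2 A (\<lambda>x. x)))" "\<zero>\<^bsub>mat_alg2 A\<^esub> = \<zero>\<^bsub>transport e4 (mat2 A (\<lambda>x. x))\<^esub>"
  "add (mat_alg2 A) = add (transport e4 (mat2 A (\<lambda>x. x)))" "mult (mat_alg2 A) = mult (transport e4 (mat2 A (\<lambda>x. x)))"
  "smult (mat_alg2 A) = smult (transport e4 (mat2 A (\<lambda>x. x)))"
  by (simp_all add: mat_alg2_def)

lemmas [simp] = transport_mat2_simps[where st = "\<lambda>x. x"]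

lemma mat_ob_star_algebra [simp]: "is_star_algebra l \<sigma> A \<Longrightarrow> is_star_algebra l \<sigma> (mat_ob A)"
  unfolding mat_ob_def by (intro is_star_algebra_transport is_star_algebra_mat2 inv_ring) auto

lemma mat_alg2_algebra [simp]: "is_algebra l B \<Longrightarrow> is_algebra l (mat_alg2 B)"
  unfolding mat_alg2_def by (intro is_algebra_truncate is_algebra_transport is_algebra_mat2) auto

definition "mat_map f z = e4 (map_prod (map_prod f f) (map_prod f f) (inv_into UNIV e4 z))"

lemma mat_map_e4 [simp]: "mat_map f (e4 ((a, b), (c, d))) = e4 ((f a, f b), (f c, f d))"
  by (simp add: mat_map_def)

definition mat_func :: "(('u, 'u) star_alg, 'u star_alg_arrow, ('u, 'u) star_alg, 'u star_alg_arrow) func" where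
  "mat_func = \<lparr>ob = mat_ob, ar = (\<lambda>(A, f, B). arrow (mat_ob A) (mat_map f) (mat_ob B))\<rparr>"

lemma mat_func_simps [simp]: "ob mat_func A = mat_ob A"
  "ar mat_func (arrow A f B) = arrow (mat_ob A) (mat_map f) (mat_ob B)"
  by (auto simp: mat_func_def arrow_def[of A] intro!: arrow_eq)

lemma mat_map_hom:
  assumes A: "is_star_algebra l \<sigma> A" and B: "is_star_algebra l \<sigma> B" and f: "f \<in> star_homs l A B"
  shows "mat_map f \<in> star_homs l (mat_ob A) (mat_ob B)"
proof -
  interpret A: star_alg l \<sigma> A by (rule star_algI[OF inv_ring A])
  note h = alg_homsD[OF star_homsD(1)[OF f]] star_homsD(2)[OF f]
    alg_hom_neg[OF is_star_algebraD[OF A] is_star_algebraD[OF B] star_homsD(1)[OF f]]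
  show ?thesis by (intro star_homsI alg_homsI) (auto simp: h)
qed

text \<open>This makes \<open>jh\<close> composed with A -> M_pm A an excisive theory, the middle
  term of the zigzag that defines the second counit.\<close>

lemma preserves_ext_mat:
  "preserves_ext (StarAlg l \<sigma>) (star_ext l \<sigma> U) (StarAlg l \<sigma>) (star_ext l \<sigma> U) mat_func"
  unfolding StarAlg_def
proof (rule preserves_ext_families[where enc = "\<lambda>v. e4 ((v (True, True), v (True, False)), (v (False, True), v (False, False)))"
      and lift = mat_map, OF conc_StarAlg conc_StarAlg])
  let ?enc = "\<lambda>v. e4 ((v (True, True), v (True, False)), (v (False, True), v (False, False)))"
  show "inj ?enc" by (simp add: inj_def fun_eq_iff all_bool_eq)
  show "carrier (ob mat_func A) = ?enc ` (UNIV \<rightarrow> carrier A)" for A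
  proof -
    have "e4 ((a, b), (c, d)) \<in> ?enc ` (UNIV \<rightarrow> carrier A)"
      if "a \<in> carrier A" "b \<in> carrier A" "c \<in> carrier A" "d \<in> carrier A" for a b c d
      using that by (intro image_eqI[of _ _ "\<lambda>(i, k). if i then if k then a else b else if k then c else d"]) auto
    then show ?thesis by (auto simp: Pi_iff)
  qed
  show "mat_map f \<in> linear_maps l (ob mat_func A) (ob mat_func B)" if "f \<in> linear_maps l A B" for A B f
    by (rule linear_mapsI) (auto simp: linear_mapsD[OF that])
qed (auto intro: mat_map_hom)

section \<open>M_pm A as a tensor product\<close>

lemma M_pm_simps [simp]:
  "carrier (M_pm l \<sigma>) = carrier (mat_alg l {1, 2})" "mult (M_pm l \<sigma>) = mult (mat_alg l {1, 2})"
  "add (M_pm l \<sigma>) = add (mat_alg l {1, 2})" "smult (M_pm l \<sigma>) = smult (mat_alg l {1, 2})"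
  "star (M_pm l \<sigma>) = (\<lambda>a (x, y). if x = y then \<sigma> (a (x, x)) else \<ominus>\<^bsub>l\<^esub> \<sigma> (a (y, x)))"
  by (simp_all add: M_pm_def module.defs)

lemma mat_alg_D:
  assumes "m \<in> carrier (mat_alg l S)"
  shows "m p \<in> carrier l" "p \<notin> S \<times> S \<Longrightarrow> m p = \<zero>\<^bsub>l\<^esub>"
  using assms by (cases p; auto simp: mat_alg_def)+

lemma mat_unit_carrier [simp]: "\<lbrakk>x \<in> S; y \<in> S\<rbrakk> \<Longrightarrow> mat_unit l x y \<in> carrier (mat_alg l S)"
proof -
  assume "x \<in> S" "y \<in> S"
  moreover have "{p. mat_unit l x y p \<noteq> \<zero>\<^bsub>l\<^esub>} \<subseteq> {(x, y)}" by (auto simp: mat_unit_def)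
  moreover from this have "finite {p. mat_unit l x y p \<noteq> \<zero>\<^bsub>l\<^esub>}" by (rule finite_subset) simp
  ultimately show ?thesis by (auto simp: mat_alg_def mat_unit_def)
qed

lemma mat_alg_mult:
  fixes i j k :: nat
  assumes m: "m \<in> carrier (mat_alg l {1, 2})" "m' \<in> carrier (mat_alg l {1, 2})"
  shows "(m \<otimes>\<^bsub>mat_alg l {1, 2}\<^esub> m') (i, k) = m (i, 1) \<otimes>\<^bsub>l\<^esub> m' (1, k) \<oplus>\<^bsub>l\<^esub> m (i, 2) \<otimes>\<^bsub>l\<^esub> m' (2, k)"
proof -
  \<comment> \<open>The product sums over the support of row \<open>i\<close>; it may be enlarged to
    both indices since the added terms vanish.\<close>
  have "{y. m (i, y) \<noteq> \<zero>\<^bsub>l\<^esub>} \<subseteq> {1, 2}" using mat_alg_D(2)[OF m(1)] by fastforce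
  then have "(\<Oplus>\<^bsub>l\<^esub>y\<in>{y. m (i, y) \<noteq> \<zero>\<^bsub>l\<^esub>}. m (i, y) \<otimes>\<^bsub>l\<^esub> m' (y, k)) = (\<Oplus>\<^bsub>l\<^esub>y\<in>{1, 2}. m (i, y) \<otimes>\<^bsub>l\<^esub> m' (y, k))"
    by (intro R.add.finprod_mono_neutral_cong_left) (auto simp: mat_alg_D(1)[OF m(1)] mat_alg_D(1)[OF m(2)])
  then show ?thesis
    by (simp add: mat_alg_def mat_alg_D(1)[OF m(1)] mat_alg_D(1)[OF m(2)])
qed

text \<open>Keeps the matrix index \<open>1\<close> from becoming \<open>Suc 0\<close>, so that
  facts about entries and matrix units continue to match.\<close>

declare One_nat_def [simp del]

definition "tau A m a = e4 ((m (1, 1) \<odot>\<^bsub>A\<^esub> a, m (1, 2) \<odot>\<^bsub>A\<^esub> a), (m (2, 1) \<odot>\<^bsub>A\<^esub> a, m (2, 2) \<odot>\<^bsub>A\<^esub> a))"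
  for m :: "nat \<times> nat \<Rightarrow> 'u"

abbreviation "M2l \<equiv> mat_alg l {1, 2 :: nat}"

lemma M2l_ops [simp]:
  "(m \<oplus>\<^bsub>M2l\<^esub> m') p = m p \<oplus>\<^bsub>l\<^esub> m' p" "(r \<odot>\<^bsub>M2l\<^esub> m) p = r \<otimes>\<^bsub>l\<^esub> m p"
  by (simp_all add: mat_alg_def)

lemma M2l_closed [simp]:
  assumes "m \<in> carrier M2l"
  shows "m' \<in> carrier M2l \<Longrightarrow> m \<oplus>\<^bsub>M2l\<^esub> m' \<in> carrier M2l" "r \<in> carrier l \<Longrightarrow> r \<odot>\<^bsub>M2l\<^esub> m \<in> carrier M2l"
proof -
  have fin: "finite {p. f p \<noteq> \<zero>\<^bsub>l\<^esub>} \<and> {p. f p \<noteq> \<zero>\<^bsub>l\<^esub>} \<subseteq> {1, 2} \<times> {1, 2}"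
    if "\<And>p. p \<notin> {1, 2} \<times> {1, 2} \<Longrightarrow> f p = \<zero>\<^bsub>l\<^esub>" for f :: "nat \<times> nat \<Rightarrow> 'u"
  proof -
    have "{p. f p \<noteq> \<zero>\<^bsub>l\<^esub>} \<subseteq> {1, 2} \<times> {1, 2}" using that by blast
    then show ?thesis using finite_subset[of "{p. f p \<noteq> \<zero>\<^bsub>l\<^esub>}" "{1, 2} \<times> {1, 2}"] by simp
  qed
  note m = mat_alg_D[OF assms]
  show "m \<oplus>\<^bsub>M2l\<^esub> m' \<in> carrier M2l" if "m' \<in> carrier M2l"
    using fin[of "\<lambda>p. m p \<oplus>\<^bsub>l\<^esub> m' p"] m mat_alg_D[OF that] by (simp add: mat_alg_def)
  show "r \<odot>\<^bsub>M2l\<^esub> m \<in> carrier M2l" if "r \<in> carrier l"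
    using fin[of "\<lambda>p. r \<otimes>\<^bsub>l\<^esub> m p"] m that by (simp add: mat_alg_def)
qed

abbreviation "E i j \<equiv> mat_unit l i (j :: nat)"

lemma mat_unit_decompose:
  assumes "m \<in> carrier M2l"
  shows "m = (m (1, 1) \<odot>\<^bsub>M2l\<^esub> E 1 1) \<oplus>\<^bsub>M2l\<^esub> ((m (1, 2) \<odot>\<^bsub>M2l\<^esub> E 1 2) \<oplus>\<^bsub>M2l\<^esub>
    ((m (2, 1) \<odot>\<^bsub>M2l\<^esub> E 2 1) \<oplus>\<^bsub>M2l\<^esub> (m (2, 2) \<odot>\<^bsub>M2l\<^esub> E 2 2)))"
proof
  fix p
  note m = mat_alg_D[OF assms]
  show "m p = ((m (1, 1) \<odot>\<^bsub>M2l\<^esub> E 1 1) \<oplus>\<^bsub>M2l\<^esub> ((m (1, 2) \<odot>\<^bsub>M2l\<^esub> E 1 2) \<oplus>\<^bsub>M2l\<^esub>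
    ((m (2, 1) \<odot>\<^bsub>M2l\<^esub> E 2 1) \<oplus>\<^bsub>M2l\<^esub> (m (2, 2) \<odot>\<^bsub>M2l\<^esub> E 2 2)))) p"
  proof (cases "p \<in> {1, 2} \<times> {1, 2}")
    case True
    then consider "p = (1, 1)" | "p = (1, 2)" | "p = (2, 1)" | "p = (2, 2)" by auto
    then show ?thesis by cases (simp_all add: m mat_unit_def)
  next
    case False
    then have "p \<noteq> (1, 1)" "p \<noteq> (1, 2)" "p \<noteq> (2, 1)" "p \<noteq> (2, 2)" by auto
    then show ?thesis using False by (simp add: m mat_unit_def)
  qed
qed

text \<open>\<open>iota_stable\<close> speaks of any object with the universal property of M_pm A;
  this exhibits the concrete 2x2 matrices as one. The scalar matrices are free on the
  \<open>E i j\<close>, so a bilinear \<open>\<beta>\<close> must induce the map taking a matrix to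
  the sum of the \<open>\<beta> (E i j)\<close> at its entries.\<close>

lemma tau_tensor:
  assumes A: "is_star_algebra l \<sigma> A"
  shows "is_star_tensor l \<sigma> (M_pm l \<sigma>) A (mat_ob A) (tau A)"
proof -
  interpret A: star_alg l \<sigma> A by (rule star_algI[OF inv_ring A])
  interpret P: star_alg l \<sigma> "mat_ob A" by (rule star_algI[OF inv_ring mat_ob_star_algebra[OF A]])
  note D = mat_alg_D(1)
  have tau_in: "tau A m a \<in> carrier (mat_ob A)" if "m \<in> carrier M2l" "a \<in> carrier A" for m a
    using that by (simp add: tau_def D)
  have bil: "tau A \<in> bilinear_maps l (M_pm l \<sigma>) A (mat_ob A)"
    unfolding bilinear_maps_def
    by (auto intro!: linear_mapsI simp: tau_def D A.smult_l_distr A.smult_r_distr R.m_comm simp flip: A.smult_assoc1)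
  have mult: "tau A m a \<otimes>\<^bsub>mat_ob A\<^esub> tau A m' a' = tau A (m \<otimes>\<^bsub>M2l\<^esub> m') (a \<otimes>\<^bsub>A\<^esub> a')"
    if "m \<in> carrier M2l" "m' \<in> carrier M2l" "a \<in> carrier A" "a' \<in> carrier A" for m m' a a'
    using that by (simp add: tau_def D mat_alg_mult A.smult_mult A.mult_smult A.smult_l_distr R.m_comm flip: A.smult_assoc1)
  have star: "star (mat_ob A) (tau A m a) = tau A (star (M_pm l \<sigma>) m) (star A a)"
    if "m \<in> carrier M2l" "a \<in> carrier A" for m a
    using that by (simp add: tau_def D A.smult_l_minus)
  have univ: "\<exists>!f. f \<in> linear_maps l (mat_ob A) N \<inter> extensional (carrier (mat_ob A)) \<and>
        (\<forall>m\<in>carrier (M_pm l \<sigma>). \<forall>a\<in>carrier A. f (tau A m a) = \<beta> m a)"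
    if N: "module l N" and \<beta>: "\<beta> \<in> bilinear_maps l (M_pm l \<sigma>) A N" for N :: "('u, 'u) module" and \<beta>
  proof -
    interpret N: module l N by (rule N)
    have b1: "\<beta> m \<in> linear_maps l A N" if "m \<in> carrier M2l" for m using bilinear_mapsD(1)[OF \<beta>] that by simp
    have b2: "(\<lambda>m. \<beta> m a) \<in> linear_maps l M2l N" if "a \<in> carrier A" for a
      using bilinear_mapsD(2)[OF \<beta> that] by (simp add: linear_maps_def)
    note b = linear_mapsD[OF b1] linear_mapsD[OF b2]
    define f where "f = restrict (\<lambda>z. case inv_into UNIV e4 z of ((a, b), (c, d)) \<Rightarrow>
      \<beta> (E 1 1) a \<oplus>\<^bsub>N\<^esub> (\<beta> (E 1 2) b \<oplus>\<^bsub>N\<^esub> (\<beta> (E 2 1) c \<oplus>\<^bsub>N\<^esub> \<beta> (E 2 2) d))) (carrier (mat_ob A))"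
    have f: "f (e4 ((a, b), (c, d))) = \<beta> (E 1 1) a \<oplus>\<^bsub>N\<^esub> (\<beta> (E 1 2) b \<oplus>\<^bsub>N\<^esub> (\<beta> (E 2 1) c \<oplus>\<^bsub>N\<^esub> \<beta> (E 2 2) d))"
      if "a \<in> carrier A" "b \<in> carrier A" "c \<in> carrier A" "d \<in> carrier A" for a b c d
      using that by (simp add: f_def del: inv_into_f_f f_inv_into_f) 
    have fl: "f \<in> linear_maps l (mat_ob A) N"
      by (rule linear_mapsI) (auto simp: f b N.smult_r_distr N.M.a_ac)
    have f\<tau>: "f (tau A m a) = \<beta> m a" if m: "m \<in> carrier M2l" and a: "a \<in> carrier A" for m a
    proof -
      have "\<beta> m a = \<beta> ((m (1, 1) \<odot>\<^bsub>M2l\<^esub> E 1 1) \<oplus>\<^bsub>M2l\<^esub> ((m (1, 2) \<odot>\<^bsub>M2l\<^esub> E 1 2) \<oplus>\<^bsub>M2l\<^esub>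
          ((m (2, 1) \<odot>\<^bsub>M2l\<^esub> E 2 1) \<oplus>\<^bsub>M2l\<^esub> (m (2, 2) \<odot>\<^bsub>M2l\<^esub> E 2 2)))) a"
        using mat_unit_decompose[OF m] by (rule arg_cong)
      also have "\<dots> = f (tau A m a)"
        using m a by (simp add: b tau_def f D)
      finally show ?thesis by simp
    qed
    show ?thesis
    proof (rule ex1I[of _ f])
      show "f \<in> linear_maps l (mat_ob A) N \<inter> extensional (carrier (mat_ob A)) \<and>
          (\<forall>m\<in>carrier (M_pm l \<sigma>). \<forall>a\<in>carrier A. f (tau A m a) = \<beta> m a)"
        using fl f\<tau> by (simp add: f_def)
      fix g assume g: "g \<in> linear_maps l (mat_ob A) N \<inter> extensional (carrier (mat_ob A)) \<and>
          (\<forall>m\<in>carrier (M_pm l \<sigma>). \<forall>a\<in>carrier A. g (tau A m a) = \<beta> m a)"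
      then have gl: "g \<in> linear_maps l (mat_ob A) N" and g\<tau>: "\<And>m a. \<lbrakk>m \<in> carrier M2l; a \<in> carrier A\<rbrakk> \<Longrightarrow> g (tau A m a) = \<beta> m a"
        by simp_all
      show "g = f"
      proof (rule extensionalityI[of _ "carrier (mat_ob A)"])
        show "g \<in> extensional (carrier (mat_ob A))" "f \<in> extensional (carrier (mat_ob A))"
          using g by (simp_all add: f_def)
        fix z assume "z \<in> carrier (mat_ob A)"
        then obtain a b' c d where z: "z = e4 ((a, b'), (c, d))" "a \<in> carrier A" "b' \<in> carrier A" "c \<in> carrier A" "d \<in> carrier A"
          by auto
        \<comment> \<open>Every matrix is a sum of elementary tensors, which forces the value of
          \<open>g\<close>.\<close>
        have "z = tau A (E 1 1) a \<oplus>\<^bsub>mat_ob A\<^esub> (tau A (E 1 2) b' \<oplus>\<^bsub>mat_ob A\<^esub> (tau A (E 2 1) c \<oplus>\<^bsub>mat_ob A\<^esub> tau A (E 2 2) d))"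
          using z(2-) by (simp add: z(1) tau_def mat_unit_def)
        also have "g \<dots> = f z"
          using z(2-) by (simp add: linear_mapsD[OF gl] tau_in g\<tau> f z(1) del: mat_ob_simps)
        finally show "g z = f z" .
      qed
    qed
  qed
  show ?thesis
    unfolding is_star_tensor_def is_tensor_def
    using A bil mult star univ P.alg by (simp add: A)
qed

definition "iota A a = e4 ((a, \<zero>\<^bsub>A\<^esub>), (\<zero>\<^bsub>A\<^esub>, \<zero>\<^bsub>A\<^esub>))"

lemma iota_tau: "\<lbrakk>is_algebra l A; a \<in> carrier A\<rbrakk> \<Longrightarrow> tau A (mat_unit l 1 1) a = iota A a"
proof -
  assume A: "is_algebra l A" and a: "a \<in> carrier A"
  interpret alg l A using A by unfold_locales
  show ?thesis using a by (simp add: tau_def iota_def mat_unit_def)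
qed

lemma iota_hom:
  assumes "is_star_algebra l \<sigma> A"
  shows "iota A \<in> star_homs l A (mat_ob A)"
proof -
  interpret star_alg l \<sigma> A by (rule star_algI[OF inv_ring assms])
  show ?thesis by (intro star_homsI alg_homsI) (simp_all add: iota_def M.add.inv_one[folded a_inv_def])
qed

end

section \<open>Isotropic idempotents\<close>

text \<open>One entry of (p a + p* c)(p a' + p* c'): \<open>r\<close>, \<open>t\<close> form a row
  of p and \<open>s\<close>, \<open>u\<close> one of p*, while the primed scalars form a column of
  each. The last four hypotheses are the corresponding entries of p p, p* p*, p p* and p* p, the
  latter two being zero.\<close>

lemma (in alg) lin_comb_mult_sum:
  assumes "r \<in> carrier l" "s \<in> carrier l" "r' \<in> carrier l" "s' \<in> carrier l"
    "t \<in> carrier l" "u \<in> carrier l" "t' \<in> carrier l" "u' \<in> carrier l"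
    and "a \<in> carrier A" "c \<in> carrier A" "a' \<in> carrier A" "c' \<in> carrier A"
    and "r \<otimes>\<^bsub>l\<^esub> r' \<oplus>\<^bsub>l\<^esub> t \<otimes>\<^bsub>l\<^esub> t' = v" "s \<otimes>\<^bsub>l\<^esub> s' \<oplus>\<^bsub>l\<^esub> u \<otimes>\<^bsub>l\<^esub> u' = w"
    "r \<otimes>\<^bsub>l\<^esub> s' \<oplus>\<^bsub>l\<^esub> t \<otimes>\<^bsub>l\<^esub> u' = \<zero>\<^bsub>l\<^esub>" "s \<otimes>\<^bsub>l\<^esub> r' \<oplus>\<^bsub>l\<^esub> u \<otimes>\<^bsub>l\<^esub> t' = \<zero>\<^bsub>l\<^esub>"
  shows "(r \<odot> a \<oplus> s \<odot> c) \<otimes> (r' \<odot> a' \<oplus> s' \<odot> c') \<oplus>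
      (t \<odot> a \<oplus> u \<odot> c) \<otimes> (t' \<odot> a' \<oplus> u' \<odot> c') =
    v \<odot> (a \<otimes> a') \<oplus> w \<odot> (c \<otimes> c')"
proof -
  note [simp] = assms(1-12)
  have "(r \<odot> a \<oplus> s \<odot> c) \<otimes> (r' \<odot> a' \<oplus> s' \<odot> c') \<oplus>
      (t \<odot> a \<oplus> u \<odot> c) \<otimes> (t' \<odot> a' \<oplus> u' \<odot> c') =
    (r \<otimes>\<^bsub>l\<^esub> r' \<oplus>\<^bsub>l\<^esub> t \<otimes>\<^bsub>l\<^esub> t') \<odot> (a \<otimes> a') \<oplus> (s \<otimes>\<^bsub>l\<^esub> s' \<oplus>\<^bsub>l\<^esub> u \<otimes>\<^bsub>l\<^esub> u') \<odot> (c \<otimes> c') \<oplus>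
      ((r \<otimes>\<^bsub>l\<^esub> s' \<oplus>\<^bsub>l\<^esub> t \<otimes>\<^bsub>l\<^esub> u') \<odot> (a \<otimes> c') \<oplus> (s \<otimes>\<^bsub>l\<^esub> r' \<oplus>\<^bsub>l\<^esub> u \<otimes>\<^bsub>l\<^esub> t') \<odot> (c \<otimes> a'))"
    by (simp add: l_dist r_dist smult_mult mult_smult smult_l_distr smult_r_distr R.m_comm M.a_ac flip: smult_assoc1)
  then show ?thesis unfolding assms(13-) using assms(13,14) by auto
qed

locale pairing_half = pairing l \<sigma> pr U for l :: "'u ring" and \<sigma> pr U +
  fixes lam
  assumes lam [simp]: "lam \<in> carrier l" and lam_sum: "lam \<oplus>\<^bsub>l\<^esub> \<sigma> lam = \<one>\<^bsub>l\<^esub>"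
begin

abbreviation "mu \<equiv> \<sigma> lam"

lemma mu_sum: "mu \<oplus>\<^bsub>l\<^esub> lam = \<one>\<^bsub>l\<^esub>" using lam_sum by (simp add: R.a_comm)

text \<open>The entries, up to sign, of p p = p and p* p* = p*, each by factoring out lambda +
  lambda* = 1; the variants differ in the order of the products.\<close>

lemma lam_eqs:
  "mu \<otimes>\<^bsub>l\<^esub> mu \<oplus>\<^bsub>l\<^esub> mu \<otimes>\<^bsub>l\<^esub> lam = mu" "lam \<otimes>\<^bsub>l\<^esub> mu \<oplus>\<^bsub>l\<^esub> lam \<otimes>\<^bsub>l\<^esub> lam = lam"
  "lam \<otimes>\<^bsub>l\<^esub> lam \<oplus>\<^bsub>l\<^esub> mu \<otimes>\<^bsub>l\<^esub> lam = lam" "mu \<otimes>\<^bsub>l\<^esub> lam \<oplus>\<^bsub>l\<^esub> mu \<otimes>\<^bsub>l\<^esub> mu = mu"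
  "lam \<otimes>\<^bsub>l\<^esub> lam \<oplus>\<^bsub>l\<^esub> lam \<otimes>\<^bsub>l\<^esub> mu = lam" "lam \<otimes>\<^bsub>l\<^esub> mu \<oplus>\<^bsub>l\<^esub> mu \<otimes>\<^bsub>l\<^esub> mu = mu"
  using lam_sum mu_sum by (simp_all add: R.m_comm flip: R.r_distr R.l_distr)

lemma lam_eqs_neg:
  "mu \<otimes>\<^bsub>l\<^esub> mu \<oplus>\<^bsub>l\<^esub> lam \<otimes>\<^bsub>l\<^esub> mu = mu"
  "\<ominus>\<^bsub>l\<^esub> (lam \<otimes>\<^bsub>l\<^esub> mu) \<oplus>\<^bsub>l\<^esub> \<ominus>\<^bsub>l\<^esub> (mu \<otimes>\<^bsub>l\<^esub> mu) = \<ominus>\<^bsub>l\<^esub> mu"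
  "\<ominus>\<^bsub>l\<^esub> (lam \<otimes>\<^bsub>l\<^esub> lam) \<oplus>\<^bsub>l\<^esub> \<ominus>\<^bsub>l\<^esub> (lam \<otimes>\<^bsub>l\<^esub> mu) = \<ominus>\<^bsub>l\<^esub> lam"
  using lam_eqs by (simp_all add: R.m_comm flip: R.minus_add)

text \<open>The matrix \<open>p = (\<lambda>* \<lambda>*; \<lambda> \<lambda>)\<close> is the idempotent of \<open>M\<^sub>\<plusminus>\<close> projecting onto one isotropic line along
  another, so \<open>p p* = p* p = 0\<close>; \<open>kappa\<close> is \<open>(a, b) \<mapsto> p a + p* b*\<close>.\<close>

definition "kappa A z = (case inv_into UNIV pr z of (a, b) \<Rightarrow> let c = star A b in
  e4 ((mu \<odot>\<^bsub>A\<^esub> a \<oplus>\<^bsub>A\<^esub> lam \<odot>\<^bsub>A\<^esub> c, mu \<odot>\<^bsub>A\<^esub> a \<oplus>\<^bsub>A\<^esub> (\<ominus>\<^bsub>l\<^esub> mu) \<odot>\<^bsub>A\<^esub> c),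
      (lam \<odot>\<^bsub>A\<^esub> a \<oplus>\<^bsub>A\<^esub> (\<ominus>\<^bsub>l\<^esub> lam) \<odot>\<^bsub>A\<^esub> c, lam \<odot>\<^bsub>A\<^esub> a \<oplus>\<^bsub>A\<^esub> mu \<odot>\<^bsub>A\<^esub> c)))"

lemma kappa_pr: "kappa A (pr (a, b)) =
  e4 ((mu \<odot>\<^bsub>A\<^esub> a \<oplus>\<^bsub>A\<^esub> lam \<odot>\<^bsub>A\<^esub> star A b, mu \<odot>\<^bsub>A\<^esub> a \<oplus>\<^bsub>A\<^esub> (\<ominus>\<^bsub>l\<^esub> mu) \<odot>\<^bsub>A\<^esub> star A b),
      (lam \<odot>\<^bsub>A\<^esub> a \<oplus>\<^bsub>A\<^esub> (\<ominus>\<^bsub>l\<^esub> lam) \<odot>\<^bsub>A\<^esub> star A b, lam \<odot>\<^bsub>A\<^esub> a \<oplus>\<^bsub>A\<^esub> mu \<odot>\<^bsub>A\<^esub> star A b))"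
  by (simp add: kappa_def Let_def)

text \<open>Since p and p* are orthogonal idempotents, products do not mix the two summands, and the
  reversed product \<open>b' b\<close> in the second component is turned into
  \<open>star A b\<close> times \<open>star A b'\<close> by the involution. The involution of M_pm
  exchanges p and p*, matching the swap of components in ind.\<close>

lemma kappa_hom:
  assumes A: "is_star_algebra l \<sigma> A"
  shows "kappa A \<in> star_homs l (ind_ob (module.truncate A)) (mat_ob A)"
proof -
  interpret star_alg l \<sigma> A by (rule star_algI[OF inv_ring A])
  have sm: "\<And>r x. \<lbrakk>r \<in> carrier l; x \<in> carrier A\<rbrakk> \<Longrightarrow> (\<ominus>\<^bsub>l\<^esub> r) \<odot>\<^bsub>A\<^esub> x = \<ominus>\<^bsub>A\<^esub> (r \<odot>\<^bsub>A\<^esub> x)"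
    by (rule smult_l_minus)
  show ?thesis
  proof (intro star_homsI alg_homsI)
    fix z z' assume "z \<in> carrier (ind_ob (module.truncate A))" "z' \<in> carrier (ind_ob (module.truncate A))"
    then obtain a b a' b' where z: "z = pr (a, b)" "z' = pr (a', b')"
      and [simp]: "a \<in> carrier A" "b \<in> carrier A" "a' \<in> carrier A" "b' \<in> carrier A" by auto
    show "kappa A (z \<otimes>\<^bsub>ind_ob (module.truncate A)\<^esub> z') = kappa A z \<otimes>\<^bsub>mat_ob A\<^esub> kappa A z'"
      unfolding z
      by (simp add: kappa_pr, intro conjI; rule lin_comb_mult_sum[symmetric])
        (simp_all add: lam_eqs lam_eqs_neg R.l_minus R.r_minus R.m_comm R.r_neg R.l_neg)
  qed (auto simp: kappa_pr smult_r_distr smult_r_minus sm M.a_ac M.minus_add R.m_comm R.r_minus simp flip: smult_assoc1)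
qed

definition "pmap B x = e4 ((mu \<odot>\<^bsub>B\<^esub> x, mu \<odot>\<^bsub>B\<^esub> x), (lam \<odot>\<^bsub>B\<^esub> x, lam \<odot>\<^bsub>B\<^esub> x))"

definition "theta B z = (case inv_into UNIV pr z of (u, v) \<Rightarrow>
  case inv_into UNIV e4 u of ((a, b), (c, d)) \<Rightarrow> case inv_into UNIV e4 v of ((a', b'), (c', d')) \<Rightarrow>
    e4 ((pr (a, a'), pr (b, \<ominus>\<^bsub>B\<^esub> c')), (pr (c, \<ominus>\<^bsub>B\<^esub> b'), pr (d, d'))))"

lemma theta_pr: "theta B (pr (e4 ((a, b), (c, d)), e4 ((a', b'), (c', d')))) =
    e4 ((pr (a, a'), pr (b, \<ominus>\<^bsub>B\<^esub> c')), (pr (c, \<ominus>\<^bsub>B\<^esub> b'), pr (d, d')))"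
  by (simp add: theta_def del: inv_into_f_f)

lemma ind_ob_neg:
  assumes "is_algebra l B" "x \<in> carrier B" "y \<in> carrier B"
  shows "\<ominus>\<^bsub>ind_ob B\<^esub> pr (x, y) = pr (\<ominus>\<^bsub>B\<^esub> x, \<ominus>\<^bsub>B\<^esub> y)"
proof -
  interpret B: alg l B using assms by unfold_locales
  interpret I: alg l "ind_ob B" using ind_ob_star_algebra[OF assms(1)] is_star_algebraD by unfold_locales
  show ?thesis by (rule I.M.minus_equality) (use assms in \<open>auto simp: B.M.l_neg\<close>)
qed

text \<open>\<open>theta\<close> identifies \<open>ind (M\<^sub>2 B)\<close> with \<open>M\<^sub>\<plusminus> (ind B)\<close>; the signs and the transposition in the second
  components come from the involution of \<open>M\<^sub>\<plusminus>\<close>.\<close>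

lemma theta_hom:
  assumes B: "is_algebra l B"
  shows "theta B \<in> star_homs l (ind_ob (mat_alg2 B)) (mat_ob (ind_ob B))"
proof -
  interpret B: alg l B using B by unfold_locales
  show ?thesis
    by (intro star_homsI alg_homsI)
      (auto simp: theta_pr ind_ob_neg[OF B] B.M.minus_add B.smult_r_minus B.M.a_ac)
qed

lemma theta_iota:
  assumes B: "is_algebra l B" and z: "z \<in> carrier (ind_ob B)"
  shows "theta B (ind_map (iota B) z) = iota (ind_ob B) z"
proof -
  interpret B: alg l B using B by unfold_locales
  show ?thesis using z by (auto simp: theta_pr iota_def)
qed

text \<open>Scalars act on the second component of ind B through \<open>\<sigma>\<close>, which
  turns the coefficients of p* into those of p up to the transposition and signs of
  \<open>theta\<close>. With \<open>theta_iota\<close> this reduces the triangle identity on ind B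
  to the equality of \<open>pmap\<close> and \<open>iota\<close> in kk.\<close>

lemma theta_pmap:
  assumes B: "is_algebra l B" and z: "z \<in> carrier (ind_ob B)"
  shows "theta B (ind_map (pmap B) z) = kappa (ind_ob B) (ind_map (\<lambda>b. pr (b, \<zero>\<^bsub>B\<^esub>)) z)"
proof -
  interpret B: alg l B using B by unfold_locales
  have s: "\<sigma> (\<ominus>\<^bsub>l\<^esub> r) = \<ominus>\<^bsub>l\<^esub> \<sigma> r" if "r \<in> carrier l" for r
    by (rule R.minus_equality[symmetric]) (use that in \<open>simp_all add: R.l_neg flip: sigma_add\<close>)
  obtain x y where xy: "z = pr (x, y)" "x \<in> carrier B" "y \<in> carrier B" using z by auto
  then show ?thesis by (simp add: theta_pr pmap_def kappa_pr s B.smult_l_minus)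
qed

text \<open>For the other triangle identity no \<open>theta\<close> is needed: with second component
  zero only the summand p a survives.\<close>

lemma kappa_unit:
  assumes A: "is_star_algebra l \<sigma> A" and a: "a \<in> carrier A"
  shows "kappa A (pr (a, \<zero>\<^bsub>A\<^esub>)) = pmap A a"
proof -
  interpret star_alg l \<sigma> A by (rule star_algI[OF inv_ring A])
  show ?thesis using a by (simp add: kappa_pr pmap_def)
qed

end

section \<open>Polynomial homotopies\<close>

text \<open>Both sides sum \<open>F\<close> over i + j <= n, by antidiagonals and by rows; passing
  to \<open>Suc n\<close> adds one antidiagonal, that is, one term to each row and a new row of
  length one.\<close>

lemma (in abelian_monoid) finsum_triangle:
  fixes n :: nat
  assumes F: "\<And>i j. F i j \<in> carrier G"
  shows "(\<Oplus>k\<in>{..n}. \<Oplus>i\<in>{..k}. F i (k - i)) = (\<Oplus>i\<in>{..n}. \<Oplus>j\<in>{..n - i}. F i j)"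
proof (induction n)
  case 0
  then show ?case using F by simp
next
  case (Suc n)
  have "(\<Oplus>i\<in>{..Suc n}. \<Oplus>j\<in>{..Suc n - i}. F i j) = F (Suc n) 0 \<oplus> (\<Oplus>i\<in>{..n}. \<Oplus>j\<in>{..Suc n - i}. F i j)"
    using F by (subst finsum_Suc) auto
  also have "(\<Oplus>i\<in>{..n}. \<Oplus>j\<in>{..Suc n - i}. F i j) = (\<Oplus>i\<in>{..n}. F i (Suc n - i) \<oplus> (\<Oplus>j\<in>{..n - i}. F i j))"
    using F by (intro finsum_cong') (auto simp: Suc_diff_le)
  also have "\<dots> = (\<Oplus>i\<in>{..n}. F i (Suc n - i)) \<oplus> (\<Oplus>i\<in>{..n}. \<Oplus>j\<in>{..n - i}. F i j)"
    using F by (intro finsum_addf) auto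
  also have "F (Suc n) 0 \<oplus> \<dots> = (F (Suc n) 0 \<oplus> (\<Oplus>i\<in>{..n}. F i (Suc n - i))) \<oplus> (\<Oplus>i\<in>{..n}. \<Oplus>j\<in>{..n - i}. F i j)"
    using F by (intro a_assoc[symmetric] finsum_closed) auto
  also have "F (Suc n) 0 \<oplus> (\<Oplus>i\<in>{..n}. F i (Suc n - i)) = (\<Oplus>i\<in>{..Suc n}. F i (Suc n - i))"
    using F by (subst finsum_Suc) auto
  finally show ?case
    using F by (subst finsum_Suc) (auto simp: Suc.IH)
qed

section \<open>Polynomials over a possibly non-unital algebra, and evaluation at t = 1\<close>

context alg
begin

lemma mult_finsum:
  fixes n :: nat
  assumes "x \<in> carrier A" "\<And>i. f i \<in> carrier A"
  shows "x \<otimes> finsum A f {..n} = finsum A (\<lambda>i. x \<otimes> f i) {..n}"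
  by (induction n) (use assms in \<open>simp_all add: r_dist\<close>)

lemma finsum_mult:
  fixes n :: nat
  assumes "x \<in> carrier A" "\<And>i. f i \<in> carrier A"
  shows "finsum A f {..n} \<otimes> x = finsum A (\<lambda>i. f i \<otimes> x) {..n}"
  by (induction n) (use assms in \<open>simp_all add: l_dist\<close>)

lemma smult_finsum:
  fixes n :: nat
  assumes "r \<in> carrier l" "\<And>i. f i \<in> carrier A"
  shows "r \<odot> finsum A f {..n} = finsum A (\<lambda>i. r \<odot> f i) {..n}"
  by (induction n) (use assms in \<open>simp_all add: smult_r_distr\<close>)

lemma finsum_bound:
  fixes n :: nat
  assumes "\<And>i. f i \<in> carrier A" "\<And>i. i > m \<Longrightarrow> f i = \<zero>" "m \<le> n"
  shows "finsum A f {..n} = finsum A f {..m}"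
  by (rule M.add.finprod_mono_neutral_cong_left[symmetric]) (use assms in auto)

lemma up_iff: "f \<in> up A \<longleftrightarrow> (\<forall>n. f n \<in> carrier A) \<and> (\<exists>n. \<forall>m>n. f m = \<zero>)"
  by (auto simp: up_def bound_def)

lemma upE:
  assumes "f \<in> up A"
  obtains n where "\<And>n. f n \<in> carrier A" "\<And>m. m > n \<Longrightarrow> f m = \<zero>"
  using assms unfolding up_iff by blast

definition "conv p q n = (\<Oplus>i\<in>{..n}. p i \<otimes> q (n - i))" for n :: nat

lemma conv_closed [simp]: "\<lbrakk>\<And>n. p n \<in> carrier A; \<And>n. q n \<in> carrier A\<rbrakk> \<Longrightarrow> conv p q n \<in> carrier A"
  unfolding conv_def by (intro M.finsum_closed) auto

lemma conv_bound:
  assumes "\<And>n. p n \<in> carrier A" "\<And>n. q n \<in> carrier A" "\<And>i. i > m \<Longrightarrow> p i = \<zero>" "\<And>i. i > k \<Longrightarrow> q i = \<zero>" "n > m + k"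
  shows "conv p q n = \<zero>"
proof -
  have "p i \<otimes> q (n - i) = \<zero>" for i
    using assms by (cases "i > m") auto
  then show ?thesis unfolding conv_def by (simp add: M.add.finprod_one_eqI)
qed

lemma conv_up:
  assumes "p \<in> up A" "q \<in> up A"
  shows "conv p q \<in> up A"
proof -
  obtain m where m: "\<And>n. p n \<in> carrier A" "\<And>i. i > m \<Longrightarrow> p i = \<zero>" using assms(1) by (rule upE) blast
  obtain k where k: "\<And>n. q n \<in> carrier A" "\<And>i. i > k \<Longrightarrow> q i = \<zero>" using assms(2) by (rule upE) blast
  have "\<forall>n>m + k. conv p q n = \<zero>" by (auto intro!: conv_bound[OF m(1) k(1) m(2) k(2)])
  then show ?thesis unfolding up_iff using m(1) k(1) by auto
qed

lemma conv_assoc: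
  assumes p: "\<And>n. p n \<in> carrier A" and q: "\<And>n. q n \<in> carrier A" and r: "\<And>n. r n \<in> carrier A"
  shows "conv (conv p q) r n = conv p (conv q r) n"
proof -
  \<comment> \<open>The argument of \<open>r\<close> is written \<open>n - (i + (k - i))\<close> to
    exhibit the summand as a function of \<open>i\<close> and \<open>j = k - i\<close>, as
    \<open>finsum_triangle\<close> wants it.\<close>
  have "conv (conv p q) r n = (\<Oplus>k\<in>{..n}. \<Oplus>i\<in>{..k}. p i \<otimes> q (k - i) \<otimes> r (n - (i + (k - i))))"
  proof -
    have "conv p q k \<otimes> r (n - k) = (\<Oplus>i\<in>{..k}. p i \<otimes> q (k - i) \<otimes> r (n - k))" for k
      unfolding conv_def using p q r by (simp add: finsum_mult)
    also have "(\<Oplus>i\<in>{..k}. p i \<otimes> q (k - i) \<otimes> r (n - k)) =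
        (\<Oplus>i\<in>{..k}. p i \<otimes> q (k - i) \<otimes> r (n - (i + (k - i))))" for k
      using p q r by (intro M.finsum_cong') auto
    finally show ?thesis unfolding conv_def[of "conv p q"] by simp
  qed
  also have "\<dots> = (\<Oplus>i\<in>{..n}. \<Oplus>j\<in>{..n - i}. p i \<otimes> q j \<otimes> r (n - (i + j)))"
    using p q r by (intro M.finsum_triangle[of "\<lambda>i j. p i \<otimes> q j \<otimes> r (n - (i + j))"]) auto
  also have "\<dots> = conv p (conv q r) n"
    unfolding conv_def using p q r by (intro M.finsum_cong') (auto simp: mult_finsum mult_assoc)
  finally show ?thesis .
qed

text \<open>Evaluation at t = 1. Summing over the support avoids any choice of a degree
  bound.\<close>

definition "coeff_sum p = finsum A p {i. p i \<noteq> \<zero>}" for p :: "nat \<Rightarrow> 'b"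

lemma coeff_sum_eq:
  assumes "\<And>n. p n \<in> carrier A" "\<And>i. i > m \<Longrightarrow> p i = \<zero>"
  shows "coeff_sum p = finsum A p {..m}"
  unfolding coeff_sum_def
  by (rule M.add.finprod_mono_neutral_cong_left) (use assms in \<open>auto simp: leI intro: ccontr\<close>)

text \<open>The left side sums \<open>p i \<otimes> q j\<close> over the triangle i + j <= m + k,
  the right side over the rectangle i <= m, j <= k. The triangle contains the rectangle, and outside
  it all terms vanish.\<close>

lemma coeff_sum_conv:
  assumes "p \<in> up A" "q \<in> up A"
  shows "coeff_sum (conv p q) = coeff_sum p \<otimes> coeff_sum q"
proof -
  obtain m where m: "\<And>n. p n \<in> carrier A" "\<And>i. i > m \<Longrightarrow> p i = \<zero>" using assms(1) by (rule upE) blast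
  obtain k where k: "\<And>n. q n \<in> carrier A" "\<And>i. i > k \<Longrightarrow> q i = \<zero>" using assms(2) by (rule upE) blast
  have q_sum: "coeff_sum q \<in> carrier A" using coeff_sum_eq[OF k] k by simp
  have "coeff_sum (conv p q) = finsum A (conv p q) {..m + k}"
    by (rule coeff_sum_eq) (use conv_bound[OF m(1) k(1) m(2) k(2)] m(1) k(1) in auto)
  also have "\<dots> = (\<Oplus>i\<in>{..m + k}. \<Oplus>j\<in>{..m + k - i}. p i \<otimes> q j)"
    unfolding conv_def using m k by (intro M.finsum_triangle) auto
  also have "\<dots> = (\<Oplus>i\<in>{..m + k}. p i \<otimes> coeff_sum q)"
  proof (rule M.finsum_cong')
    fix i
    \<comment> \<open>For i <= m the range up to m + k - i still covers the degree of
      \<open>q\<close>; for i > m the factor \<open>p i\<close> is zero.\<close>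
    have "p i \<otimes> finsum A q {..m + k - i} = p i \<otimes> coeff_sum q"
      using m k finsum_bound[of q k "m + k - i"] coeff_sum_eq[OF k] by (cases "i > m") auto
    then show "(\<Oplus>j\<in>{..m + k - i}. p i \<otimes> q j) = p i \<otimes> coeff_sum q"
      using m k by (simp add: mult_finsum)
  qed (use m q_sum in auto)
  also have "\<dots> = finsum A p {..m + k} \<otimes> coeff_sum q"
    using m q_sum by (simp add: finsum_mult)
  also have "finsum A p {..m + k} = coeff_sum p"
    using finsum_bound[of p m "m + k"] coeff_sum_eq[OF m] m by auto
  finally show ?thesis .
qed

lemma coeff_sum_add:
  assumes "p \<in> up A" "q \<in> up A"
  shows "coeff_sum (\<lambda>n. p n \<oplus> q n) = coeff_sum p \<oplus> coeff_sum q"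
proof -
  obtain m where m: "\<And>n. p n \<in> carrier A" "\<And>i. i > m \<Longrightarrow> p i = \<zero>" using assms(1) by (rule upE) blast
  obtain k where k: "\<And>n. q n \<in> carrier A" "\<And>i. i > k \<Longrightarrow> q i = \<zero>" using assms(2) by (rule upE) blast
  have "coeff_sum (\<lambda>n. p n \<oplus> q n) = finsum A (\<lambda>n. p n \<oplus> q n) {..m + k}"
    by (rule coeff_sum_eq) (use m k in auto)
  also have "\<dots> = finsum A p {..m + k} \<oplus> finsum A q {..m + k}" using m k by (intro M.finsum_addf) auto
  finally show ?thesis
    using finsum_bound[of p m "m + k"] coeff_sum_eq[OF m] m finsum_bound[of q k "m + k"] coeff_sum_eq[OF k] k by auto
qed

lemma coeff_sum_smult:
  assumes "r \<in> carrier l" "p \<in> up A"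
  shows "coeff_sum (\<lambda>n. r \<odot> p n) = r \<odot> coeff_sum p"
proof -
  obtain m where m: "\<And>n. p n \<in> carrier A" "\<And>i. i > m \<Longrightarrow> p i = \<zero>" using assms(2) by (rule upE) blast
  have "coeff_sum (\<lambda>n. r \<odot> p n) = finsum A (\<lambda>n. r \<odot> p n) {..m}"
    by (rule coeff_sum_eq) (use m assms in auto)
  then show ?thesis using m assms coeff_sum_eq[OF m] by (simp add: smult_finsum)
qed

lemma coeff_sum_closed:
  assumes "p \<in> up A"
  shows "coeff_sum p \<in> carrier A"
proof -
  obtain m where m: "\<And>n. p n \<in> carrier A" "\<And>i. i > m \<Longrightarrow> p i = \<zero>" using assms by (rule upE) blast
  show ?thesis using coeff_sum_eq[OF m] m by simp
qed

text \<open>The involution is a dummy: \<open>transport\<close> is only defined for \<open>star_alg\<close> records.\<close>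

definition "poly_plain = module.extend (poly_alg A) \<lparr>star = \<lambda>x. x\<rparr>"

lemma up_add: "\<lbrakk>p \<in> up A; q \<in> up A\<rbrakk> \<Longrightarrow> (\<lambda>n. p n \<oplus> q n) \<in> up A"
proof -
  assume a: "p \<in> up A" "q \<in> up A"
  obtain m where m: "\<And>n. p n \<in> carrier A" "\<And>i. i > m \<Longrightarrow> p i = \<zero>" using a(1) by (rule upE) blast
  obtain k where k: "\<And>n. q n \<in> carrier A" "\<And>i. i > k \<Longrightarrow> q i = \<zero>" using a(2) by (rule upE) blast
  show ?thesis unfolding up_iff using m k by (auto intro!: exI[of _ "m + k"])
qed

lemma up_smult: "\<lbrakk>r \<in> carrier l; p \<in> up A\<rbrakk> \<Longrightarrow> (\<lambda>n. r \<odot> p n) \<in> up A"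
proof -
  assume a: "r \<in> carrier l" "p \<in> up A"
  obtain m where m: "\<And>n. p n \<in> carrier A" "\<And>i. i > m \<Longrightarrow> p i = \<zero>" using a(2) by (rule upE) blast
  show ?thesis unfolding up_iff using m a(1) by (auto intro!: exI[of _ m])
qed

lemma zero_up [simp]: "(\<lambda>n. \<zero>) \<in> up A"
  by (simp add: up_iff)

lemma poly_plain_simps [simp]:
  "carrier poly_plain = up A" "\<zero>\<^bsub>poly_plain\<^esub> = (\<lambda>n. \<zero>)"
  "\<lbrakk>p \<in> up A; q \<in> up A\<rbrakk> \<Longrightarrow> p \<oplus>\<^bsub>poly_plain\<^esub> q = (\<lambda>n. p n \<oplus> q n)"
  "r \<odot>\<^bsub>poly_plain\<^esub> p = (\<lambda>n. r \<odot> p n)"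
  "\<lbrakk>p \<in> up A; q \<in> up A\<rbrakk> \<Longrightarrow> p \<otimes>\<^bsub>poly_plain\<^esub> q = conv p q"
  by (simp_all add: poly_plain_def poly_alg_def module.defs UP_def conv_def fun_eq_iff)

lemma is_algebra_poly_plain: "is_algebra l poly_plain"
proof (rule is_algebraI)
  show "cring l" by (rule cring_l)
  show "x \<oplus>\<^bsub>poly_plain\<^esub> y \<in> carrier poly_plain" if "x \<in> carrier poly_plain" "y \<in> carrier poly_plain" for x y
    using that by (simp add: up_add)
  show "\<zero>\<^bsub>poly_plain\<^esub> \<in> carrier poly_plain" by (simp add: up_iff)
  show "\<exists>y\<in>carrier poly_plain. y \<oplus>\<^bsub>poly_plain\<^esub> x = \<zero>\<^bsub>poly_plain\<^esub>" if "x \<in> carrier poly_plain" for x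
  proof (rule bexI[of _ "\<lambda>n. \<ominus> x n"])
    have z: "\<ominus> \<zero> = \<zero>" using M.l_neg[of "\<zero>"] by simp
    have "(\<lambda>n. \<ominus> x n) \<in> up A" using that by (auto simp: up_iff z)
    then show "(\<lambda>n. \<ominus> x n) \<in> carrier poly_plain" "(\<lambda>n. \<ominus> x n) \<oplus>\<^bsub>poly_plain\<^esub> x = \<zero>\<^bsub>poly_plain\<^esub>"
      using that by (simp_all add: mem_upD M.l_neg)
  qed
  show "x \<otimes>\<^bsub>poly_plain\<^esub> y \<otimes>\<^bsub>poly_plain\<^esub> z = x \<otimes>\<^bsub>poly_plain\<^esub> (y \<otimes>\<^bsub>poly_plain\<^esub> z)"
    if "x \<in> carrier poly_plain" "y \<in> carrier poly_plain" "z \<in> carrier poly_plain" for x y z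
    using that by (simp add: conv_up fun_eq_iff conv_assoc mem_upD)
  show "(x \<oplus>\<^bsub>poly_plain\<^esub> y) \<otimes>\<^bsub>poly_plain\<^esub> z = x \<otimes>\<^bsub>poly_plain\<^esub> z \<oplus>\<^bsub>poly_plain\<^esub> y \<otimes>\<^bsub>poly_plain\<^esub> z"
    "z \<otimes>\<^bsub>poly_plain\<^esub> (x \<oplus>\<^bsub>poly_plain\<^esub> y) = z \<otimes>\<^bsub>poly_plain\<^esub> x \<oplus>\<^bsub>poly_plain\<^esub> z \<otimes>\<^bsub>poly_plain\<^esub> y"
    if "x \<in> carrier poly_plain" "y \<in> carrier poly_plain" "z \<in> carrier poly_plain" for x y z
    using that by (simp_all add: conv_up up_add fun_eq_iff conv_def mem_upD l_dist r_dist M.finsum_addf flip: M.finsum_addf)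
  show "(r \<odot>\<^bsub>poly_plain\<^esub> x) \<otimes>\<^bsub>poly_plain\<^esub> y = r \<odot>\<^bsub>poly_plain\<^esub> (x \<otimes>\<^bsub>poly_plain\<^esub> y)"
    "x \<otimes>\<^bsub>poly_plain\<^esub> (r \<odot>\<^bsub>poly_plain\<^esub> y) = r \<odot>\<^bsub>poly_plain\<^esub> (x \<otimes>\<^bsub>poly_plain\<^esub> y)"
    if "r \<in> carrier l" "x \<in> carrier poly_plain" "y \<in> carrier poly_plain" for r x y
    using that by (simp_all add: up_smult fun_eq_iff conv_def mem_upD smult_mult mult_smult smult_finsum)
qed (auto simp: conv_up up_add up_smult mem_upD M.a_ac smult_l_distr smult_r_distr smult_assoc1)

end

lemma (in alg) poly_alg_simps:
  "carrier (poly_alg A) = up A"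
  "\<lbrakk>p \<in> up A; q \<in> up A\<rbrakk> \<Longrightarrow> p \<oplus>\<^bsub>poly_alg A\<^esub> q = (\<lambda>n. p n \<oplus> q n)"
  "\<lbrakk>p \<in> up A; q \<in> up A\<rbrakk> \<Longrightarrow> p \<otimes>\<^bsub>poly_alg A\<^esub> q = conv p q"
  "r \<odot>\<^bsub>poly_alg A\<^esub> p = (\<lambda>n. r \<odot> p n)"
  by (simp_all add: poly_alg_def UP_def conv_def fun_eq_iff)

section \<open>Polynomial algebras inside the universe, and homotopic homomorphisms\<close>

context pairing
begin

text \<open>Not injective on lists of different lengths, so the length is encoded separately below.\<close>

fun enc_list :: "'u list \<Rightarrow> 'u" where
  "enc_list [] = undefined"
| "enc_list (x # xs) = pr (x, enc_list xs)"

lemma enc_list_inj: "\<lbrakk>length xs = length ys; enc_list xs = enc_list ys\<rbrakk> \<Longrightarrow> xs = ys"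
  by (induction xs ys rule: list_induct2) auto

text \<open>Homotopy invariance only speaks of copies of A[t] carried by the universe, so the
  eventually zero sequences must be injected into it. The degree is encoded by an embedding of the
  naturals, the entries by iterated pairing; \<open>z\<close> stands for the zero
  coefficient.\<close>

lemma ex_encoding:
  assumes "infinite (UNIV :: 'u set)"
  shows "\<exists>enc :: (nat \<Rightarrow> 'u) \<Rightarrow> 'u. inj_on enc {f. \<exists>n. \<forall>m>n. f m = z}"
proof -
  obtain \<nu> :: "nat \<Rightarrow> 'u" where \<nu>: "inj \<nu>"
    using infinite_countable_subset[OF assms] by blast
  \<comment> \<open>Beyond \<open>len f\<close> every entry is \<open>z\<close>, so the entries 0 to
    \<open>len f\<close> inclusive have to be listed, whence the \<open>Suc\<close> in the next
    line.\<close>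
  define len where "len f = (LEAST n. \<forall>m>n. f m = z)" for f :: "nat \<Rightarrow> 'u"
  define enc where "enc f = pr (\<nu> (len f), enc_list (map f [0..<Suc (len f)]))" for f
  have "inj_on enc {f. \<exists>n. \<forall>m>n. f m = z}"
  proof (rule inj_onI)
    fix f g :: "nat \<Rightarrow> 'u"
    assume f: "f \<in> {f. \<exists>n. \<forall>m>n. f m = z}" and g: "g \<in> {f. \<exists>n. \<forall>m>n. f m = z}" and eq: "enc f = enc g"
    have lf: "\<forall>m>len f. f m = z" unfolding len_def by (rule LeastI_ex) (use f in blast)
    have lg: "\<forall>m>len g. g m = z" unfolding len_def by (rule LeastI_ex) (use g in blast)
    have l: "len f = len g" using eq \<nu> by (simp add: enc_def inj_eq)
    have "map f [0..<Suc (len f)] = map g [0..<Suc (len f)]"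
      by (rule enc_list_inj) (use eq l in \<open>simp_all add: enc_def del: upt_Suc\<close>)
    then have "f m = g m" if "m \<le> len f" for m using that by (simp add: map_eq_conv del: upt_Suc)
    then show "f = g" using lf lg l by (metis linorder_not_less ext)
  qed
  then show ?thesis by blast
qed

text \<open>The hypotheses \<open>m0\<close>, \<open>m1\<close>, \<open>m2\<close> are the
  coefficients of 1, t and t^2 in the statement that f0 + t f1 is multiplicative as a map from
  \<open>B\<close> to C[t]. Evaluations at 0 and at 1 are both left inverse to the inclusion of
  constants, so they agree once that inclusion is inverted, and they take f0 + t f1 to the two
  homomorphisms.\<close>

lemma homotopy_eq:
  assumes inf: "infinite (UNIV :: 'u set)"
    and T: "is_category T" and H: "is_functor (Alg l) T H" and hinv: "homotopy_invariant l T H"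
    and B: "is_algebra l B" and C: "is_algebra l C"
    and f0: "f0 \<in> linear_maps l B C" and f1: "f1 \<in> linear_maps l B C"
    and m0: "\<And>x y. \<lbrakk>x \<in> carrier B; y \<in> carrier B\<rbrakk> \<Longrightarrow> f0 (x \<otimes>\<^bsub>B\<^esub> y) = f0 x \<otimes>\<^bsub>C\<^esub> f0 y"
    and m1: "\<And>x y. \<lbrakk>x \<in> carrier B; y \<in> carrier B\<rbrakk> \<Longrightarrow> f1 (x \<otimes>\<^bsub>B\<^esub> y) = f0 x \<otimes>\<^bsub>C\<^esub> f1 y \<oplus>\<^bsub>C\<^esub> f1 x \<otimes>\<^bsub>C\<^esub> f0 y"
    and m2: "\<And>x y. \<lbrakk>x \<in> carrier B; y \<in> carrier B\<rbrakk> \<Longrightarrow> f1 x \<otimes>\<^bsub>C\<^esub> f1 y = \<zero>\<^bsub>C\<^esub>"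
  shows "ar H (arrow B f0 C) = ar H (arrow B (\<lambda>x. f0 x \<oplus>\<^bsub>C\<^esub> f1 x) C)"
proof -
  interpret B: alg l B using B by unfold_locales
  interpret C: alg l C using C by unfold_locales
  interpret H: functr "Alg l" T H using T H Alg_category by unfold_locales
  note f0 [simp] = linear_mapsD[OF f0] and f1 [simp] = linear_mapsD[OF f1]
  obtain enc :: "(nat \<Rightarrow> 'u) \<Rightarrow> 'u" where "inj_on enc {f. \<exists>n. \<forall>m>n. f m = \<zero>\<^bsub>C\<^esub>}"
    using ex_encoding[OF inf] by blast
  then have enc: "inj_on enc (up C)" by (rule inj_on_subset) (auto simp: C.up_iff)
  define P :: "('u, 'u) module" where "P = module.truncate (transport enc C.poly_plain)"
  have P: "is_algebra l P" unfolding P_def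
    by (intro is_algebra_truncate is_algebra_transport C.is_algebra_poly_plain) (simp add: enc)
  have e': "inj_on enc (carrier C.poly_plain)" using enc by simp
  have P_simps: "carrier P = enc ` up C"
    "\<lbrakk>p \<in> up C; q \<in> up C\<rbrakk> \<Longrightarrow> enc p \<oplus>\<^bsub>P\<^esub> enc q = enc (\<lambda>n. p n \<oplus>\<^bsub>C\<^esub> q n)"
    "\<lbrakk>p \<in> up C; q \<in> up C\<rbrakk> \<Longrightarrow> enc p \<otimes>\<^bsub>P\<^esub> enc q = enc (C.conv p q)"
    "p \<in> up C \<Longrightarrow> r \<odot>\<^bsub>P\<^esub> enc p = enc (\<lambda>n. r \<odot>\<^bsub>C\<^esub> p n)" for p q r
    using transport_simps[OF e'] by (simp_all add: P_def)
  have enc_hom: "enc \<in> alg_homs l (poly_alg C) P"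
    by (rule alg_homsI) (simp_all add: P_simps C.poly_alg_simps)
  define inc where "inc a = enc (monom (UP C) a 0)" for a
  have inc_iso: "iso_arrow T (ar H (arrow C inc P))"
    unfolding inc_def
    by (rule hinv[unfolded homotopy_invariant_def, rule_format])
      (use C P enc_hom enc in \<open>auto simp: bij_betw_def C.poly_alg_simps P_simps\<close>)
  have const_up: "(\<lambda>n. if n = 0 then a else if n = 1 then b else \<zero>\<^bsub>C\<^esub>) \<in> up C" if "a \<in> carrier C" "b \<in> carrier C" for a b
    unfolding C.up_iff using that by (auto intro!: exI[of _ 1])
  \<comment> \<open>Constants are written in the shape of a linear polynomial so that
    \<open>const_up\<close>, \<open>conv_eq\<close> and \<open>sum1\<close> cover them.\<close>
  have inc_eq: "inc a = enc (\<lambda>n. if n = 0 then a else if n = 1 then \<zero>\<^bsub>C\<^esub> else \<zero>\<^bsub>C\<^esub>)" if "a \<in> carrier C" for a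
    using that by (auto simp: inc_def UP_def intro!: arg_cong[of _ _ enc])
  define dec where "dec = inv_into (up C) enc"
  have dec [simp]: "dec (enc p) = p" if "p \<in> up C" for p using enc that by (simp add: dec_def)
  have conv_eq: "C.conv (\<lambda>n. if n = 0 then a else if n = 1 then b else \<zero>\<^bsub>C\<^esub>) (\<lambda>n. if n = 0 then c else if n = 1 then d else \<zero>\<^bsub>C\<^esub>) n
      = (if n = 0 then a \<otimes>\<^bsub>C\<^esub> c else if n = 1 then a \<otimes>\<^bsub>C\<^esub> d \<oplus>\<^bsub>C\<^esub> b \<otimes>\<^bsub>C\<^esub> c else if n = 2 then b \<otimes>\<^bsub>C\<^esub> d else \<zero>\<^bsub>C\<^esub>)"
    if abcd: "a \<in> carrier C" "b \<in> carrier C" "c \<in> carrier C" "d \<in> carrier C" for a b c d n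
  proof -
    consider "n = 0" | "n = 1" | "n = 2" | "n > 2" by linarith
    then show ?thesis
    proof cases
      case 4
      then show ?thesis using C.conv_bound[of "\<lambda>n. if n = 0 then a else if n = 1 then b else \<zero>\<^bsub>C\<^esub>"
        "\<lambda>n. if n = 0 then c else if n = 1 then d else \<zero>\<^bsub>C\<^esub>" 1 1 n] abcd by auto
    next
      case 2
      have "{..1 :: nat} = {0, 1}" by auto
      then show ?thesis using 2 abcd by (simp add: C.conv_def C.M.a_comm)
    next
      case 3
      have "{..2 :: nat} = {0, 1, 2}" by auto
      then show ?thesis using 3 abcd by (simp add: C.conv_def)
    qed (use abcd in \<open>simp add: C.conv_def\<close>)
  qed
  define h where "h x = enc (\<lambda>n. if n = 0 then f0 x else if n = 1 then f1 x else \<zero>\<^bsub>C\<^esub>)" for x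
  have h: "h \<in> alg_homs l B P"
  proof (rule alg_homsI)
    fix x y assume xy: "x \<in> carrier B" "y \<in> carrier B"
    show "h (x \<otimes>\<^bsub>B\<^esub> y) = h x \<otimes>\<^bsub>P\<^esub> h y"
      unfolding h_def using xy
      by (subst P_simps) (auto simp: const_up conv_eq m0 m1 m2 fun_eq_iff intro!: arg_cong[of _ _ enc])
    show "h (x \<oplus>\<^bsub>B\<^esub> y) = h x \<oplus>\<^bsub>P\<^esub> h y"
      unfolding h_def using xy
      by (subst P_simps) (auto simp: const_up fun_eq_iff intro!: arg_cong[of _ _ enc])
  next
    fix r x assume xy: "r \<in> carrier l" "x \<in> carrier B"
    show "h (r \<odot>\<^bsub>B\<^esub> x) = r \<odot>\<^bsub>P\<^esub> h x"
      unfolding h_def using xy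
      by (subst P_simps) (auto simp: const_up fun_eq_iff intro!: arg_cong[of _ _ enc])
  qed (simp add: h_def P_simps const_up)
  define ev0 where "ev0 z = dec z 0" for z
  define ev1 where "ev1 z = C.coeff_sum (dec z)" for z
  have ev0: "ev0 \<in> alg_homs l P C"
    by (rule alg_homsI) (auto simp: P_simps ev0_def C.up_add C.up_smult C.conv_up C.conv_def mem_upD)
  have ev1: "ev1 \<in> alg_homs l P C"
    by (rule alg_homsI) (auto simp: P_simps ev1_def C.up_add C.up_smult C.conv_up
        C.coeff_sum_add C.coeff_sum_smult C.coeff_sum_conv C.coeff_sum_closed)
  have sum1: "C.coeff_sum (\<lambda>n. if n = 0 then a else if n = 1 then b else \<zero>\<^bsub>C\<^esub>) = a \<oplus>\<^bsub>C\<^esub> b"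
    if "a \<in> carrier C" "b \<in> carrier C" for a b
  proof -
    have "{..1 :: nat} = {0, 1}" by auto
    then show ?thesis using that by (subst C.coeff_sum_eq[where m = 1]) auto
  qed
  have inc: "inc \<in> alg_homs l C P"
  proof (rule alg_homsI)
    fix x y assume xy: "x \<in> carrier C" "y \<in> carrier C"
    then show "inc (x \<otimes>\<^bsub>C\<^esub> y) = inc x \<otimes>\<^bsub>P\<^esub> inc y"
      by (simp only: inc_eq C.mult_closed, subst P_simps)
        (auto simp: const_up conv_eq fun_eq_iff intro!: arg_cong[of _ _ enc])
    show "inc (x \<oplus>\<^bsub>C\<^esub> y) = inc x \<oplus>\<^bsub>P\<^esub> inc y"
      using xy by (simp only: inc_eq C.M.a_closed, subst P_simps)
        (auto simp: const_up fun_eq_iff intro!: arg_cong[of _ _ enc])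
  next
    fix r x assume xy: "r \<in> carrier l" "x \<in> carrier C"
    then show "inc (r \<odot>\<^bsub>C\<^esub> x) = r \<odot>\<^bsub>P\<^esub> inc x"
      by (simp only: inc_eq C.smult_closed, subst P_simps)
        (auto simp: const_up fun_eq_iff intro!: arg_cong[of _ _ enc])
  qed (simp add: inc_eq P_simps const_up)
  have [simp]: "arrow C inc P \<in> Arr (Alg l)" "arrow P ev0 C \<in> Arr (Alg l)" "arrow P ev1 C \<in> Arr (Alg l)" "arrow B h P \<in> Arr (Alg l)"
    using B C P inc ev0 ev1 h by (simp_all add: Alg_Arr)
  have "arrow P ev0 C \<bullet>\<^bsub>Alg l\<^esub> arrow C inc P = Id (Alg l) C"
    using C P inc by (auto simp: Alg_comp ev0_def inc_eq const_up intro!: arrow_eq)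
  then have 0: "ar H (arrow P ev0 C) \<bullet>\<^bsub>T\<^esub> ar H (arrow C inc P) = Id T (ob H C)"
    using C H.ar_Id[of C] by (simp flip: H.ar_comp)
  have "arrow P ev1 C \<bullet>\<^bsub>Alg l\<^esub> arrow C inc P = Id (Alg l) C"
    using C P inc by (auto simp: Alg_comp ev1_def inc_eq const_up sum1 intro!: arrow_eq)
  then have 1: "ar H (arrow P ev1 C) \<bullet>\<^bsub>T\<^esub> ar H (arrow C inc P) = Id T (ob H C)"
    using C H.ar_Id[of C] by (simp flip: H.ar_comp)
  obtain k where k: "k \<in> Arr T" "Dom T k = ob H P" "Cod T k = ob H C" "ar H (arrow C inc P) \<bullet>\<^bsub>T\<^esub> k = Id T (ob H P)"
    using H.T.iso_arrowE[OF inc_iso] by auto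
  \<comment> \<open>The inclusion of constants is cancelled on the right by means of its inverse
    \<open>k\<close>.\<close>
  have "ar H (arrow P ev0 C) = (ar H (arrow P ev0 C) \<bullet>\<^bsub>T\<^esub> ar H (arrow C inc P)) \<bullet>\<^bsub>T\<^esub> k"
    using k by simp
  also have "\<dots> = (ar H (arrow P ev1 C) \<bullet>\<^bsub>T\<^esub> ar H (arrow C inc P)) \<bullet>\<^bsub>T\<^esub> k"
    unfolding 0 1 ..
  also have "\<dots> = ar H (arrow P ev1 C)" using k by simp
  finally have ev: "ar H (arrow P ev0 C) = ar H (arrow P ev1 C)" .
  have "arrow B f0 C = arrow P ev0 C \<bullet>\<^bsub>Alg l\<^esub> arrow B h P"
    using B P h by (auto simp: Alg_comp ev0_def h_def const_up intro!: arrow_eq)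
  moreover have "arrow B (\<lambda>x. f0 x \<oplus>\<^bsub>C\<^esub> f1 x) C = arrow P ev1 C \<bullet>\<^bsub>Alg l\<^esub> arrow B h P"
    using B P h by (auto simp: Alg_comp ev1_def h_def const_up sum1 intro!: arrow_eq)
  ultimately show ?thesis by (simp add: ev)
qed

end

text \<open>Both \<open>E\<^sub>1\<^sub>1\<close> and \<open>p\<close> are of the form column times row with \<open>row \<cdot> column = 1\<close>.  First the row moves from
  \<open>(1, 0)\<close> to \<open>(1, t)\<close>, then the column from \<open>(1, 0)\<close> to \<open>(1 - t \<lambda>, t \<lambda>)\<close>, always through idempotents.\<close>

lemma (in pairing_half) iota_pmap_homotopic:
  assumes inf: "infinite (UNIV :: 'u set)"
    and T: "is_category T" and H: "is_functor (Alg l) T H" and hinv: "homotopy_invariant l T H"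
    and B: "is_algebra l B"
  shows "ar H (arrow B (iota B) (mat_alg2 B)) = ar H (arrow B (pmap B) (mat_alg2 B))"
proof -
  interpret B: alg l B using B by unfold_locales
  let ?z = "\<zero>\<^bsub>B\<^esub>"
  have neg0: "\<ominus>\<^bsub>B\<^esub> ?z = ?z" using B.M.l_neg[of ?z] by simp
  define g where "g x = e4 ((x, x), (?z, ?z))" for x
  \<comment> \<open>The t-derivatives of the two paths, each a column times a row: column (1, 0) and
    row (0, 1) for \<open>g1\<close>, column (-lambda, lambda) and row (1, 1) for \<open>g2\<close>.
    In both cases row times column is zero, which gives the hypothesis \<open>m2\<close> of
    \<open>homotopy_eq\<close>.\<close>
  define g1 where "g1 x = e4 ((?z, x), (?z, ?z))" for x
  define g2 where "g2 x = e4 ((\<ominus>\<^bsub>B\<^esub> (lam \<odot>\<^bsub>B\<^esub> x), \<ominus>\<^bsub>B\<^esub> (lam \<odot>\<^bsub>B\<^esub> x)), (lam \<odot>\<^bsub>B\<^esub> x, lam \<odot>\<^bsub>B\<^esub> x))" for x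
  note hom = homotopy_eq[OF inf T H hinv B mat_alg2_algebra[OF B]]
  have "ar H (arrow B (iota B) (mat_alg2 B)) = ar H (arrow B (\<lambda>x. iota B x \<oplus>\<^bsub>mat_alg2 B\<^esub> g1 x) (mat_alg2 B))"
    by (rule hom) (auto intro!: linear_mapsI simp: iota_def g1_def)
  also have "arrow B (\<lambda>x. iota B x \<oplus>\<^bsub>mat_alg2 B\<^esub> g1 x) (mat_alg2 B) = arrow B g (mat_alg2 B)"
    by (rule arrow_eq) (simp add: iota_def g1_def g_def)
  also have "ar H \<dots> = ar H (arrow B (\<lambda>x. g x \<oplus>\<^bsub>mat_alg2 B\<^esub> g2 x) (mat_alg2 B))"
    by (rule hom) (auto intro!: linear_mapsI simp: g_def g2_def neg0 B.smult_r_distr B.M.minus_add B.M.a_ac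
        B.smult_r_minus B.smult_mult B.mult_smult B.M.l_neg B.M.r_neg R.m_comm simp flip: B.smult_assoc1)
  also have "arrow B (\<lambda>x. g x \<oplus>\<^bsub>mat_alg2 B\<^esub> g2 x) (mat_alg2 B) = arrow B (pmap B) (mat_alg2 B)"
  proof (rule arrow_eq)
    fix x assume x: "x \<in> carrier B"
    have "mu \<odot>\<^bsub>B\<^esub> x \<oplus>\<^bsub>B\<^esub> lam \<odot>\<^bsub>B\<^esub> x = x"
      using x mu_sum by (simp flip: B.smult_l_distr)
    then have "x \<oplus>\<^bsub>B\<^esub> \<ominus>\<^bsub>B\<^esub> (lam \<odot>\<^bsub>B\<^esub> x) = (mu \<odot>\<^bsub>B\<^esub> x \<oplus>\<^bsub>B\<^esub> lam \<odot>\<^bsub>B\<^esub> x) \<oplus>\<^bsub>B\<^esub> \<ominus>\<^bsub>B\<^esub> (lam \<odot>\<^bsub>B\<^esub> x)"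
      by simp
    also have "\<dots> = mu \<odot>\<^bsub>B\<^esub> x" using x by (simp add: B.M.a_assoc B.M.r_neg)
    finally show "g x \<oplus>\<^bsub>mat_alg2 B\<^esub> g2 x = pmap B x"
      using x by (simp add: g_def g2_def pmap_def)
  qed
  finally show ?thesis .
qed

section \<open>The adjunctions\<close>

text \<open>Homotopy invariance and stability demand that certain arrows become invertible, which
  any functor preserves. Such composites are the theories to which uniqueness is applied.\<close>

lemma kk_theory_composite:
  assumes "kk_theory l U X K J \<delta>" "triangulated T" "triangulated_functor K T D \<chi>"
  shows "kk_theory l U X T (comp_func D J) (composite_boundary (Alg l) J \<delta> T D \<chi>)"
proof -
  have E: "excisive (Alg l) (alg_ext l U) K J \<delta>"
    and h: "homotopy_invariant l K J" and m: "matrix_stable l X K J"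
    using assms(1) by (simp_all add: kk_theory_def)
  interpret D: trifun K T D \<chi> using assms E by unfold_locales (simp_all add: excisive_def)
  have "excisive (Alg l) (alg_ext l U) T (comp_func D J) (composite_boundary (Alg l) J \<delta> T D \<chi>)"
    by (rule excisive_composite[OF Alg_category assms(2) E assms(3)])
      (use ext_arrows_Alg in \<open>unfold ext_arrows_def, fast\<close>)
  moreover have "homotopy_invariant l T (comp_func D J)"
    using h unfolding homotopy_invariant_def by (simp add: comp_func_def)
  moreover have "matrix_stable l X T (comp_func D J)"
    using m unfolding matrix_stable_def by (simp add: comp_func_def) (blast intro: D.ar_iso)
  ultimately show ?thesis by (simp add: kk_theory_def)
qed

lemma kkh_theory_composite:
  assumes "kkh_theory l \<sigma> U X K J \<delta>" "triangulated T" "triangulated_functor K T D \<chi>"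
  shows "kkh_theory l \<sigma> U X T (comp_func D J) (composite_boundary (StarAlg l \<sigma>) J \<delta> T D \<chi>)"
proof -
  have E: "excisive (StarAlg l \<sigma>) (star_ext l \<sigma> U) K J \<delta>"
    and h: "star_homotopy_invariant l \<sigma> K J" and i: "iota_stable l \<sigma> K J" and m: "star_matrix_stable l \<sigma> X K J"
    using assms(1) by (simp_all add: kkh_theory_def)
  interpret D: trifun K T D \<chi> using assms E by unfold_locales (simp_all add: excisive_def)
  have "excisive (StarAlg l \<sigma>) (star_ext l \<sigma> U) T (comp_func D J) (composite_boundary (StarAlg l \<sigma>) J \<delta> T D \<chi>)"
    by (rule excisive_composite[OF StarAlg_category assms(2) E assms(3)])
      (use ext_arrows_StarAlg in \<open>unfold ext_arrows_def, fast\<close>)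
  moreover have "star_homotopy_invariant l \<sigma> T (comp_func D J)"
    using h unfolding star_homotopy_invariant_def by (simp add: comp_func_def)
  moreover have "iota_stable l \<sigma> T (comp_func D J)"
    using i unfolding iota_stable_def by (simp add: comp_func_def)
  moreover have "star_matrix_stable l \<sigma> X T (comp_func D J)"
    using m unfolding star_matrix_stable_def by (simp add: comp_func_def) (blast intro: D.ar_iso)
  ultimately show ?thesis by (simp add: kkh_theory_def)
qed

lemma universal_kk_theory:
  fixes K :: "(('u, 'u) module, 'n) tricat"
  assumes "universal_kk l U X K J \<delta> TYPE(('u, 'u) module \<times> 'n)"
  shows "universal_theory (Alg l) K K (alg_ext l U) J \<delta>"
proof -
  have k: "kk_theory l U X K J \<delta>" using assms by (simp add: universal_kk_def)
  then have E: "excisive (Alg l) (alg_ext l U) K J \<delta>" and K: "triangulated K"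
    by (simp_all add: kk_theory_def excisive_def)
  show ?thesis
  proof (intro universal_theory.intro universal_theory_axioms.intro catg.intro triang.intro)
    show "i \<in> Arr (Alg l) \<and> p \<in> Arr (Alg l)" if "(i, p) \<in> alg_ext l U" for i p
      using ext_arrows_Alg that unfolding ext_arrows_def by fast
    show "factors_uniquely (Alg l) (alg_ext l U) K J \<delta> K (comp_func D J) (composite_boundary (Alg l) J \<delta> K D \<chi>)"
      if "triangulated_functor K K D \<chi>" for D \<chi>
      using assms kk_theory_composite[OF k K that] unfolding universal_kk_def by blast
  qed (use assms E K Alg_category in \<open>simp_all add: universal_kk_def\<close>)
qed

lemma universal_kkh_theory:
  fixes K :: "(('u, 'u) star_alg, 'm) tricat"
  assumes "universal_kkh l \<sigma> U X K J \<delta> TYPE(('u, 'u) star_alg \<times> 'm)"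
  shows "universal_theory (StarAlg l \<sigma>) K K (star_ext l \<sigma> U) J \<delta>"
proof -
  have k: "kkh_theory l \<sigma> U X K J \<delta>" using assms by (simp add: universal_kkh_def)
  then have E: "excisive (StarAlg l \<sigma>) (star_ext l \<sigma> U) K J \<delta>" and K: "triangulated K"
    by (simp_all add: kkh_theory_def excisive_def)
  show ?thesis
  proof (intro universal_theory.intro universal_theory_axioms.intro catg.intro triang.intro)
    show "i \<in> Arr (StarAlg l \<sigma>) \<and> p \<in> Arr (StarAlg l \<sigma>)" if "(i, p) \<in> star_ext l \<sigma> U" for i p
      using ext_arrows_StarAlg that unfolding ext_arrows_def by fast
    show "factors_uniquely (StarAlg l \<sigma>) (star_ext l \<sigma> U) K J \<delta> K (comp_func D J)
        (composite_boundary (StarAlg l \<sigma>) J \<delta> K D \<chi>)"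
      if "triangulated_functor K K D \<chi>" for D \<chi>
      using assms kkh_theory_composite[OF k K that] unfolding universal_kkh_def by blast
  qed (use assms E K StarAlg_category in \<open>simp_all add: universal_kkh_def\<close>)
qed

section \<open>The homomorphisms behind the units and counits\<close>

lemma (in pairing) unit_hom:
  assumes A: "is_star_algebra l \<sigma> A"
  shows "(\<lambda>a. pr (a, star A a)) \<in> star_homs l A (ind_ob (module.truncate A))"
proof -
  interpret star_alg l \<sigma> A by (rule star_algI[OF inv_ring A])
  show ?thesis by (intro star_homsI alg_homsI) simp_all
qed

lemma (in pairing) counit_hom: "(\<lambda>z. fst (inv_into UNIV pr z)) \<in> alg_homs l (module.truncate (ind_ob B)) B"
  by (rule alg_homsI) auto

lemma (in pairing) incl_hom:
  assumes B: "is_algebra l B"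
  shows "(\<lambda>b. pr (b, \<zero>\<^bsub>B\<^esub>)) \<in> alg_homs l B (module.truncate (ind_ob B))"
proof -
  interpret alg l B using B by unfold_locales
  show ?thesis by (rule alg_homsI) simp_all
qed

lemma (in pairing_half) pmap_hom:
  assumes B: "is_algebra l B"
  shows "pmap B \<in> alg_homs l B (mat_alg2 B)"
proof -
  interpret alg l B using B by unfold_locales
  have "pmap B (x \<otimes>\<^bsub>B\<^esub> y) = pmap B x \<otimes>\<^bsub>mat_alg2 B\<^esub> pmap B y" if "x \<in> carrier B" "y \<in> carrier B" for x y
    using that by (simp add: pmap_def smult_mult mult_smult lam_eqs lam_eqs_neg R.m_comm flip: smult_assoc1 smult_l_distr)
  then show ?thesis
    by (intro alg_homsI) (auto simp: pmap_def smult_r_distr R.m_comm simp flip: smult_assoc1)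
qed

lemma (in pairing) iota_alg_hom:
  assumes B: "is_algebra l B"
  shows "iota B \<in> alg_homs l B (mat_alg2 B)"
proof -
  interpret alg l B using B by unfold_locales
  show ?thesis by (intro alg_homsI) (simp_all add: iota_def)
qed

theorem proposition9p2:
  fixes l :: "'u ring" and \<sigma> :: "'u \<Rightarrow> 'u" and X :: "'u set" and U :: underlying
    and pr :: "'u \<times> 'u \<Rightarrow> 'u"
    and kkh :: "(('u, 'u) star_alg, 'm) tricat" and kk :: "(('u, 'u) module, 'n) tricat"
  assumes "involutive_ring l \<sigma>"
    and "\<exists>x\<in>carrier l. x \<oplus>\<^bsub>l\<^esub> \<sigma> x = \<one>\<^bsub>l\<^esub>"
    and "infinite X"
    and "inj pr"
    and "universal_kkh l \<sigma> U X kkh jh \<delta>h TYPE(('u, 'u) star_alg \<times> 'm)"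
    and "universal_kkh l \<sigma> U X kkh jh \<delta>h TYPE(('u, 'u) module \<times> 'n)"
    and "universal_kk l U X kk j \<delta> TYPE(('u, 'u) module \<times> 'n)"
    and "universal_kk l U X kk j \<delta> TYPE(('u, 'u) star_alg \<times> 'm)"
    and "induced_res l \<sigma> U kkh jh \<delta>h kk j \<delta> res \<phi>"
    and "induced_ind l \<sigma> U pr kkh jh \<delta>h kk j \<delta> ind \<psi>"
  shows "left_adjoint kkh kk res ind \<and> left_adjoint kk kkh ind res"
proof -
  obtain lam where lam: "lam \<in> carrier l" "lam \<oplus>\<^bsub>l\<^esub> \<sigma> lam = \<one>\<^bsub>l\<^esub>" using assms(2) by blast
  interpret pairing_half l \<sigma> pr U lam
    using assms(1,4) lam by unfold_locales
  \<comment> \<open>The infinite index set makes the universe infinite, so that degrees of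
    polynomials can be encoded in it.\<close>
  have inf: "infinite (UNIV :: 'u set)" using assms(3) finite_subset[of X UNIV] by auto
  interpret UH: universal_theory "StarAlg l \<sigma>" kkh kkh "star_ext l \<sigma> U" jh \<delta>h
    by (rule universal_kkh_theory[OF assms(5)])
  interpret UK: universal_theory "Alg l" kk kk "alg_ext l U" j \<delta>
    by (rule universal_kk_theory[OF assms(7)])
  let ?SA = "StarAlg l \<sigma>" and ?EH = "star_ext l \<sigma> U"
    and ?EA = "alg_ext l U" and ?ri = "comp_func res_alg (ind_alg \<sigma> pr)"
    and ?ir = "comp_func (ind_alg \<sigma> pr) res_alg"
  note extH = ext_arrows_StarAlg[of l \<sigma> U] and extA = ext_arrows_Alg[of l U]
  interpret jh: functr ?SA kkh jh using UH.exc by unfold_locales (simp add: excisive_def)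
  interpret j: functr "Alg l" kk j using UK.exc by unfold_locales (simp add: excisive_def)
  have res: "factors_through ?SA ?EH kkh jh \<delta>h kk (comp_func j res_alg) (pull_boundary \<delta> res_alg) res \<phi>"
    using assms(9) by (simp add: induced_res_def)
  have ind: "factors_through (Alg l) ?EA kk j \<delta> kkh (comp_func jh (ind_alg \<sigma> pr)) (pull_boundary \<delta>h (ind_alg \<sigma> pr)) ind \<psi>"
    using assms(10) by (simp add: induced_ind_def)
  interpret res: trifun kkh kk res \<phi> using res by unfold_locales (simp add: factors_through_def)
  interpret ind: trifun kk kkh ind \<psi> using ind by unfold_locales (simp add: factors_through_def)
  have kk_inv: "homotopy_invariant l kk j" using assms(7) by (simp add: universal_kk_def kk_theory_def)
  have objH: "A \<in> Obj kkh \<longleftrightarrow> is_star_algebra l \<sigma> A" for A by (simp add: UH.Obj_K)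
  have objA: "B \<in> Obj kk \<longleftrightarrow> is_algebra l B" for B by (simp add: UK.Obj_K)
  have ob_jh [simp]: "ob jh A = A" if "is_star_algebra l \<sigma> A" for A using UH.ob_J that by simp
  have ob_j [simp]: "ob j B = B" if "is_algebra l B" for B using UK.ob_J that by simp
  have ob_res [simp]: "ob res A = module.truncate A" if "is_star_algebra l \<sigma> A" for A
    using res that by (auto simp: factors_through_def eq_func_def comp_func_def is_star_algebraD)
  have ob_ind [simp]: "ob ind B = ind_ob B" if "is_algebra l B" for B
    using ind that by (auto simp: factors_through_def eq_func_def comp_func_def)
  have ar_res: "ar res (ar jh f) = ar j (ar res_alg f)" if "f \<in> Arr ?SA" for f
    using res that by (auto simp: factors_through_def eq_func_def comp_func_def)
  have ar_ind: "ar ind (ar j f) = ar jh (ar (ind_alg \<sigma> pr) f)" if "f \<in> Arr (Alg l)" for f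
    using ind that by (auto simp: factors_through_def eq_func_def comp_func_def)
  note [simp] = is_star_algebraD
  have jh_comp: "ar jh (arrow B g C) \<bullet>\<^bsub>kkh\<^esub> ar jh (arrow A f B) = ar jh (arrow A (g \<circ> f) C)"
    if "is_star_algebra l \<sigma> A" "is_star_algebra l \<sigma> B" "is_star_algebra l \<sigma> C" "f \<in> star_homs l A B" "g \<in> star_homs l B C"
    for A B C f g
    using that by (simp add: StarAlg_Arr StarAlg_comp flip: jh.ar_comp)
  have j_comp: "ar j (arrow B g C) \<bullet>\<^bsub>kk\<^esub> ar j (arrow A f B) = ar j (arrow A (g \<circ> f) C)"
    if "is_algebra l A" "is_algebra l B" "is_algebra l C" "f \<in> alg_homs l A B" "g \<in> alg_homs l B C"
    for A B C f g
    using that by (simp add: Alg_Arr Alg_comp flip: j.ar_comp)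
  have jh_Id: "ar jh (arrow A (\<lambda>x. x) A) = Id kkh A" if "is_star_algebra l \<sigma> A" for A
    using jh.ar_Id[of A] that by simp
  have j_Id: "ar j (arrow A (\<lambda>x. x) A) = Id kk A" if "is_algebra l A" for A
    using j.ar_Id[of A] that by simp
  note pext = preserves_ext_Id[OF StarAlg_category] preserves_ext_Id[OF Alg_category]
    preserves_ext_comp[OF StarAlg_category Alg_category StarAlg_category preserves_ext_res preserves_ext_ind]
    preserves_ext_comp[OF Alg_category StarAlg_category Alg_category preserves_ext_ind preserves_ext_res]
  have ir: "factors_through ?SA ?EH kkh jh \<delta>h kkh (comp_func jh ?ir) (pull_boundary \<delta>h ?ir)
      (comp_func ind res) (\<lambda>A. ar ind (\<phi> A) \<bullet>\<^bsub>kkh\<^esub> \<psi> (ob res A))"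
    by (rule factors_through_comp[OF extH extA UH.exc UK.exc UH.K.tri preserves_ext_res res ind])
  have ri: "factors_through (Alg l) ?EA kk j \<delta> kk (comp_func j ?ri) (pull_boundary \<delta> ?ri)
      (comp_func res ind) (\<lambda>A. ar res (\<psi> A) \<bullet>\<^bsub>kk\<^esub> \<phi> (ob ind A))"
    by (rule factors_through_comp[OF extA extH UK.exc UH.exc UK.K.tri preserves_ext_ind ind res])
  note idH = factors_through_Id[OF extH UH.exc] and idA = factors_through_Id[OF extA UK.exc]
  have tr [simp]: "is_algebra l (module.truncate A)" if "is_star_algebra l \<sigma> A" for A :: "('u, 'u) star_alg" using that by simp

  \<comment> \<open>\<open>\<eta>\<close> and \<open>\<epsilon>\<close> are for res left adjoint to
    ind; \<open>\<eta>'\<close>, \<open>\<kappa>\<close> and \<open>\<iota>\<close> are for ind left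
    adjoint to res.\<close>
  define \<eta> where "\<eta> A = arrow A (\<lambda>a. pr (a, star A a)) (ind_ob (module.truncate A))" for A
  define \<epsilon> where "\<epsilon> B = arrow (module.truncate (ind_ob B)) (\<lambda>z. fst (inv_into UNIV pr z)) B" for B
  define \<eta>' where "\<eta>' B = arrow B (\<lambda>b. pr (b, \<zero>\<^bsub>B\<^esub>)) (module.truncate (ind_ob B))" for B
  define \<kappa> where "\<kappa> A = arrow (ind_ob (module.truncate A)) (kappa A) (mat_ob A)" for A
  define \<iota> where "\<iota> A = arrow A (iota A) (mat_ob A)" for A

  \<comment> \<open>Here and below, \<open>jh\<close> and \<open>j\<close> are read as theories
    pulled back along the identity functor, so that \<open>theory_map_transformation\<close> applies
    to transformations from or to the identity.\<close>
  have \<eta>_map: "theory_map ?SA ?EH kkh jh \<delta>h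
      (comp_func jh ?ir) (pull_boundary \<delta>h ?ir) (\<lambda>A. ar jh (\<eta> A))"
  proof (rule theory_map_transformation[OF extH extH UH.exc pext(1) pext(3), unfolded comp_func_Id pull_boundary_Id])
    show "\<eta> A \<in> arrows ?SA (ob Id_func A) (ob ?ir A)" if "A \<in> Obj ?SA" for A
      using that by (auto simp: \<eta>_def Id_func_def comp_func_def intro!: StarAlg_arrow unit_hom)
    show "\<eta> (Cod ?SA f) \<bullet>\<^bsub>?SA\<^esub> ar Id_func f = ar ?ir f \<bullet>\<^bsub>?SA\<^esub> \<eta> (Dom ?SA f)" if "f \<in> Arr ?SA" for f
      using that
    proof (rule StarAlg_ArrE)
      fix A u B assume f: "f = arrow A u B" "is_star_algebra l \<sigma> A" "is_star_algebra l \<sigma> B" "u \<in> star_homs l A B"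
      interpret A: star_alg l \<sigma> A by (rule star_algI[OF inv_ring f(2)])
      show ?thesis using f(2-)
        by (auto simp: f(1) \<eta>_def Id_func_def comp_func_def StarAlg_comp unit_hom star_homsD intro!: arrow_eq)
    qed
  qed
  have \<epsilon>_map: "theory_map (Alg l) ?EA kk (comp_func j ?ri) (pull_boundary \<delta> ?ri)
      j \<delta> (\<lambda>B. ar j (\<epsilon> B))"
  proof (rule theory_map_transformation[OF extA extA UK.exc pext(4) pext(2), unfolded comp_func_Id pull_boundary_Id])
    show "\<epsilon> B \<in> arrows (Alg l) (ob ?ri B) (ob Id_func B)" if "B \<in> Obj (Alg l)" for B
      using that by (auto simp: \<epsilon>_def Id_func_def comp_func_def intro!: Alg_arrow counit_hom)
    show "\<epsilon> (Cod (Alg l) f) \<bullet>\<^bsub>Alg l\<^esub> ar ?ri f = ar Id_func f \<bullet>\<^bsub>Alg l\<^esub> \<epsilon> (Dom (Alg l) f)" if "f \<in> Arr (Alg l)" for f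
      using that
    proof (rule Alg_ArrE)
      fix A u B assume f: "f = arrow A u B" "is_algebra l A" "is_algebra l B" "u \<in> alg_homs l A B"
      have "ind_map u \<in> alg_homs l (module.truncate (ind_ob A)) (module.truncate (ind_ob B))"
        by (intro alg_homs_truncate star_homsD(1) ind_map_hom f)
      then show ?thesis using f(2-)
        by (auto simp: f(1) \<epsilon>_def Id_func_def comp_func_def Alg_comp counit_hom intro!: arrow_eq)
    qed
  qed
  have \<eta>'_map: "theory_map (Alg l) ?EA kk j \<delta>
      (comp_func j ?ri) (pull_boundary \<delta> ?ri) (\<lambda>B. ar j (\<eta>' B))"
  proof (rule theory_map_transformation[OF extA extA UK.exc pext(2) pext(4), unfolded comp_func_Id pull_boundary_Id])
    show "\<eta>' B \<in> arrows (Alg l) (ob Id_func B) (ob ?ri B)" if "B \<in> Obj (Alg l)" for B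
      using that by (auto simp: \<eta>'_def Id_func_def comp_func_def intro!: Alg_arrow incl_hom)
    show "\<eta>' (Cod (Alg l) f) \<bullet>\<^bsub>Alg l\<^esub> ar Id_func f = ar ?ri f \<bullet>\<^bsub>Alg l\<^esub> \<eta>' (Dom (Alg l) f)" if "f \<in> Arr (Alg l)" for f
      using that
    proof (rule Alg_ArrE)
      fix A u B assume f: "f = arrow A u B" "is_algebra l A" "is_algebra l B" "u \<in> alg_homs l A B"
      show ?thesis using f(2-)
        by (auto simp: f(1) \<eta>'_def Id_func_def comp_func_def Alg_comp incl_hom alg_hom_zero intro!: arrow_eq)
    qed
  qed
  have \<kappa>_map: "theory_map ?SA ?EH kkh (comp_func jh ?ir) (pull_boundary \<delta>h ?ir)
      (comp_func jh mat_func) (pull_boundary \<delta>h mat_func) (\<lambda>A. ar jh (\<kappa> A))"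
  proof (rule theory_map_transformation[OF extH extH UH.exc pext(3) preserves_ext_mat, unfolded comp_func_Id pull_boundary_Id])
    show "\<kappa> A \<in> arrows ?SA (ob ?ir A) (ob mat_func A)" if "A \<in> Obj ?SA" for A
      using that by (auto simp: \<kappa>_def comp_func_def intro!: StarAlg_arrow kappa_hom)
    show "\<kappa> (Cod ?SA f) \<bullet>\<^bsub>?SA\<^esub> ar ?ir f = ar mat_func f \<bullet>\<^bsub>?SA\<^esub> \<kappa> (Dom ?SA f)" if "f \<in> Arr ?SA" for f
      using that
    proof (rule StarAlg_ArrE)
      fix A u B assume f: "f = arrow A u B" "is_star_algebra l \<sigma> A" "is_star_algebra l \<sigma> B" "u \<in> star_homs l A B"
      interpret A: star_alg l \<sigma> A by (rule star_algI[OF inv_ring f(2)])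
      have "ind_map u \<in> star_homs l (ind_ob (module.truncate A)) (ind_ob (module.truncate B))"
        by (intro ind_map_hom alg_homs_truncate star_homsD(1) f tr)
      then show ?thesis using f(2-)
        by (auto simp: f(1) \<kappa>_def comp_func_def StarAlg_comp kappa_hom kappa_pr star_homsD(2)
            alg_homsD[OF star_homsD(1)[OF f(4)]] intro!: arrow_eq)
    qed
  qed
  have \<iota>_map: "theory_map ?SA ?EH kkh jh \<delta>h
      (comp_func jh mat_func) (pull_boundary \<delta>h mat_func) (\<lambda>A. ar jh (\<iota> A))"
  proof (rule theory_map_transformation[OF extH extH UH.exc pext(1) preserves_ext_mat, unfolded comp_func_Id pull_boundary_Id])
    show "\<iota> A \<in> arrows ?SA (ob Id_func A) (ob mat_func A)" if "A \<in> Obj ?SA" for A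
      using that by (auto simp: \<iota>_def Id_func_def intro!: StarAlg_arrow iota_hom)
    show "\<iota> (Cod ?SA f) \<bullet>\<^bsub>?SA\<^esub> ar Id_func f = ar mat_func f \<bullet>\<^bsub>?SA\<^esub> \<iota> (Dom ?SA f)" if "f \<in> Arr ?SA" for f
      using that
    proof (rule StarAlg_ArrE)
      fix A u B assume f: "f = arrow A u B" "is_star_algebra l \<sigma> A" "is_star_algebra l \<sigma> B" "u \<in> star_homs l A B"
      show ?thesis using f(2-)
        by (auto simp: f(1) \<iota>_def Id_func_def StarAlg_comp iota_hom iota_def
            alg_hom_zero[OF is_star_algebraD[OF f(2)] is_star_algebraD[OF f(3)] star_homsD(1)[OF f(4)]] intro!: arrow_eq)
    qed
  qed
  have \<iota>_Arr: "\<iota> A \<in> Arr ?SA" if "is_star_algebra l \<sigma> A" for A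
    using that by (simp add: \<iota>_def StarAlg_Arr iota_hom)
  have \<kappa>_Arr: "\<kappa> A \<in> Arr ?SA" if "is_star_algebra l \<sigma> A" for A
    using that by (simp add: \<kappa>_def StarAlg_Arr kappa_hom)
  have \<iota>_iso: "iso_arrow kkh (ar jh (\<iota> A))" if A: "is_star_algebra l \<sigma> A" for A
  proof -
    have "iota_stable l \<sigma> kkh jh" using assms(5) by (simp add: universal_kkh_def kkh_theory_def)
    then have "iso_arrow kkh (ar jh (arrow A (tau A (mat_unit l 1 1)) (mat_ob A)))"
      unfolding iota_stable_def using A tau_tensor[OF A] by blast
    also have "arrow A (tau A (mat_unit l 1 1)) (mat_ob A) = \<iota> A"
      unfolding \<iota>_def by (rule arrow_eq) (use A in \<open>simp add: iota_tau\<close>)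
    finally show ?thesis .
  qed
  define \<iota>' where "\<iota>' A = (SOME g. g \<in> arrows kkh (mat_ob A) A \<and> g \<bullet>\<^bsub>kkh\<^esub> ar jh (\<iota> A) = Id kkh A \<and>
      ar jh (\<iota> A) \<bullet>\<^bsub>kkh\<^esub> g = Id kkh (mat_ob A))" for A
  have \<iota>': "\<iota>' A \<in> arrows kkh (mat_ob A) A \<and> \<iota>' A \<bullet>\<^bsub>kkh\<^esub> ar jh (\<iota> A) = Id kkh A \<and>
      ar jh (\<iota> A) \<bullet>\<^bsub>kkh\<^esub> \<iota>' A = Id kkh (mat_ob A)" if A: "is_star_algebra l \<sigma> A" for A
    unfolding \<iota>'_def
    by (rule someI_ex)
      (use \<iota>_iso[OF A] A \<iota>_Arr[OF A] in \<open>auto simp: iso_arrow_def arrows_def \<iota>_def\<close>)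
  define \<epsilon>' where "\<epsilon>' A = \<iota>' A \<bullet>\<^bsub>kkh\<^esub> ar jh (\<kappa> A)" for A
  \<comment> \<open>\<open>\<kappa>\<close> and \<open>\<iota>\<close> both end in the theory
    sending A to \<open>jh\<close> of M_pm A, so the inverse of the second may be composed with the
    first.\<close>
  have \<epsilon>'_map: "theory_map ?SA ?EH kkh (comp_func jh ?ir) (pull_boundary \<delta>h ?ir) jh \<delta>h \<epsilon>'"
    using theory_map_comp_inverse[OF extH excisive_pull[OF extH extH UH.exc pext(3)]
      excisive_pull[OF extH extH UH.exc preserves_ext_mat] UH.exc \<kappa>_map \<iota>_map, of \<iota>'] \<iota>'
    by (simp add: \<epsilon>'_def[abs_def] comp_func_def)

  have nat_\<eta>: "ar jh (\<eta> (Cod kkh f)) \<bullet>\<^bsub>kkh\<^esub> f = ar ind (ar res f) \<bullet>\<^bsub>kkh\<^esub> ar jh (\<eta> (Dom kkh f))" if "f \<in> Arr kkh" for f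
    using UH.factors_through_natural[OF idH ir \<eta>_map that] by (simp add: Id_func_def comp_func_def)
  have nat_\<epsilon>: "ar j (\<epsilon> (Cod kk f)) \<bullet>\<^bsub>kk\<^esub> ar res (ar ind f) = f \<bullet>\<^bsub>kk\<^esub> ar j (\<epsilon> (Dom kk f))" if "f \<in> Arr kk" for f
    using UK.factors_through_natural[OF ri idA \<epsilon>_map that] by (simp add: Id_func_def comp_func_def)
  have nat_\<eta>': "ar j (\<eta>' (Cod kk f)) \<bullet>\<^bsub>kk\<^esub> f = ar res (ar ind f) \<bullet>\<^bsub>kk\<^esub> ar j (\<eta>' (Dom kk f))" if "f \<in> Arr kk" for f
    using UK.factors_through_natural[OF idA ri \<eta>'_map that] by (simp add: Id_func_def comp_func_def)
  have nat_\<epsilon>': "\<epsilon>' (Cod kkh f) \<bullet>\<^bsub>kkh\<^esub> ar ind (ar res f) = f \<bullet>\<^bsub>kkh\<^esub> \<epsilon>' (Dom kkh f)" if "f \<in> Arr kkh" for f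
    using UH.factors_through_natural[OF ir idH \<epsilon>'_map that] by (simp add: Id_func_def comp_func_def)
  have iota_pmap: "ar j (arrow B (iota B) (mat_alg2 B)) = ar j (arrow B (pmap B) (mat_alg2 B))" if "is_algebra l B" for B
    by (rule iota_pmap_homotopic[OF inf UK.K.cat j.is_fun kk_inv that])

  have "left_adjoint kkh kk res ind"
  proof (rule left_adjointI[where \<eta> = "\<lambda>A. ar jh (\<eta> A)" and \<epsilon> = "\<lambda>B. ar j (\<epsilon> B)",
        OF UH.K.pre UK.K.pre res.addfun ind.addfun _ _ nat_\<eta> nat_\<epsilon>])
    show "ar jh (\<eta> A) \<in> arrows kkh A (ob ind (ob res A))" if "A \<in> Obj kkh" for A
      using that by (auto simp: objH \<eta>_def arrows_def StarAlg_Arr unit_hom)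
    show "ar j (\<epsilon> B) \<in> arrows kk (ob res (ob ind B)) B" if "B \<in> Obj kk" for B
      using that by (auto simp: objA \<epsilon>_def arrows_def Alg_Arr counit_hom)
    show "ar j (\<epsilon> (ob res A)) \<bullet>\<^bsub>kk\<^esub> ar res (ar jh (\<eta> A)) = Id kk (ob res A)" if "A \<in> Obj kkh" for A
    proof -
      have A: "is_star_algebra l \<sigma> A" using that by (simp add: objH)
      note u = alg_homs_truncate[OF star_homsD(1)[OF unit_hom[OF A]]]
      show ?thesis using A
        by (auto simp: \<epsilon>_def \<eta>_def ar_res StarAlg_Arr unit_hom j_comp[OF _ _ _ u counit_hom] comp_def j_Id)
    qed
    show "ar ind (ar j (\<epsilon> B)) \<bullet>\<^bsub>kkh\<^esub> ar jh (\<eta> (ob ind B)) = Id kkh (ob ind B)" if "B \<in> Obj kk" for B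
    proof -
      have B: "is_algebra l B" using that by (simp add: objA)
      \<comment> \<open>On (x, y) the unit gives ((x, y), (y, x)), and the first projections of both
        members return (x, y).\<close>
      have "arrow (ind_ob B) (ind_map (\<lambda>z. fst (inv_into UNIV pr z)) \<circ> (\<lambda>a. pr (a, star (ind_ob B) a))) (ind_ob B) =
          arrow (ind_ob B) (\<lambda>x. x) (ind_ob B)"
        by (rule arrow_eq) auto
      then show ?thesis using B
        by (simp add: \<epsilon>_def \<eta>_def ar_ind Alg_Arr counit_hom unit_hom jh_comp ind_map_hom jh_Id)
    qed
  qed
  moreover have "left_adjoint kk kkh ind res"
  proof (rule left_adjointI[where \<eta> = "\<lambda>B. ar j (\<eta>' B)" and \<epsilon> = \<epsilon>',
        OF UK.K.pre UH.K.pre ind.addfun res.addfun _ _ nat_\<eta>' nat_\<epsilon>'])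
    show "ar j (\<eta>' B) \<in> arrows kk B (ob res (ob ind B))" if "B \<in> Obj kk" for B
      using that by (auto simp: objA \<eta>'_def arrows_def Alg_Arr incl_hom)
    show "\<epsilon>' A \<in> arrows kkh (ob ind (ob res A)) A" if "A \<in> Obj kkh" for A
      using that \<iota>'[of A] \<kappa>_Arr[of A] by (auto simp: objH \<epsilon>'_def arrows_def \<kappa>_def)
    show "\<epsilon>' (ob ind B) \<bullet>\<^bsub>kkh\<^esub> ar ind (ar j (\<eta>' B)) = Id kkh (ob ind B)" if "B \<in> Obj kk" for B
    proof -
      have B: "is_algebra l B" using that by (simp add: objA)
      let ?I = "ind_ob B" and ?M = "mat_alg2 B"
      let ?\<theta> = "arrow (ind_ob ?M) (theta B) (mat_ob ?I)"
      \<comment> \<open>The composite is rewritten as \<open>theta\<close> after ind of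
        \<open>pmap\<close>; once \<open>pmap\<close> is exchanged for \<open>iota\<close>,
        \<open>theta\<close> turns the result back into \<open>\<iota> ?I\<close>, which
        \<open>\<iota>'\<close> inverts.\<close>
      have "ar jh (\<kappa> ?I) \<bullet>\<^bsub>kkh\<^esub> ar ind (ar j (\<eta>' B)) =
          ar jh (arrow ?I (kappa ?I \<circ> ind_map (\<lambda>b. pr (b, \<zero>\<^bsub>B\<^esub>))) (mat_ob ?I))"
        using B by (simp add: \<kappa>_def \<eta>'_def ar_ind Alg_Arr incl_hom jh_comp ind_map_hom kappa_hom)
      also have "arrow ?I (kappa ?I \<circ> ind_map (\<lambda>b. pr (b, \<zero>\<^bsub>B\<^esub>))) (mat_ob ?I) =
          arrow ?I (theta B \<circ> ind_map (pmap B)) (mat_ob ?I)"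
        by (rule arrow_eq) (simp only: comp_apply theta_pmap[OF B])
      also have "ar jh \<dots> = ar jh ?\<theta> \<bullet>\<^bsub>kkh\<^esub> ar ind (ar j (arrow B (pmap B) ?M))"
        using B by (simp add: ar_ind Alg_Arr pmap_hom jh_comp ind_map_hom theta_hom)
      \<comment> \<open>The one step of this chain that is not an equality of homomorphisms: the
        homotopy is used in kk and then carried over by ind.\<close>
      also have "\<dots> = ar jh ?\<theta> \<bullet>\<^bsub>kkh\<^esub> ar ind (ar j (arrow B (iota B) ?M))"
        by (simp add: iota_pmap[OF B])
      also have "\<dots> = ar jh (arrow ?I (theta B \<circ> ind_map (iota B)) (mat_ob ?I))"
        using B by (simp add: ar_ind Alg_Arr iota_alg_hom jh_comp ind_map_hom theta_hom)
      also have "arrow ?I (theta B \<circ> ind_map (iota B)) (mat_ob ?I) = \<iota> ?I"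
        unfolding \<iota>_def by (rule arrow_eq) (simp only: comp_apply theta_iota[OF B])
      finally have "ar jh (\<kappa> ?I) \<bullet>\<^bsub>kkh\<^esub> ar ind (ar j (\<eta>' B)) = ar jh (\<iota> ?I)" .
      moreover have "\<epsilon>' ?I \<bullet>\<^bsub>kkh\<^esub> ar ind (ar j (\<eta>' B)) = \<iota>' ?I \<bullet>\<^bsub>kkh\<^esub> ar jh (\<kappa> ?I) \<bullet>\<^bsub>kkh\<^esub> ar ind (ar j (\<eta>' B))"
      proof -
        have "\<eta>' B \<in> Arr (Alg l)" using B by (simp add: \<eta>'_def Alg_Arr incl_hom)
        then show ?thesis
          using B \<iota>'[of ?I] \<kappa>_Arr[of ?I] by (simp add: \<epsilon>'_def arrows_def) (simp add: \<kappa>_def \<eta>'_def)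
      qed
      ultimately show ?thesis using B \<iota>'[of ?I] by simp
    qed
    show "ar res (\<epsilon>' A) \<bullet>\<^bsub>kk\<^esub> ar j (\<eta>' (ob res A)) = Id kk (ob res A)" if "A \<in> Obj kkh" for A
    proof -
      have A: "is_star_algebra l \<sigma> A" using that by (simp add: objH)
      let ?A = "module.truncate A"
      have \<iota>'A: "\<iota>' A \<in> Arr kkh" "Dom kkh (\<iota>' A) = mat_ob A" "Cod kkh (\<iota>' A) = A"
        using \<iota>'[OF A] by (simp_all add: arrows_def)
      have k: "kappa A \<in> alg_homs l (module.truncate (ind_ob ?A)) (mat_alg2 ?A)"
        using alg_homs_truncate[OF star_homsD(1)[OF kappa_hom[OF A]]] by (simp add: truncate_mat_ob)
      have "ar res (ar jh (\<kappa> A)) \<bullet>\<^bsub>kk\<^esub> ar j (\<eta>' ?A) = ar j (arrow ?A (kappa A \<circ> (\<lambda>b. pr (b, \<zero>\<^bsub>?A\<^esub>))) (mat_alg2 ?A))"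
        using A \<kappa>_Arr[OF A] by (simp add: ar_res, simp add: \<kappa>_def \<eta>'_def truncate_mat_ob j_comp[OF _ _ _ incl_hom[OF tr[OF A], simplified] k])
      also have "arrow ?A (kappa A \<circ> (\<lambda>b. pr (b, \<zero>\<^bsub>?A\<^esub>))) (mat_alg2 ?A) = arrow ?A (pmap ?A) (mat_alg2 ?A)"
        by (rule arrow_eq) (use kappa_unit[OF A] in \<open>simp add: pmap_def\<close>)
      \<comment> \<open>Restriction has forgotten the involution of M_pm A, so the homotopy applies
        directly to the algebra underlying A.\<close>
      also have "ar j \<dots> = ar j (arrow ?A (iota ?A) (mat_alg2 ?A))"
        using iota_pmap[of ?A] A by simp
      also have "\<dots> = ar res (ar jh (\<iota> A))"
        using \<iota>_Arr[OF A] by (simp add: ar_res) (simp add: \<iota>_def truncate_mat_ob iota_def[abs_def])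
      finally have 1: "ar res (ar jh (\<kappa> A)) \<bullet>\<^bsub>kk\<^esub> ar j (\<eta>' ?A) = ar res (ar jh (\<iota> A))" .
      have \<eta>A: "\<eta>' ?A \<in> Arr (Alg l)"
        unfolding \<eta>'_def by (rule Alg_Arr) (use A incl_hom[OF tr[OF A]] in simp_all)
      have "ar res (\<epsilon>' A) \<bullet>\<^bsub>kk\<^esub> ar j (\<eta>' ?A) = ar res (\<iota>' A) \<bullet>\<^bsub>kk\<^esub> ar res (ar jh (\<kappa> A)) \<bullet>\<^bsub>kk\<^esub> ar j (\<eta>' ?A)"
        using A \<iota>'A \<kappa>_Arr[OF A] \<eta>A by (simp add: \<epsilon>'_def \<kappa>_def \<eta>'_def)
      also have "\<dots> = ar res (\<iota>' A \<bullet>\<^bsub>kkh\<^esub> ar jh (\<iota> A))"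
        unfolding 1 using A \<iota>'A \<iota>_Arr[OF A] by (simp add: \<iota>_def)
      also have "\<dots> = Id kk (ob res A)"
        using \<iota>'[OF A] A by (simp add: objH)
      finally show ?thesis using A by simp
    qed
  qed
  ultimately show ?thesis ..
qed

end
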